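(* Let $X,Y,Z$ be Hilbert spaces with $Y\subset Z$, $A:X\to Y$ a bounded linear operator, and let $y^\delta=Af^\dagger+\delta\zeta$ with $f^\dagger\in X$, $\delta\ge 0$, $\zeta\in Z$. Assume: (i) (noise) $\mathcal{E}:Y\to Z$, $y\mapsto y$, is a bounded linear embedding operator such that $\eta:=\mathcal{E}^*\zeta\in Y$ satisfies $\|\eta\|_Y\le 1$; (ii) (source condition) $\varphi$ is an index function and $f^\dagger=\varphi(A^*A)w$ for some $w\in X$ with $\|w\|_X\le 1$; (iii) (link condition) there exist an index function $\psi$ and constants $0<m\le 1\le M<\infty$ with $$ m\|\psi(AA^* )v\|_Y\le\|(\mathcal{E}\mathcal{E}^* )^{1/2}v\|_Y\le M\|\psi(AA^* )v\|_Y\qquad\forall\, v\in Y. $$ Set $T:=\mathcal{E}^*A$, $g^\delta:=\mathcal{E}^*y^\delta$, $\Theta(\lambda):=\sqrt{\lambda}\,\psi(\lambda)$ and $f_0(t):=\big((\Theta^2)^{-1}(t)\big)^{1/2}$ for $t>0$, and assume that $f_0^2$ is an operator concave function. Let $q_\alpha$ be a regularization with qualification $\rho$, and let $f_\alpha^\delta:=q_\alpha(T^*T)T^*g^\delta$. 1. If $1\prec\varphi\prec\Theta$ and the function $\lambda\mapsto\varphi(f_0^2(\lambda))/\rho(\lambda)$ is non-increasing, then $$ \|f^\dagger-f_\alpha^\delta\|_X\le C\Big(\varphi(f_0^2(\alpha))+\frac{\delta}{\sqrt{\alpha}}\Big),\qquad 0<\alpha\le a, $$ where the constant $C$ depends on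 the regularization scheme and the link condition (in particular not on $\alpha$ and $\delta$). 2. If $\Theta\prec\varphi\prec\Theta^\mu$, the function $\lambda\mapsto\varphi(f_0^2(\lambda))/\rho(\lambda)$ is non-increasing, and the following lifting condition holds with a sufficiently large $\mu>1$ (meaning: $\mu$ is so large that $t\mapsto\varphi^2\big((\Theta^{2\mu})^{-1}(t)\big)$ is operator concave): there are constants $0<m\le 1\le M<\infty$ with $$ m^\mu\|\Theta^\mu(A^*A)w\|_X\le\|(T^*T)^{\mu/2}w\|_X\le M^\mu\|\Theta^\mu(A^*A)w\|_X\qquad\forall\, w\in X, $$ then $$ \|f^\dagger-f_\alpha^\delta\|_X\le C\Big(\varphi(f_0^2(\alpha))+\frac{\delta}{\sqrt{\alpha}}\Big),\qquad 0<\alpha\le a, $$ where the constant $C$ depends on the regularization scheme and the lifting condition (in particular not on $\alpha$ and $\delta$).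
   Context: Index function: a function $\varphi:[0,\infty)\to[0,\infty)$ that is non-decreasing, continuous, positive on $(0,\infty)$, with $\varphi(0)=0$. Partial ordering: $\varphi_1\prec\varphi_2$ means that $t\mapsto\varphi_2(t)/\varphi_1(t)$ is an index function (i.e. $\varphi_2$ tends to zero faster than $\varphi_1$); here $1$ denotes the constant function. Since $\psi$ is an index function, $\Theta^2(\lambda)=\lambda\psi^2(\lambda)$ is a strictly increasing continuous bijection of $[0,\infty)$, so $(\Theta^2)^{-1}$ is defined; $\Theta^{\mu}(\lambda)=(\Theta(\lambda))^\mu$ and $\Theta^{2\mu}(\lambda)=(\Theta(\lambda))^{2\mu}$. Regularization: with $a:=\|T^*T\|$, a family of (Borel) functions $q_\alpha(\lambda)$, $0<\alpha\le a$, is called a regularization if there are finite constants $\gamma,\gamma_*$ with $$\sup_{0<\lambda\le a}|1-\lambda q_\alpha(\lambda)|\le\gamma,\qquad \sup_{0<\lambda\le a}|q_\alpha(\lambda)|\le\frac{\gamma_*}{\alpha},\qquad 0<\alpha\le a.$$ It has qualification $\rho:(0,a]\to\mathbb{R}_+$ (positive valued) if $$\sup_{0<\lambda\le a}|1-\lambda q_\alpha(\lambda)|\,\rho(\lambda)\le\gamma\rho(\alpha),\qquad 0<\alpha\le a.$$ Functions of selfadjoint nonnegative operators are understood via the functional calculus. A real function $h$ on $[0,\infty)$ is operator concave if $h(tB_1+(1-t)B_2)\ge t\,h(B_1)+(1-t)h(B_2)$ for all bounded nonnegative selfadjoint operators $B_1,B_2$ on a Hilbert space and $t\in[0,1]$.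 Convention on $\mathcal{E}^*$ and $\mathcal{E}\mathcal{E}^*$: the adjoint is $\mathcal{E}^*:Z\to Y$, and it is applied to elements of $Y\subset Z$ through the embedding, so that $T=\mathcal{E}^*A:X\to Y$ is bounded and $g^\delta=Tf^\dagger+\delta\eta$. The symbol $\mathcal{E}\mathcal{E}^*$, when acting on $Y$, denotes the nonnegative selfadjoint operator on $Y$ for which $T^*T=A^*\mathcal{E}\mathcal{E}^*A$; that is, with $S:=\mathcal{E}^*|_Y:Y\to Y$, $\mathcal{E}\mathcal{E}^*$ stands for $S^*S$ (adjoint in $Y$), so $\|(\mathcal{E}\mathcal{E}^* )^{1/2}v\|_Y=\|\mathcal{E}^*v\|_Y$. *)

theory Defs
  imports "HOL-Analysis.Analysis"
begin

section \<open>Index functions\<close>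

text \<open>Functions on the half line are total functions on the reals whose values on the negative
  numbers are never used.\<close>

definition index_function :: "(real \<Rightarrow> real) \<Rightarrow> bool" where
  "index_function \<phi> \<longleftrightarrow>
     mono_on {0..} \<phi> \<and> continuous_on {0..} \<phi> \<and> (\<forall>t>0. 0 < \<phi> t) \<and> \<phi> 0 = 0"

text \<open>If both functions vanish at zero, the quotient at zero is \<open>0 / 0 = 0\<close>, which is the
  value an index function must have there; continuity of the quotient at zero then says that
  it tends to zero.\<close>

definition index_less :: "(real \<Rightarrow> real) \<Rightarrow> (real \<Rightarrow> real) \<Rightarrow> bool" (infix "\<prec>\<^sub>I" 50) where
  "\<phi>\<^sub>1 \<prec>\<^sub>I \<phi>\<^sub>2 \<longleftrightarrow> index_function (\<lambda>t. \<phi>\<^sub>2 t / \<phi>\<^sub>1 t)"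

definition Theta :: "(real \<Rightarrow> real) \<Rightarrow> real \<Rightarrow> real" where
  "Theta \<psi> s = sqrt s * \<psi> s"

text \<open>The inverse is taken on the half line, so \<open>f0 \<psi> 0 = 0\<close> for an index function \<open>\<psi>\<close>.\<close>

definition f0 :: "(real \<Rightarrow> real) \<Rightarrow> real \<Rightarrow> real" where
  "f0 \<psi> t = sqrt (inv_into {0..} (\<lambda>s. (Theta \<psi> s)\<^sup>2) t)"


section \<open>Functional calculus of nonnegative selfadjoint operators\<close>

definition selfadjoint :: "('a::real_inner \<Rightarrow> 'a) \<Rightarrow> bool" where
  "selfadjoint B \<longleftrightarrow> bounded_linear B \<and> (\<forall>x y. B x \<bullet> y = x \<bullet> B y)"

definition nonneg_selfadjoint :: "('a::real_inner \<Rightarrow> 'a) \<Rightarrow> bool" where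
  "nonneg_selfadjoint B \<longleftrightarrow> selfadjoint B \<and> (\<forall>x. 0 \<le> B x \<bullet> x)"

definition projection_valued_measure :: "(real set \<Rightarrow> 'a::real_inner \<Rightarrow> 'a) \<Rightarrow> bool" where
  "projection_valued_measure P \<longleftrightarrow>
     (\<forall>S\<in>sets borel. selfadjoint (P S) \<and> P S \<circ> P S = P S) \<and>
     P UNIV = id \<and>
     (\<forall>F. range F \<subseteq> sets borel \<longrightarrow> disjoint_family F \<longrightarrow>
        (\<forall>x. (\<lambda>n::nat. P (F n) x) sums P (\<Union>n. F n) x))"

definition scalar_measure :: "(real set \<Rightarrow> 'a::real_inner \<Rightarrow> 'a) \<Rightarrow> 'a \<Rightarrow> real measure" where
  "scalar_measure P x = measure_of UNIV (sets borel) (\<lambda>S. ennreal (P S x \<bullet> x))"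

text \<open>The spectrum of a nonnegative selfadjoint \<open>B\<close> lies in the interval from \<open>0\<close> to the
  operator norm of \<open>B\<close>, which therefore carries the spectral measure.\<close>

definition spectral_measure ::
    "('a::real_inner \<Rightarrow> 'a) \<Rightarrow> (real set \<Rightarrow> 'a \<Rightarrow> 'a) \<Rightarrow> bool" where
  "spectral_measure B P \<longleftrightarrow>
     projection_valued_measure P \<and> P {0..onorm B} = id \<and>
     (\<forall>x. B x \<bullet> x = (LINT s:{0..onorm B}|scalar_measure P x. s))"

text \<open>\<open>fun_calc h B\<close> is the operator \<open>h(B) = \<integral> h dP\<close> for the spectral measure \<open>P\<close> of the bounded
  nonnegative selfadjoint operator \<open>B\<close>, where \<open>h\<close> is real, Borel and bounded on the interval
  carrying \<open>P\<close>. By the spectral theorem \<open>P\<close> is unique on the Borel sets, and a selfadjoint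
  operator is determined by its quadratic form.\<close>

definition fun_calc :: "(real \<Rightarrow> real) \<Rightarrow> ('a::real_inner \<Rightarrow> 'a) \<Rightarrow> 'a \<Rightarrow> 'a" where
  "fun_calc h B =
     (THE H. \<exists>P. spectral_measure B P \<and> selfadjoint H \<and>
        (\<forall>x. H x \<bullet> x = (LINT s:{0..onorm B}|scalar_measure P x. h s)))"

text \<open>A type argument names the Hilbert space on which the operators act. Concavity on all
  Hilbert spaces implies concavity on each particular one.\<close>

definition operator_concave :: "'a::{real_inner,complete_space} itself \<Rightarrow> (real \<Rightarrow> real) \<Rightarrow> bool" where
  "operator_concave _ h \<longleftrightarrow>
     (\<forall>(B\<^sub>1 :: 'a \<Rightarrow> 'a) B\<^sub>2 t.
        nonneg_selfadjoint B\<^sub>1 \<longrightarrow> nonneg_selfadjoint B\<^sub>2 \<longrightarrow> 0 \<le> t \<longrightarrow> t \<le> 1 \<longrightarrow>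
        (\<forall>x. t * (fun_calc h B\<^sub>1 x \<bullet> x) + (1 - t) * (fun_calc h B\<^sub>2 x \<bullet> x)
              \<le> fun_calc h (\<lambda>v. t *\<^sub>R B\<^sub>1 v + (1 - t) *\<^sub>R B\<^sub>2 v) x \<bullet> x))"


section \<open>Regularization\<close>

definition regularization ::
    "real \<Rightarrow> (real \<Rightarrow> real \<Rightarrow> real) \<Rightarrow> real \<Rightarrow> real \<Rightarrow> bool" where
  "regularization a q \<gamma> \<gamma>\<^sub>s \<longleftrightarrow>
     (\<forall>\<alpha>\<in>{0<..a}.
        q \<alpha> \<in> borel_measurable (restrict_space borel {0<..a}) \<and>
        (\<forall>s\<in>{0<..a}. \<bar>1 - s * q \<alpha> s\<bar> \<le> \<gamma>) \<and>
        (\<forall>s\<in>{0<..a}. \<bar>q \<alpha> s\<bar> \<le> \<gamma>\<^sub>s / \<alpha>))"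

definition qualification ::
    "real \<Rightarrow> (real \<Rightarrow> real \<Rightarrow> real) \<Rightarrow> real \<Rightarrow> (real \<Rightarrow> real) \<Rightarrow> bool" where
  "qualification a q \<gamma> \<rho> \<longleftrightarrow>
     (\<forall>s\<in>{0<..a}. 0 < \<rho> s) \<and>
     (\<forall>\<alpha>\<in>{0<..a}. \<forall>s\<in>{0<..a}. \<bar>1 - s * q \<alpha> s\<bar> * \<rho> s \<le> \<gamma> * \<rho> \<alpha>)"


section \<open>The operator equation with large noise\<close>

text \<open>The inclusion of \<open>Y\<close> in \<open>Z\<close> is an injective bounded linear map \<open>E\<close>. The adjoint of \<open>E\<close> maps
  \<open>Z\<close> to \<open>Y\<close>, and acts on \<open>Y\<close> through \<open>E\<close>.\<close>

definition adj_on_Y ::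
    "('y::real_inner \<Rightarrow> 'z::real_inner) \<Rightarrow> 'y \<Rightarrow> 'y" where
  "adj_on_Y E = adjoint E \<circ> E"

definition sym_op ::
    "('x::real_inner \<Rightarrow> 'y::real_inner) \<Rightarrow> ('y \<Rightarrow> 'z::real_inner) \<Rightarrow> 'x \<Rightarrow> 'y" where
  "sym_op A E = adj_on_Y E \<circ> A"

text \<open>The operator written \<open>E E\<^sup>*\<close> on \<open>Y\<close> is \<open>S\<^sup>* S\<close>, where \<open>S\<close> is the adjoint of \<open>E\<close> restricted
  to \<open>Y\<close>.\<close>

definition link_condition ::
    "('x::real_inner \<Rightarrow> 'y::real_inner) \<Rightarrow> ('y \<Rightarrow> 'z::real_inner) \<Rightarrow> (real \<Rightarrow> real)
       \<Rightarrow> real \<Rightarrow> real \<Rightarrow> bool" where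
  "link_condition A E \<psi> m M \<longleftrightarrow>
     0 < m \<and> m \<le> 1 \<and> 1 \<le> M \<and>
     (\<forall>v. m * norm (fun_calc \<psi> (A \<circ> adjoint A) v)
            \<le> norm (fun_calc sqrt (adjoint (adj_on_Y E) \<circ> adj_on_Y E) v) \<and>
          norm (fun_calc sqrt (adjoint (adj_on_Y E) \<circ> adj_on_Y E) v)
            \<le> M * norm (fun_calc \<psi> (A \<circ> adjoint A) v))"

definition lifting_condition ::
    "('x::real_inner \<Rightarrow> 'y::real_inner) \<Rightarrow> ('y \<Rightarrow> 'z::real_inner) \<Rightarrow> (real \<Rightarrow> real)
       \<Rightarrow> real \<Rightarrow> real \<Rightarrow> real \<Rightarrow> bool" where
  "lifting_condition A E \<psi> \<mu> m M \<longleftrightarrow>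
     0 < m \<and> m \<le> 1 \<and> 1 \<le> M \<and>
     (\<forall>w. m powr \<mu> * norm (fun_calc (\<lambda>s. Theta \<psi> s powr \<mu>) (adjoint A \<circ> A) w)
            \<le> norm (fun_calc (\<lambda>s. s powr (\<mu> / 2)) (adjoint (sym_op A E) \<circ> sym_op A E) w) \<and>
          norm (fun_calc (\<lambda>s. s powr (\<mu> / 2)) (adjoint (sym_op A E) \<circ> sym_op A E) w)
            \<le> M powr \<mu> * norm (fun_calc (\<lambda>s. Theta \<psi> s powr \<mu>) (adjoint A \<circ> A) w))"

definition source_condition ::
    "('x::real_inner \<Rightarrow> 'y::real_inner) \<Rightarrow> (real \<Rightarrow> real) \<Rightarrow> 'x \<Rightarrow> bool" where
  "source_condition A \<phi> f \<longleftrightarrow>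
     index_function \<phi> \<and> (\<exists>w. norm w \<le> 1 \<and> f = fun_calc \<phi> (adjoint A \<circ> A) w)"

definition noisy_data ::
    "('x::real_inner \<Rightarrow> 'y::real_inner) \<Rightarrow> ('y \<Rightarrow> 'z::real_inner) \<Rightarrow> 'x \<Rightarrow> real \<Rightarrow> 'z \<Rightarrow> 'z" where
  "noisy_data A E f \<delta> \<zeta> = E (A f) + \<delta> *\<^sub>R \<zeta>"

definition reconstruction ::
    "('x::real_inner \<Rightarrow> 'y::real_inner) \<Rightarrow> ('y \<Rightarrow> 'z::real_inner) \<Rightarrow> (real \<Rightarrow> real \<Rightarrow> real)
       \<Rightarrow> real \<Rightarrow> 'z \<Rightarrow> 'x" where
  "reconstruction A E q \<alpha> y =
     fun_calc (q \<alpha>) (adjoint (sym_op A E) \<circ> sym_op A E) (adjoint (sym_op A E) (adjoint E y))"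

end

theory Submission
  imports Defs "HOL-Probability.Helly_Selection" "HOL-Probability.Probability_Mass_Function"
begin

text \<open>
  Write \<open>T = sym_op A E\<close>, \<open>B = T\<^sup>* T\<close>, \<open>H = A\<^sup>* A\<close> and \<open>r s = 1 - s * q \<alpha> s\<close>. The error is
  \<open>r(B) f - \<delta> *\<^sub>R q\<^sub>\<alpha>(B) T\<^sup>* \<eta>\<close> with \<open>\<eta> = adjoint E \<zeta>\<close>. The second term is of order \<open>\<delta> / sqrt \<alpha>\<close>
  because \<open>s * (q \<alpha> s)\<^sup>2\<close> is at most \<open>(1 + \<gamma>) * \<gamma>\<^sub>s / \<alpha>\<close> on the spectrum (\<open>noise_propagation\<close>).

  For the bias, \<open>f = \<phi>(H) w\<close>. Both the link condition, with \<open>\<mu> = 1\<close>, and the lifting condition say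
  that the quadratic form of \<open>\<Theta>\<^sup>2\<^sup>\<mu>(H)\<close> is dominated by a multiple \<open>\<kappa>\<close> of that of \<open>B\<^sup>\<mu>\<close>; the link
  condition is used at \<open>v = A x\<close>, where \<open>\<psi>(A A\<^sup>*) A = A \<psi>(A\<^sup>* A)\<close>. The relation \<open>\<phi> \<prec> \<Theta>\<^sup>\<mu>\<close> says that
  \<open>\<phi>\<^sup>2 = \<omega> \<circ> \<Theta>\<^sup>2\<^sup>\<mu>\<close> for a quasi-concave \<open>\<omega>\<close>: both \<open>\<omega> t\<close> and \<open>t / \<omega> t\<close> are nondecreasing. Up to
  constant factors and an arbitrarily small error near \<open>0\<close>, \<open>\<omega>\<close> is a sum of functions \<open>c * min t \<sigma>\<close> with
  \<open>c \<ge> 0\<close>, by passing to a concave majorant and interpolating it on a dyadic grid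
  (\<open>quasi_concave_approximation\<close>). For a single
  minimum, domination of forms is inherited up to a factor \<open>2\<close>, by Peetre's K-functional: the form of
  \<open>min \<sigma> d\<close> is comparable to the infimum over decompositions \<open>x = y + z\<close> of the form of \<open>d\<close> at \<open>y\<close>
  plus \<open>\<sigma>\<close> times the squared norm of \<open>z\<close>, which is monotone in the form (\<open>min_comparison\<close>).
  Together, \<open>\<parallel>\<phi>(H) x\<parallel> \<le> 4 sqrt \<kappa> \<parallel>\<phi>(f0\<^sup>2(B)) x\<parallel>\<close> (\<open>source_comparison\<close>), with a constant that does not
  depend on \<open>\<phi>\<close>. By duality the norm of \<open>r(B) \<phi>(H) w\<close> is at most \<open>4 sqrt \<kappa>\<close> times the supremum of
  \<open>\<bar>\<phi>((f0 \<psi> s)\<^sup>2) * r s\<bar>\<close>, and the qualification bounds this by \<open>\<gamma> * \<phi>((f0 \<psi> \<alpha>)\<^sup>2)\<close>, using monotonicity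
  of \<open>\<phi>\<close> below \<open>\<alpha>\<close> and the qualification above \<open>\<alpha>\<close>.

  The value \<open>fun_calc h B\<close> is a definite description in terms of a spectral measure, so it carries
  information only once spectral measures are known to exist and to be unique. For existence, the
  numbers \<open>(B ^^ k) x \<bullet> x\<close> are the moments of a measure, by Hausdorff's theorem, since
  \<open>B\<^sup>k (1 - B)\<^sup>l \<ge> 0\<close> after scaling. Polarization of these measures gives bounded bilinear forms, hence
  operators \<open>h(B)\<close> for bounded Borel \<open>h\<close>; linearity and multiplicativity hold for monomials and extend
  to Borel functions because a finite signed measure on a bounded interval is determined by its moments. The
  indicators then give the projections. For uniqueness, the scalar measures of an arbitrary spectral
  measure of \<open>B\<close> have the same moments \<open>(B ^^ k) x \<bullet> x\<close>.\<close>

section \<open>Adjoints in Hilbert space\<close>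

text \<open>The representing vector minimizes \<open>\<parallel>y\<parallel>\<^sup>2 - 2 * l y\<close>: a minimizing sequence is Cauchy by the
  parallelogram law, and the first variation at the minimum vanishes.\<close>

lemma riesz_representation:
  fixes l :: "'a::{real_inner,complete_space} \<Rightarrow> real"
  assumes "bounded_linear l"
  obtains y where "\<And>x. l x = x \<bullet> y"
proof -
  interpret bounded_linear l by fact
  obtain K where K: "\<And>x. \<bar>l x\<bar> \<le> norm x * K" "K > 0"
    using pos_bounded by (metis real_norm_def)
  define J where "J y = (norm y)\<^sup>2 - 2 * l y" for y
  have J_lower: "- K\<^sup>2 \<le> J y" for y
  proof -
    have "0 \<le> (norm y - K)\<^sup>2" by simp
    then show ?thesis using K(1)[of y] by (simp add: J_def power2_diff abs_le_iff)
  qed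
  define \<iota> where "\<iota> = Inf (range J)"
  have bdd: "bdd_below (range J)" using J_lower by (auto intro!: bdd_belowI)
  have inf_le: "\<iota> \<le> J y" for y
    unfolding \<iota>_def by (rule cInf_lower) (use bdd in auto)
  have "\<exists>y. J y < \<iota> + 1 / real (Suc n)" for n
  proof -
    have "\<iota> < \<iota> + 1 / real (Suc n)" by simp
    then have "\<exists>j\<in>range J. j < \<iota> + 1 / real (Suc n)"
      unfolding \<iota>_def by (subst cInf_less_iff[symmetric]) (use bdd in auto)
    then show ?thesis by blast
  qed
  then obtain Y where Y: "\<And>n. J (Y n) < \<iota> + 1 / real (Suc n)" by metis
  have par: "(norm (u - v))\<^sup>2 \<le> 2 * (J u - \<iota>) + 2 * (J v - \<iota>)" for u v
  proof -
    have "(norm (u - v))\<^sup>2 = 2 * J u + 2 * J v - 4 * J ((1/2) *\<^sub>R (u + v))"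
      unfolding J_def power2_norm_eq_inner
      by (simp add: scale add inner_simps inner_commute algebra_simps)
    with inf_le[of "(1/2) *\<^sub>R (u + v)"] show ?thesis by simp
  qed
  have "Cauchy Y"
  proof (rule CauchyI)
    fix e :: real assume "e > 0"
    then have "4 / e\<^sup>2 > 0" by simp
    then obtain N :: nat where N: "4 / e\<^sup>2 < real N" using reals_Archimedean2 by blast
    have small: "2 * (J (Y n) - \<iota>) < e\<^sup>2 / 2" if "n \<ge> N" for n
    proof -
      have "2 * (J (Y n) - \<iota>) < 2 / real (Suc n)" using Y[of n] by simp
      also have "\<dots> \<le> e\<^sup>2 / 2"
      proof -
        have "4 < real N * e\<^sup>2" using N \<open>e > 0\<close> by (simp add: divide_less_eq)
        also have "real N * e\<^sup>2 \<le> real (Suc n) * e\<^sup>2" using that by (intro mult_right_mono) auto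
        finally show ?thesis by (simp add: divide_le_eq mult.commute del: of_nat_Suc)
      qed
      finally show ?thesis .
    qed
    show "\<exists>N. \<forall>m\<ge>N. \<forall>n\<ge>N. norm (Y m - Y n) < e"
    proof (intro exI[of _ N] allI impI)
      fix m n assume "N \<le> m" "N \<le> n"
      then have "(norm (Y m - Y n))\<^sup>2 < e\<^sup>2"
        using par[of "Y m" "Y n"] small[of m] small[of n] by simp
      then show "norm (Y m - Y n) < e"
        using \<open>e > 0\<close> by (simp add: power_less_imp_less_base)
    qed
  qed
  then obtain y where y: "Y \<longlonglongrightarrow> y" using Cauchy_convergent convergent_def by blast
  have "(\<lambda>n. J (Y n)) \<longlonglongrightarrow> J y"
    unfolding J_def by (intro tendsto_intros y tendsto)
  moreover have "(\<lambda>n. \<iota> + 1 / real (Suc n)) \<longlonglongrightarrow> \<iota> + 0"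
    by (intro tendsto_intros LIMSEQ_inverse_real_of_nat[unfolded inverse_eq_divide])
  ultimately have "J y \<le> \<iota>"
    using LIMSEQ_le[of "\<lambda>n. J (Y n)" "J y" "\<lambda>n. \<iota> + 1 / real (Suc n)" "\<iota> + 0"] less_imp_le[OF Y] by simp
  then have J_min: "J y \<le> J z" for z using inf_le[of z] by simp
  \<comment> \<open>If the first variation \<open>d\<close> in direction \<open>z\<close> were nonzero,
    the step \<open>t\<close> would decrease \<open>J\<close>.\<close>
  have "l z = z \<bullet> y" for z
  proof (rule ccontr)
    define d where "d = l z - z \<bullet> y"
    assume "l z \<noteq> z \<bullet> y"
    then have "d \<noteq> 0" by (simp add: d_def)
    then have "z \<noteq> 0" by (auto simp: d_def zero)
    then have zz: "(norm z)\<^sup>2 > 0" by simp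
    define t where "t = d / (norm z)\<^sup>2"
    have "J (y + t *\<^sub>R z) = J y - 2 * t * d + t\<^sup>2 * (norm z)\<^sup>2"
      unfolding J_def d_def power2_norm_eq_inner
      by (simp add: scale add inner_simps inner_commute algebra_simps power2_eq_square)
    also have "\<dots> = J y - d\<^sup>2 / (norm z)\<^sup>2"
      using zz by (simp add: t_def field_simps power2_eq_square)
    also have "\<dots> < J y" using zz \<open>d \<noteq> 0\<close> by simp
    finally show False using J_min[of "y + t *\<^sub>R z"] by simp
  qed
  then show thesis using that by blast
qed

lemma adjoint_inner:
  fixes A :: "'a::{real_inner,complete_space} \<Rightarrow> 'b::real_inner"
  assumes "bounded_linear A"
  shows "A x \<bullet> y = x \<bullet> adjoint A y"
proof -
  have "\<exists>w. \<forall>x. A x \<bullet> y = x \<bullet> w" for y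
  proof -
    have "bounded_linear (\<lambda>x. A x \<bullet> y)"
      by (rule bounded_linear_compose[OF bounded_linear_inner_left assms])
    then show ?thesis by (rule riesz_representation) blast
  qed
  then obtain f' where "\<forall>x y. A x \<bullet> y = x \<bullet> f' y" by metis
  with adjoint_unique[OF this] show ?thesis by simp
qed

lemma adjoint_inner':
  fixes A :: "'a::{real_inner,complete_space} \<Rightarrow> 'b::real_inner"
  assumes "bounded_linear A"
  shows "adjoint A y \<bullet> x = y \<bullet> A x"
  using adjoint_inner[OF assms, of x y] by (simp add: inner_commute)

lemma bounded_linear_adjoint:
  fixes A :: "'a::{real_inner,complete_space} \<Rightarrow> 'b::real_inner"
  assumes A: "bounded_linear A"
  shows "bounded_linear (adjoint A)"
proof -
  obtain K where K: "\<And>x. norm (A x) \<le> norm x * K" "K > 0"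
    using bounded_linear.pos_bounded[OF A] by blast
  show ?thesis
  proof (rule bounded_linear_intro[where K=K])
    show "adjoint A (x + y) = adjoint A x + adjoint A y" for x y
      by (subst vector_eq_rdot[symmetric])
         (simp add: adjoint_inner'[OF A] inner_simps)
    show "adjoint A (r *\<^sub>R x) = r *\<^sub>R adjoint A x" for r x
      by (subst vector_eq_rdot[symmetric])
         (simp add: adjoint_inner'[OF A] inner_simps)
    show "norm (adjoint A x) \<le> norm x * K" for x
    proof -
      have "(norm (adjoint A x))\<^sup>2 = x \<bullet> A (adjoint A x)"
        by (simp add: power2_norm_eq_inner adjoint_inner'[OF A])
      also have "\<dots> \<le> norm x * norm (A (adjoint A x))" by (rule norm_cauchy_schwarz)
      also have "\<dots> \<le> norm x * (norm (adjoint A x) * K)" by (intro mult_left_mono K) simp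
      finally show ?thesis
        by (cases "norm (adjoint A x) = 0")
           (use K(2) in \<open>auto simp: power2_eq_square mult_ac\<close>)
    qed
  qed
qed

lemma nonneg_selfadjoint_adjoint_comp:
  fixes A :: "'a::{real_inner,complete_space} \<Rightarrow> 'b::real_inner"
  assumes A: "bounded_linear A"
  shows "nonneg_selfadjoint (adjoint A \<circ> A)"
  unfolding nonneg_selfadjoint_def selfadjoint_def comp_def
  using bounded_linear_compose[OF bounded_linear_adjoint[OF A] A]
  by (simp add: adjoint_inner'[OF A] adjoint_inner[OF A, symmetric])

lemma nonneg_selfadjoint_comp_adjoint:
  fixes A :: "'a::{real_inner,complete_space} \<Rightarrow> 'b::real_inner"
  assumes A: "bounded_linear A"
  shows "nonneg_selfadjoint (A \<circ> adjoint A)"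
  unfolding nonneg_selfadjoint_def selfadjoint_def comp_def
  using bounded_linear_compose[OF A bounded_linear_adjoint[OF A]]
  by (simp add: adjoint_inner[OF A] adjoint_inner'[OF A, symmetric])


lemma inner_eqI:
  assumes "\<And>y. u \<bullet> y = v \<bullet> y"
  shows "u = v"
  by (rule vector_eq_rdot[THEN iffD1]) (rule allI, rule assms)

lemma selfadjoint_inner: "selfadjoint B \<Longrightarrow> B x \<bullet> y = x \<bullet> B y"
  by (simp add: selfadjoint_def)

lemma selfadjoint_bounded_linear: "selfadjoint B \<Longrightarrow> bounded_linear B"
  by (simp add: selfadjoint_def)

lemma selfadjoint_funpow:
  assumes "selfadjoint B"
  shows "selfadjoint (B ^^ k)"
proof (induction k)
  case 0
  then show ?case by (simp add: selfadjoint_def bounded_linear_ident id_def)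
next
  case (Suc k)
  have "bounded_linear (\<lambda>x. B ((B ^^ k) x))"
    by (rule bounded_linear_compose) (use Suc assms in \<open>simp_all add: selfadjoint_def\<close>)
  moreover have "B ((B ^^ k) x) \<bullet> y = x \<bullet> B ((B ^^ k) y)" for x y
    by (simp add: selfadjoint_inner[OF assms] selfadjoint_inner[OF Suc] funpow_swap1)
  ultimately show ?case by (simp add: selfadjoint_def comp_def)
qed

lemma selfadjoint_eqI:
  assumes H: "selfadjoint H" and G: "selfadjoint G" and eq: "\<And>x. H x \<bullet> x = G x \<bullet> x"
  shows "H = G"
proof
  fix x
  interpret H: bounded_linear H using H by (rule selfadjoint_bounded_linear)
  interpret G: bounded_linear G using G by (rule selfadjoint_bounded_linear)
  have "H x \<bullet> y = G x \<bullet> y" for y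
    using eq[of "x + y"] eq[of x] eq[of y] selfadjoint_inner[OF H, of x y] selfadjoint_inner[OF G, of x y]
      inner_commute[of x "H y"] inner_commute[of x "G y"]
    by (simp add: H.add G.add inner_simps)
  then show "H x = G x" by (rule inner_eqI)
qed

section \<open>The Hausdorff moment problem\<close>

text \<open>The array \<open>c\<close> stands for a linear functional with value \<open>c i j\<close> at \<open>t\<^sup>i (1 - t)\<^sup>j\<close>. The recursion
  expresses \<open>t + (1 - t) = 1\<close>, and the sum expands the \<open>n\<close>-th power of that identity.\<close>

lemma sum_binomial_moments:
  fixes c :: "nat \<Rightarrow> nat \<Rightarrow> real"
  assumes pascal: "\<And>k l. c k l = c (Suc k) l + c k (Suc l)"
  shows "(\<Sum>k\<le>n. real (n choose k) * c (i + k) (j + (n - k))) = c i j"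
proof (induction n arbitrary: i j)
  case 0
  then show ?case by simp
next
  case (Suc n)
  have "(\<Sum>k\<le>Suc n. real (Suc n choose k) * c (i + k) (j + (Suc n - k)))
      = c i (j + Suc n) + (\<Sum>k\<le>n. real (Suc n choose Suc k) * c (i + Suc k) (j + (n - k)))"
    by (simp only: sum.atMost_Suc_shift) simp
  also have "(\<Sum>k\<le>n. real (Suc n choose Suc k) * c (i + Suc k) (j + (n - k)))
      = (\<Sum>k\<le>n. real (n choose k) * c (Suc i + k) (j + (n - k)))
       + (\<Sum>k\<le>n. real (n choose Suc k) * c (i + Suc k) (j + (n - k)))"
    by (simp add: distrib_right sum.distrib)
  also have "(\<Sum>k\<le>n. real (n choose k) * c (Suc i + k) (j + (n - k))) = c (Suc i) j"
    by (rule Suc)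
  also have "c i (j + Suc n) + (c (Suc i) j + (\<Sum>k\<le>n. real (n choose Suc k) * c (i + Suc k) (j + (n - k))))
     = c (Suc i) j + (\<Sum>k\<le>Suc n. real (n choose k) * c (i + k) (j + (Suc n - k)))"
    by (simp only: sum.atMost_Suc_shift) simp
  also have "(\<Sum>k\<le>Suc n. real (n choose k) * c (i + k) (j + (Suc n - k)))
     = (\<Sum>k\<le>n. real (n choose k) * c (i + k) (Suc j + (n - k)))"
    by (auto simp: Suc_diff_le intro!: sum.cong)
  also have "\<dots> = c i (Suc j)" by (rule Suc)
  finally show ?case using pascal[of i j] by simp
qed

lemma abs_power_diff_le:
  fixes x y :: real
  assumes "0 \<le> x" "x \<le> 1" "0 \<le> y" "y \<le> 1"
  shows "\<bar>x ^ j - y ^ j\<bar> \<le> real j * \<bar>x - y\<bar>"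
proof (induction j)
  case (Suc j)
  have "x ^ Suc j - y ^ Suc j = x * (x ^ j - y ^ j) + (x - y) * y ^ j"
    by (simp add: algebra_simps)
  then have "\<bar>x ^ Suc j - y ^ Suc j\<bar> \<le> \<bar>x\<bar> * \<bar>x ^ j - y ^ j\<bar> + \<bar>x - y\<bar> * \<bar>y ^ j\<bar>"
    by (metis abs_mult abs_triangle_ineq)
  also have "\<dots> \<le> 1 * \<bar>x ^ j - y ^ j\<bar> + \<bar>x - y\<bar> * 1"
    using assms by (intro add_mono mult_mono) (auto simp: power_le_one)
  finally show ?case using Suc by (simp add: algebra_simps)
qed simp

text \<open>The \<open>n\<close>-th Bernstein measure puts mass \<open>(n choose k) * c k (n - k)\<close> at \<open>k / n\<close>. Because
  \<open>k (n choose k) = n (n - 1 choose k - 1)\<close>, its moment of order \<open>j + 1\<close> is, up to an error of order \<open>1 / n\<close>,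
  the moment of order \<open>j\<close> of the measure of index \<open>n - 1\<close> for the functional multiplied by \<open>t\<close>. Hence the
  induction on \<open>j\<close> is over all functionals at once.\<close>

lemma bernstein_moments_tendsto:
  fixes c :: "nat \<Rightarrow> nat \<Rightarrow> real"
  assumes "\<And>k l. 0 \<le> c k l" and "\<And>k l. c k l = c (Suc k) l + c k (Suc l)"
  shows "(\<lambda>n. \<Sum>k\<le>n. (real k / real n) ^ j * (real (n choose k) * c k (n - k))) \<longlonglongrightarrow> c j 0"
  using assms
proof (induction j arbitrary: c)
  case 0
  have "(\<Sum>k\<le>n. (real k / real n) ^ 0 * (real (n choose k) * c k (n - k))) = c 0 0" for n
    using sum_binomial_moments[of c n 0 0, OF 0(2)] by simp
  then show ?case by simp
next
  case (Suc j)
  \<comment> \<open>\<open>c'\<close> is the functional multiplied by \<open>t\<close>,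
    \<open>S n\<close> its \<open>j\<close>-th Bernstein moment, and \<open>U n\<close> the moment of
    order \<open>j + 1\<close> of \<open>c\<close> at index \<open>n + 1\<close>.\<close>
  define c' where "c' k l = c (Suc k) l" for k l
  have c': "\<And>k l. 0 \<le> c' k l" "\<And>k l. c' k l = c' (Suc k) l + c' k (Suc l)"
    unfolding c'_def by (rule Suc.prems)+
  define S where "S n = (\<Sum>k\<le>n. (real k / real n) ^ j * (real (n choose k) * c' k (n - k)))" for n
  define U where "U n = (\<Sum>k\<le>n. (real (Suc k) / real (Suc n)) ^ j * (real (n choose k) * c' k (n - k)))" for n
  have "S \<longlonglongrightarrow> c' j 0" unfolding S_def[abs_def] using Suc.IH[of c', OF c'] by simp
  moreover have "(\<lambda>n. U n - S n) \<longlonglongrightarrow> 0"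
  proof (rule Lim_null_comparison)
    have lim: "(\<lambda>n. 1 / real (Suc n)) \<longlonglongrightarrow> 0"
      by (rule LIMSEQ_inverse_real_of_nat[unfolded inverse_eq_divide])
    show "(\<lambda>n. real j * c' 0 0 * (1 / real (Suc n))) \<longlonglongrightarrow> 0"
      using tendsto_mult_right_zero[OF lim, of "real j * c' 0 0"] by simp
    show "\<forall>\<^sub>F n in sequentially. norm (U n - S n) \<le> real j * c' 0 0 * (1 / real (Suc n))"
    proof (intro eventually_sequentiallyI[of 1])
      fix n :: nat assume n: "1 \<le> n"
      have "\<bar>(real (Suc k) / real (Suc n)) ^ j - (real k / real n) ^ j\<bar> \<le> real j * (1 / real (Suc n))"
        if "k \<le> n" for k
      proof -
        have "\<bar>(real (Suc k) / real (Suc n)) ^ j - (real k / real n) ^ j\<bar>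
            \<le> real j * \<bar>real (Suc k) / real (Suc n) - real k / real n\<bar>"
          using that n by (intro abs_power_diff_le) auto
        also have "\<dots> = real j * \<bar>((real n - real k) / real n) * (1 / real (Suc n))\<bar>"
        proof -
          have "real (Suc k) / real (Suc n) - real k / real n = ((real n - real k) / real n) * (1 / real (Suc n))"
          using n by (simp add: field_simps del: of_nat_Suc) (simp add: algebra_simps)
          then show ?thesis by (simp only:)
        qed
        also have "\<dots> \<le> real j * (1 * (1 / real (Suc n)))"
          unfolding abs_mult
        proof (intro mult_left_mono mult_mono)
          show "\<bar>(real n - real k) / real n\<bar> \<le> 1" using that n by simp
        qed auto
        finally show ?thesis by (simp only: mult_1_left)
      qed note bd = this
      have "norm (U n - S n) \<le> (\<Sum>k\<le>n. norm (((real (Suc k) / real (Suc n)) ^ j - (real k / real n) ^ j)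
              * (real (n choose k) * c' k (n - k))))"
        unfolding U_def S_def sum_subtractf[symmetric] left_diff_distrib[symmetric] by (rule norm_sum)
      also have "\<dots> \<le> (\<Sum>k\<le>n. (real j * (1 / real (Suc n))) * (real (n choose k) * c' k (n - k)))"
      proof (rule sum_mono)
        fix k assume "k \<in> {..n}"
        then have "\<bar>(real (Suc k) / real (Suc n)) ^ j - (real k / real n) ^ j\<bar> * (real (n choose k) * c' k (n - k))
           \<le> (real j * (1 / real (Suc n))) * (real (n choose k) * c' k (n - k))"
          using c'(1) by (intro mult_right_mono bd) auto
        then show "norm (((real (Suc k) / real (Suc n)) ^ j - (real k / real n) ^ j) * (real (n choose k) * c' k (n - k)))
           \<le> (real j * (1 / real (Suc n))) * (real (n choose k) * c' k (n - k))"
          using c'(1) by (simp add: abs_mult)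
      qed
      also have "\<dots> = (real j * (1 / real (Suc n))) * c' 0 0"
        using sum_binomial_moments[of c' n 0 0, OF c'(2)] by (simp only: sum_distrib_left[symmetric] add_0)
      finally show "norm (U n - S n) \<le> real j * c' 0 0 * (1 / real (Suc n))" by (simp add: mult_ac)
    qed
  qed
  ultimately have U: "U \<longlonglongrightarrow> c' j 0"
    using tendsto_add[of S "c' j 0" sequentially "\<lambda>n. U n - S n" 0] by simp
  have "(\<Sum>k\<le>Suc n. (real k / real (Suc n)) ^ Suc j * (real (Suc n choose k) * c k (Suc n - k))) = U n" for n
  proof -
    have "(\<Sum>k\<le>Suc n. (real k / real (Suc n)) ^ Suc j * (real (Suc n choose k) * c k (Suc n - k)))
      = (\<Sum>k\<le>n. (real (Suc k) / real (Suc n)) ^ Suc j * (real (Suc n choose Suc k) * c (Suc k) (n - k)))"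
      by (simp only: sum.atMost_Suc_shift) simp
    also have "\<dots> = U n"
      unfolding U_def
    proof (rule sum.cong[OF refl])
      fix k
      have "real (Suc k) * real (Suc n choose Suc k) = real (Suc n) * real (n choose k)"
        using Suc_times_binomial_eq[of n k] by (metis of_nat_mult mult.commute)
      then have "real (Suc k) / real (Suc n) * real (Suc n choose Suc k) = real (n choose k)"
        by (simp add: field_simps del: of_nat_Suc)
      then show "(real (Suc k) / real (Suc n)) ^ Suc j * (real (Suc n choose Suc k) * c (Suc k) (n - k))
         = (real (Suc k) / real (Suc n)) ^ j * (real (n choose k) * c' k (n - k))"
        by (simp only: c'_def power_Suc2 mult.assoc[symmetric]) (simp only: mult.assoc)
    qed
    finally show ?thesis .
  qed
  then have "(\<lambda>n. \<Sum>k\<le>Suc n. (real k / real (Suc n)) ^ Suc j * (real (Suc n choose k) * c k (Suc n - k))) \<longlonglongrightarrow> c (Suc j) 0"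
    using U by (simp only: c'_def)
  then show ?case by (rule LIMSEQ_imp_Suc[where f="\<lambda>n. \<Sum>k\<le>n. (real k / real n) ^ Suc j * (real (n choose k) * c k (n - k))"])
qed

text \<open>The Bernstein measures all live on the unit interval, so Helly's selection theorem yields a weak
  limit, and its moments are the limits of the Bernstein moments.\<close>

theorem hausdorff_moment_problem:
  fixes c :: "nat \<Rightarrow> nat \<Rightarrow> real"
  assumes nonneg: "\<And>k l. 0 \<le> c k l" and pascal: "\<And>k l. c k l = c (Suc k) l + c k (Suc l)"
  obtains M :: "real measure" where "sets M = sets borel" "finite_measure M" "emeasure M (- {0..1}) = 0"
    "\<And>k. (LINT s:{0..1}|M. s ^ k) = c k 0"
proof (cases "c 0 0 = 0")
  case True
  have "c k 0 = 0" for k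
  proof (induction k)
    case (Suc k)
    then show ?case using pascal[of k 0] nonneg[of "Suc k" 0] nonneg[of k "Suc 0"] by simp
  qed (use True in simp)
  moreover have "(LINT s:{0..1}|null_measure (borel :: real measure). s ^ k) = 0" for k
    by (simp add: set_lebesgue_integral_def)
  ultimately show ?thesis
    by (intro that[of "null_measure borel"]) (auto intro: finite_measureI)
next
  case False
  then have c00: "c 0 0 > 0" using nonneg[of 0 0] by simp
  define w where "w n k = (if k \<le> n then real (n choose k) * c k (n - k) / c 0 0 else 0)" for n k
  have w_nonneg: "0 \<le> w n k" for n k using nonneg c00 by (simp add: w_def)
  have w_sum: "(\<Sum>k\<le>n. w n k) = 1" for n
    using sum_binomial_moments[of c n 0 0, OF pascal] c00 by (simp add: w_def sum_divide_distrib[symmetric])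
  have w_total: "(\<integral>\<^sup>+k. ennreal (w n k) \<partial>count_space UNIV) = 1" for n
  proof -
    have "(\<integral>\<^sup>+k. ennreal (w n k) \<partial>count_space UNIV) = (\<Sum>k\<le>n. ennreal (w n k))"
      by (rule nn_integral_count_space') (auto simp: w_def)
    also have "\<dots> = 1" using w_nonneg w_sum by (simp add: sum_ennreal)
    finally show ?thesis .
  qed
  define p where "p n = embed_pmf (w n)" for n
  have pmf_p: "pmf (p n) k = w n k" for n k
    unfolding p_def by (rule pmf_embed_pmf) (use w_nonneg w_total in auto)
  have set_p: "k \<le> n" if "k \<in> set_pmf (p n)" for n k
    using that by (auto simp: set_pmf_iff pmf_p w_def split: if_splits)
  define D where "D n = distr (measure_pmf (p n)) borel (\<lambda>k. real k / real n)" for n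
  have D: "real_distribution (D n)" for n
    unfolding D_def by (intro prob_space.real_distribution_distr measure_pmf.prob_space_axioms) simp
  have D_int: "integral\<^sup>L (D n) f = (\<Sum>k\<le>n. f (real k / real n) * w n k)" 
    if [measurable]: "f \<in> borel_measurable borel" for f :: "real \<Rightarrow> real" and n
    unfolding D_def
    by (subst integral_distr) (auto simp: integral_measure_pmf_real[of "{..n}"] set_p pmf_p)
  have D_tight: "tight D"
    unfolding tight_def
  proof (intro conjI allI impI D)
    fix \<epsilon> :: real assume "\<epsilon> > 0"
    have "measure (D n) {-1<..1} = 1" for n
    proof -
      have "measure (D n) {-1<..1} = measure (measure_pmf (p n)) {k. real k / real n \<in> {-1<..1}}"
        unfolding D_def by (subst measure_distr) (auto simp: vimage_def)
      also have "\<dots> = 1"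
      proof (rule measure_pmf.prob_eq_1[THEN iffD2])
        show "AE k in measure_pmf (p n). k \<in> {k. real k / real n \<in> {-1<..1}}"
        proof (rule AE_pmfI)
          fix k assume "k \<in> set_pmf (p n)"
          then have "k \<le> n" by (rule set_p)
          then have "real k / real n \<le> 1" by (auto simp: divide_le_eq_1)
          moreover have "-1 < real k / real n" by (rule less_le_trans[of _ 0]) auto
          ultimately show "k \<in> {k. real k / real n \<in> {-1<..1}}" by simp
        qed
      qed simp
      finally show ?thesis .
    qed
    then show "\<exists>a b. a < b \<and> (\<forall>n. 1 - \<epsilon> < measure (D n) {a<..b})"
      using \<open>\<epsilon> > 0\<close> by (intro exI[of _ "-1"] exI[of _ 1]) auto
  qed
  obtain r N where r: "strict_mono (r :: nat \<Rightarrow> nat)" and N: "real_distribution N"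
    and conv: "weak_conv_m (D \<circ> id \<circ> r) N"
    using tight_imp_convergent_subsubsequence[OF D_tight, of id] by (auto simp: strict_mono_def)
  interpret N: real_distribution N by fact
  \<comment> \<open>Weak convergence is tested against bounded continuous functions on the whole line,
    so powers are clipped to the unit interval; pushing the limit forward under the clipping
    concentrates it there.\<close>
  define clip where "clip s = min 1 (max 0 s)" for s :: real
  have clip_meas[measurable]: "clip \<in> borel_measurable borel"
    unfolding clip_def by measurable
  have clip_bd: "0 \<le> clip s" "clip s \<le> 1" for s by (auto simp: clip_def)
  have clip_cont: "isCont clip s" for s
    unfolding clip_def[abs_def] by (intro continuous_intros)
  have moments: "(\<integral>s. clip s ^ j \<partial>N) = c j 0 / c 0 0" for j
  proof (rule LIMSEQ_unique)
    show "(\<lambda>n. \<integral>s. clip s ^ j \<partial>(D \<circ> id \<circ> r) n) \<longlonglongrightarrow> (\<integral>s. clip s ^ j \<partial>N)"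
      by (rule weak_conv_imp_integral_bdd_continuous_conv[OF _ N conv, of _ 1])
         (use D clip_bd in \<open>auto simp: power_le_one isCont_power clip_cont\<close>)
    have "(\<integral>s. clip s ^ j \<partial>D n) = (\<Sum>k\<le>n. (real k / real n) ^ j * (real (n choose k) * c k (n - k))) / c 0 0" for n
    proof -
      have "clip (real k / real n) = real k / real n" if "k \<le> n" for k
      proof -
        have "real k / real n \<le> 1" using that by (auto simp: divide_le_eq_1)
        then show ?thesis by (simp add: clip_def)
      qed
      then show ?thesis
        by (subst D_int) (auto simp: sum_divide_distrib w_def intro!: sum.cong)
    qed
    then have "(\<lambda>n. \<integral>s. clip s ^ j \<partial>D n) \<longlonglongrightarrow> c j 0 / c 0 0"
      using bernstein_moments_tendsto[of c, OF nonneg pascal, where j=j] c00 by (auto intro!: tendsto_divide)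
    then show "(\<lambda>n. \<integral>s. clip s ^ j \<partial>(D \<circ> id \<circ> r) n) \<longlonglongrightarrow> c j 0 / c 0 0"
      using LIMSEQ_subseq_LIMSEQ[OF _ r] by (simp add: comp_def)
  qed
  define M where "M = density (distr N borel clip) (\<lambda>_. ennreal (c 0 0))"
  show thesis
  proof (rule that)
    show "sets M = sets borel" by (simp add: M_def)
    have "prob_space (distr N borel clip)" by (rule N.prob_space_distr) simp
    then have "emeasure (distr N borel clip) UNIV = 1"
      using prob_space.emeasure_space_1 by fastforce
    then show "finite_measure M"
      unfolding M_def by (intro finite_measureI) (simp add: emeasure_density_const ennreal_mult_eq_top_iff)
    have "clip -` (- {0..1}) = {}" using clip_bd by auto
    then show "emeasure M (- {0..1}) = 0"
      unfolding M_def by (subst emeasure_density_const) (auto simp: emeasure_distr)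
    show "(LINT s:{0..1}|M. s ^ k) = c k 0" for k
    proof -
      have "(LINT s:{0..1}|M. s ^ k) = (\<integral>s. c 0 0 * (indicator {0..1} (clip s) * clip s ^ k) \<partial>N)"
        unfolding M_def set_lebesgue_integral_def using c00
        by (subst integral_density) (auto simp: integral_distr)
      also have "\<dots> = c 0 0 * (\<integral>s. clip s ^ k \<partial>N)"
        using clip_bd by (simp add: indicator_def)
      finally show ?thesis using moments[of k] c00 by simp
    qed
  qed
qed

section \<open>Bounded Borel functions on an interval\<close>

text \<open>Only the values on the interval matter; the indicator turns measurability of the restriction into
  measurability on the line.\<close>

definition bounded_borel :: "real \<Rightarrow> (real \<Rightarrow> real) \<Rightarrow> bool" where
  "bounded_borel b h \<longleftrightarrow>
     (\<lambda>s. indicator {0..b} s * h s) \<in> borel_measurable borel \<and> (\<exists>K. \<forall>s\<in>{0..b}. \<bar>h s\<bar> \<le> K)"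

lemma bounded_borelI:
  assumes "h \<in> borel_measurable borel" "\<And>s. s \<in> {0..b} \<Longrightarrow> \<bar>h s\<bar> \<le> K"
  shows "bounded_borel b h"
  using assms unfolding bounded_borel_def by (auto intro: exI[of _ K])

lemma bounded_borel_bound:
  assumes "bounded_borel b h"
  obtains K where "K \<ge> 0" "\<And>s. s \<in> {0..b} \<Longrightarrow> \<bar>h s\<bar> \<le> K"
proof -
  obtain K where "\<forall>s\<in>{0..b}. \<bar>h s\<bar> \<le> K" using assms unfolding bounded_borel_def by blast
  then show thesis by (intro that[of "max 0 K"]) (auto simp: le_max_iff_disj)
qed

lemma bounded_borel_measurable:
  "bounded_borel b h \<Longrightarrow> (\<lambda>s. indicator {0..b} s * h s) \<in> borel_measurable borel"
  by (simp add: bounded_borel_def)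

lemma bounded_borel_cong:
  assumes "bounded_borel b h" "\<And>s. s \<in> {0..b} \<Longrightarrow> h s = g s"
  shows "bounded_borel b g"
proof -
  have "(\<lambda>s. indicator {0..b} s * h s) = (\<lambda>s. indicator {0..b} s * g s)"
    using assms(2) by (auto simp: indicator_def)
  then show ?thesis using assms unfolding bounded_borel_def by auto
qed

lemma bounded_borel_const [simp]: "bounded_borel b (\<lambda>_. c)"
  by (rule bounded_borelI[of _ _ "\<bar>c\<bar>"]) auto

lemma bounded_borel_indicator [simp]: "S \<in> sets borel \<Longrightarrow> bounded_borel b (indicator S)"
  by (rule bounded_borelI[of _ _ 1]) (auto simp: indicator_def)

lemma bounded_borel_power [simp]: "bounded_borel b (\<lambda>s. s ^ k)"
  by (rule bounded_borelI[of _ _ "\<bar>b\<bar> ^ k"]) (auto simp: power_abs intro!: power_mono)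

lemma bounded_borel_add [intro]:
  assumes "bounded_borel b f" "bounded_borel b g"
  shows "bounded_borel b (\<lambda>s. f s + g s)"
proof -
  obtain K L where "\<And>s. s \<in> {0..b} \<Longrightarrow> \<bar>f s\<bar> \<le> K" "\<And>s. s \<in> {0..b} \<Longrightarrow> \<bar>g s\<bar> \<le> L"
    using bounded_borel_bound[OF assms(1)] bounded_borel_bound[OF assms(2)] by metis
  then have "\<forall>s\<in>{0..b}. \<bar>f s + g s\<bar> \<le> K + L" by (intro ballI order_trans[OF abs_triangle_ineq] add_mono)
  then show ?thesis
    using borel_measurable_add[OF assms[THEN bounded_borel_measurable]]
    unfolding bounded_borel_def by (auto simp: distrib_left)
qed

lemma bounded_borel_mult [intro]:
  assumes "bounded_borel b f" "bounded_borel b g"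
  shows "bounded_borel b (\<lambda>s. f s * g s)"
proof -
  obtain K L where "K \<ge> 0" "\<And>s. s \<in> {0..b} \<Longrightarrow> \<bar>f s\<bar> \<le> K" "\<And>s. s \<in> {0..b} \<Longrightarrow> \<bar>g s\<bar> \<le> L"
    using bounded_borel_bound[OF assms(1)] bounded_borel_bound[OF assms(2)] by metis
  then have "\<forall>s\<in>{0..b}. \<bar>f s * g s\<bar> \<le> K * L" by (auto simp: abs_mult intro!: mult_mono)
  moreover have "(\<lambda>s. indicator {0..b} s * (f s * g s))
      = (\<lambda>s. (indicator {0..b} s * f s) * (indicator {0..b} s * g s))"
    by (auto simp: indicator_def)
  ultimately show ?thesis
    using borel_measurable_times[OF assms[THEN bounded_borel_measurable]]
    unfolding bounded_borel_def by auto
qed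

lemma bounded_borel_cmult [intro]: "bounded_borel b f \<Longrightarrow> bounded_borel b (\<lambda>s. c * f s)"
  using bounded_borel_mult[OF bounded_borel_const] by blast

lemma bounded_borel_diff [intro]:
  assumes "bounded_borel b f" "bounded_borel b g"
  shows "bounded_borel b (\<lambda>s. f s - g s)"
  using bounded_borel_add[OF assms(1) bounded_borel_cmult[OF assms(2), of "-1"]] by simp

lemma bounded_borel_restrict_space:
  assumes "h \<in> borel_measurable (restrict_space borel {0..b})" "\<And>s. s \<in> {0..b} \<Longrightarrow> \<bar>h s\<bar> \<le> K"
  shows "bounded_borel b h"
proof -
  have "(\<lambda>s. indicator {0..b} s *\<^sub>R h s) \<in> borel_measurable borel"
    using assms(1) by (subst borel_measurable_restrict_space_iff[symmetric]) auto
  then show ?thesis using assms(2) unfolding bounded_borel_def by (auto intro: exI[of _ K])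
qed

lemma bounded_borel_mono_on:
  assumes "mono_on {0..b} h"
  shows "bounded_borel b h"
proof (rule bounded_borel_restrict_space)
  show "h \<in> borel_measurable (restrict_space borel {0..b})"
    by (rule borel_measurable_mono_on_fnc) fact
  show "\<bar>h s\<bar> \<le> max \<bar>h 0\<bar> \<bar>h b\<bar>" if "s \<in> {0..b}" for s
  proof -
    have "h 0 \<le> h s" "h s \<le> h b" using assms that by (auto simp: mono_on_def)
    then show ?thesis by linarith
  qed
qed

lemma bounded_borel_continuous_on:
  assumes "continuous_on {0..b} h"
  shows "bounded_borel b h"
proof -
  have "bounded (h ` {0..b})"
    by (intro compact_imp_bounded compact_continuous_image assms) simp
  then obtain K where "\<forall>s\<in>{0..b}. \<bar>h s\<bar> \<le> K" unfolding bounded_iff by auto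
  then show ?thesis
    using borel_measurable_continuous_on_indicator[OF _ assms] unfolding bounded_borel_def by auto
qed

lemma bounded_borel_min:
  assumes h: "bounded_borel b h" and "0 \<le> s"
  shows "bounded_borel b (\<lambda>t. min (h t) s)"
proof -
  obtain K where "\<And>s. s \<in> {0..b} \<Longrightarrow> \<bar>h s\<bar> \<le> K" using bounded_borel_bound[OF h] by blast
  then have "\<forall>t\<in>{0..b}. \<bar>min (h t) s\<bar> \<le> max K s" using \<open>0 \<le> s\<close> by (fastforce simp: min_def)
  moreover have "(\<lambda>t. indicator {0..b} t * min (h t) s) = (\<lambda>t. min (indicator {0..b} t * h t) s * indicator {0..b} t)"
    by (auto simp: indicator_def)
  moreover have "(\<lambda>t. min (indicator {0..b} t * h t) s * indicator {0..b} t) \<in> borel_measurable borel"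
    using bounded_borel_measurable[OF h] by measurable
  ultimately show ?thesis unfolding bounded_borel_def by auto
qed

lemma bounded_borel_sqrt:
  assumes h: "bounded_borel b h"
  shows "bounded_borel b (\<lambda>t. sqrt (h t))"
proof -
  obtain K where K: "\<And>s. s \<in> {0..b} \<Longrightarrow> \<bar>h s\<bar> \<le> K" using bounded_borel_bound[OF h] by blast
  have "\<bar>sqrt (h t)\<bar> \<le> sqrt K" if "t \<in> {0..b}" for t
  proof -
    have "\<bar>sqrt (h t)\<bar> = sqrt \<bar>h t\<bar>" by (auto simp: abs_if real_sqrt_minus)
    then show ?thesis using K[OF that] by simp
  qed
  moreover have "(\<lambda>t. indicator {0..b} t * sqrt (h t)) = (\<lambda>t. sqrt (indicator {0..b} t * h t))"
    by (auto simp: indicator_def)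
  moreover have "(\<lambda>t. sqrt (indicator {0..b} t * h t)) \<in> borel_measurable borel"
    using bounded_borel_measurable[OF h] by measurable
  ultimately show ?thesis unfolding bounded_borel_def by (auto intro!: exI[of _ "sqrt K"])
qed

lemma bounded_borel_le:
  assumes h: "bounded_borel b h"
  shows "bounded_borel b (\<lambda>t. if h t \<le> s then 1 else 0)"
proof -
  have "(\<lambda>t. indicator {0..b} t * (if h t \<le> s then 1 else 0))
      = (\<lambda>t. indicator {0..b} t * (if indicator {0..b} t * h t \<le> s then 1 else (0::real)))"
    by (auto simp: indicator_def)
  also have "\<dots> \<in> borel_measurable borel"
    using bounded_borel_measurable[OF h] by measurable
  finally show ?thesis unfolding bounded_borel_def by (intro conjI exI[of _ 1]) auto
qed

text \<open>A finite signed measure on the interval, described by its integral: linear and continuous under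
  bounded pointwise convergence. Differences, multiples and densities stay in this class, so
  polarized measures need no separate construction.\<close>

definition sigma_functional :: "real \<Rightarrow> ((real \<Rightarrow> real) \<Rightarrow> real) \<Rightarrow> bool" where
  "sigma_functional b \<Lambda> \<longleftrightarrow>
     (\<forall>f g. bounded_borel b f \<longrightarrow> bounded_borel b g \<longrightarrow> \<Lambda> (\<lambda>s. f s + g s) = \<Lambda> f + \<Lambda> g) \<and>
     (\<forall>c f. bounded_borel b f \<longrightarrow> \<Lambda> (\<lambda>s. c * f s) = c * \<Lambda> f) \<and>
     (\<forall>F h K. (\<forall>n. bounded_borel b (F n)) \<longrightarrow> bounded_borel b h \<longrightarrow>
        (\<forall>n. \<forall>s\<in>{0..b}. \<bar>F n s\<bar> \<le> K) \<longrightarrow> (\<forall>s\<in>{0..b}. (\<lambda>n. F n s) \<longlonglongrightarrow> h s) \<longrightarrow>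
        (\<lambda>n. \<Lambda> (F n)) \<longlonglongrightarrow> \<Lambda> h)"

lemma sigma_functional_add:
  assumes "sigma_functional b \<Lambda>" "bounded_borel b f" "bounded_borel b g"
  shows "\<Lambda> (\<lambda>s. f s + g s) = \<Lambda> f + \<Lambda> g"
  by (rule assms(1)[unfolded sigma_functional_def, THEN conjunct1, rule_format, OF assms(2,3)])

lemma sigma_functional_cmult:
  assumes "sigma_functional b \<Lambda>" "bounded_borel b f"
  shows "\<Lambda> (\<lambda>s. c * f s) = c * \<Lambda> f"
  by (rule assms(1)[unfolded sigma_functional_def, THEN conjunct2, THEN conjunct1, rule_format, OF assms(2)])

lemma sigma_functional_diff:
  assumes "sigma_functional b \<Lambda>" "bounded_borel b f" "bounded_borel b g"
  shows "\<Lambda> (\<lambda>s. f s - g s) = \<Lambda> f - \<Lambda> g"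
  using sigma_functional_add[OF assms(1,2) bounded_borel_cmult[OF assms(3), of "-1"]]
    sigma_functional_cmult[OF assms(1,3), of "-1"] by simp

lemma sigma_functional_tendsto:
  assumes "sigma_functional b \<Lambda>" "\<And>n. bounded_borel b (F n)" "bounded_borel b h"
    and "\<And>n s. s \<in> {0..b} \<Longrightarrow> \<bar>F n s\<bar> \<le> K" "\<And>s. s \<in> {0..b} \<Longrightarrow> (\<lambda>n. F n s) \<longlonglongrightarrow> h s"
  shows "(\<lambda>n. \<Lambda> (F n)) \<longlonglongrightarrow> \<Lambda> h"
  by (rule assms(1)[unfolded sigma_functional_def, THEN conjunct2, THEN conjunct2, rule_format])
     (use assms(2-) in blast)+

lemma sigma_functional_zero: "sigma_functional b \<Lambda> \<Longrightarrow> \<Lambda> (\<lambda>_. 0) = 0"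
  using sigma_functional_cmult[of b \<Lambda> "\<lambda>_. 0" 0] by simp

lemma sigma_functional_cong:
  assumes "sigma_functional b \<Lambda>" "bounded_borel b f" "\<And>s. s \<in> {0..b} \<Longrightarrow> f s = g s"
  shows "\<Lambda> f = \<Lambda> g"
proof -
  have g: "bounded_borel b g" using assms(2,3) by (rule bounded_borel_cong)
  obtain K where "\<And>s. s \<in> {0..b} \<Longrightarrow> \<bar>f s\<bar> \<le> K" using bounded_borel_bound[OF assms(2)] by blast
  then have "(\<lambda>_::nat. \<Lambda> f) \<longlonglongrightarrow> \<Lambda> g"
    using assms(3) by (intro sigma_functional_tendsto[OF assms(1) assms(2) g, where K=K]) auto
  then show ?thesis by (simp add: LIMSEQ_const_iff)
qed

lemma sigma_functional_plus:
  assumes "sigma_functional b \<Lambda>" "sigma_functional b \<Lambda>'"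
  shows "sigma_functional b (\<lambda>h. \<Lambda> h + \<Lambda>' h)"
  unfolding sigma_functional_def
proof (intro conjI allI impI)
  fix F :: "nat \<Rightarrow> real \<Rightarrow> real" and h K
  assume F: "\<forall>n. bounded_borel b (F n)" "bounded_borel b h"
    "\<forall>n. \<forall>s\<in>{0..b}. \<bar>F n s\<bar> \<le> K" "\<forall>s\<in>{0..b}. (\<lambda>n. F n s) \<longlonglongrightarrow> h s"
  show "(\<lambda>n. \<Lambda> (F n) + \<Lambda>' (F n)) \<longlonglongrightarrow> \<Lambda> h + \<Lambda>' h"
    using F by (intro tendsto_add sigma_functional_tendsto[OF assms(1), where K=K] sigma_functional_tendsto[OF assms(2), where K=K]) auto
qed (simp_all add: assms[THEN sigma_functional_add] assms[THEN sigma_functional_cmult] distrib_left)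

lemma sigma_functional_scale:
  assumes "sigma_functional b \<Lambda>"
  shows "sigma_functional b (\<lambda>h. c * \<Lambda> h)"
  unfolding sigma_functional_def
proof (intro conjI allI impI)
  fix F :: "nat \<Rightarrow> real \<Rightarrow> real" and h K
  assume F: "\<forall>n. bounded_borel b (F n)" "bounded_borel b h"
    "\<forall>n. \<forall>s\<in>{0..b}. \<bar>F n s\<bar> \<le> K" "\<forall>s\<in>{0..b}. (\<lambda>n. F n s) \<longlonglongrightarrow> h s"
  show "(\<lambda>n. c * \<Lambda> (F n)) \<longlonglongrightarrow> c * \<Lambda> h"
    using F by (intro tendsto_mult_left sigma_functional_tendsto[OF assms, where K=K]) auto
qed (simp_all add: sigma_functional_add[OF assms] sigma_functional_cmult[OF assms] distrib_left)

lemma sigma_functional_minus: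
  assumes "sigma_functional b \<Lambda>" "sigma_functional b \<Lambda>'"
  shows "sigma_functional b (\<lambda>h. \<Lambda> h - \<Lambda>' h)"
  using sigma_functional_plus[OF assms(1) sigma_functional_scale[OF assms(2), of "-1"]] by simp

lemma sigma_functional_divide:
  assumes "sigma_functional b \<Lambda>"
  shows "sigma_functional b (\<lambda>h. \<Lambda> h / c)"
  using sigma_functional_scale[OF assms, of "inverse c"] by (simp add: divide_inverse_commute)

lemma sigma_functional_weight:
  assumes "sigma_functional b \<Lambda>" "bounded_borel b g"
  shows "sigma_functional b (\<lambda>h. \<Lambda> (\<lambda>s. g s * h s))"
  unfolding sigma_functional_def
proof (intro conjI allI impI)
  fix f h c assume f: "bounded_borel b f"
  note gf = bounded_borel_mult[OF assms(2) f]
  show "\<Lambda> (\<lambda>s. g s * (c * f s)) = c * \<Lambda> (\<lambda>s. g s * f s)"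
    using sigma_functional_cmult[OF assms(1) gf, of c] by (simp add: mult_ac)
  assume h: "bounded_borel b h"
  show "\<Lambda> (\<lambda>s. g s * (f s + h s)) = \<Lambda> (\<lambda>s. g s * f s) + \<Lambda> (\<lambda>s. g s * h s)"
    using sigma_functional_add[OF assms(1) gf bounded_borel_mult[OF assms(2) h]]
    by (simp add: distrib_left)
next
  fix F :: "nat \<Rightarrow> real \<Rightarrow> real" and h K
  assume F: "\<forall>n. bounded_borel b (F n)" "bounded_borel b h"
    "\<forall>n. \<forall>s\<in>{0..b}. \<bar>F n s\<bar> \<le> K" "\<forall>s\<in>{0..b}. (\<lambda>n. F n s) \<longlonglongrightarrow> h s"
  obtain L where L: "L \<ge> 0" "\<And>s. s \<in> {0..b} \<Longrightarrow> \<bar>g s\<bar> \<le> L"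
    using bounded_borel_bound[OF assms(2)] by blast
  have "\<bar>g s * F n s\<bar> \<le> L * K" if "s \<in> {0..b}" for n s
    unfolding abs_mult using L F(3) that by (intro mult_mono) auto
  then show "(\<lambda>n. \<Lambda> (\<lambda>s. g s * F n s)) \<longlonglongrightarrow> \<Lambda> (\<lambda>s. g s * h s)"
    using F assms(2) by (intro sigma_functional_tendsto[OF assms(1), where K="L * K"]) (auto intro!: tendsto_mult_left)
qed

lemma set_integrable_bounded_borel:
  fixes M :: "real measure"
  assumes M: "finite_measure M" "sets M = sets borel" and h: "bounded_borel b h"
  shows "set_integrable M {0..b} h"
proof -
  interpret finite_measure M by fact
  obtain K where "K \<ge> 0" "\<And>s. s \<in> {0..b} \<Longrightarrow> \<bar>h s\<bar> \<le> K" using bounded_borel_bound[OF h] by blast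
  then show ?thesis
    unfolding set_integrable_def using bounded_borel_measurable[OF h] M(2)
    by (intro integrable_const_bound[of _ K])
       (auto simp: indicator_def abs_mult cong: measurable_cong_sets)
qed

lemma sigma_functional_integral:
  fixes M :: "real measure"
  assumes M: "finite_measure M" "sets M = sets borel"
  shows "sigma_functional b (\<lambda>h. LINT s:{0..b}|M. h s)"
  unfolding sigma_functional_def
proof (intro conjI allI impI)
  interpret finite_measure M by fact
  note int = set_integrable_bounded_borel[OF M]
  fix f g :: "real \<Rightarrow> real" and c assume f: "bounded_borel b f"
  show "(LINT s:{0..b}|M. c * f s) = c * (LINT s:{0..b}|M. f s)"
    by simp
  assume g: "bounded_borel b g"
  show "(LINT s:{0..b}|M. f s + g s) = (LINT s:{0..b}|M. f s) + (LINT s:{0..b}|M. g s)"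
    by (rule set_integral_add(2)[OF int[OF f] int[OF g]])
next
  interpret finite_measure M by fact
  fix F :: "nat \<Rightarrow> real \<Rightarrow> real" and h K
  assume F: "\<forall>n. bounded_borel b (F n)" "bounded_borel b h"
    "\<forall>n. \<forall>s\<in>{0..b}. \<bar>F n s\<bar> \<le> K" "\<forall>s\<in>{0..b}. (\<lambda>n. F n s) \<longlonglongrightarrow> h s"
  show "(\<lambda>n. LINT s:{0..b}|M. F n s) \<longlonglongrightarrow> (LINT s:{0..b}|M. h s)"
    unfolding set_lebesgue_integral_def
  proof (rule integral_dominated_convergence[where w="\<lambda>_. max 0 K"])
    show "(\<lambda>x. indicat_real {0..b} x *\<^sub>R h x) \<in> borel_measurable M"
      "(\<lambda>x. indicat_real {0..b} x *\<^sub>R F n x) \<in> borel_measurable M" for n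
      using F(1,2) M(2) by (auto dest: bounded_borel_measurable cong: measurable_cong_sets)
    show "AE x in M. (\<lambda>n. indicat_real {0..b} x *\<^sub>R F n x) \<longlonglongrightarrow> indicat_real {0..b} x *\<^sub>R h x"
      using F(4) by (auto simp: indicator_def intro!: AE_I2)
    show "AE x in M. norm (indicat_real {0..b} x *\<^sub>R F n x) \<le> max 0 K" for n
      using F(3) by (auto simp: indicator_def le_max_iff_disj intro!: AE_I2)
  qed simp
qed

text \<open>Bounded nonnegative Borel functions are increasing limits of simple functions.\<close>

lemma sigma_functional_eq_0_if_indicators:
  assumes \<Lambda>: "sigma_functional b \<Lambda>"
    and ind: "\<And>S. S \<in> sets borel \<Longrightarrow> \<Lambda> (indicator S) = 0"
    and h: "bounded_borel b h"
  shows "\<Lambda> h = 0"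
proof -
  have pos: "bounded_borel b u \<longrightarrow> \<Lambda> u = 0" if "u \<in> borel_measurable borel" "\<And>s. 0 \<le> u s" for u :: "real \<Rightarrow> real"
    using that
  proof (induction u rule: borel_measurable_induct_real)
    case (set A)
    then show ?case using ind by simp
  next
    case (mult u c)
    show ?case
    proof
      assume cu: "bounded_borel b (\<lambda>x. c * u x)"
      show "\<Lambda> (\<lambda>x. c * u x) = 0"
      proof (cases "c = 0")
        case True
        then show ?thesis using sigma_functional_zero[OF \<Lambda>] by simp
      next
        case False
        have "bounded_borel b u"
          by (rule bounded_borel_cong[OF bounded_borel_cmult[OF cu, of "inverse c"]]) (use False in simp)
        then show ?thesis using mult sigma_functional_cmult[OF \<Lambda>] by simp
      qed
    qed
  next
    case (add u v)
    show ?case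
    proof
      assume "bounded_borel b (\<lambda>x. v x + u x)"
      then obtain K where "\<And>s. s \<in> {0..b} \<Longrightarrow> \<bar>v s + u s\<bar> \<le> K" using bounded_borel_bound by blast
      then have "\<bar>u s\<bar> \<le> K" "\<bar>v s\<bar> \<le> K" if "s \<in> {0..b}" for s
        using add.hyps(2,4) that by (smt (verit))+
      then have "bounded_borel b u" "bounded_borel b v"
        using add.hyps by (auto intro!: bounded_borelI[of _ _ K])
      then show "\<Lambda> (\<lambda>x. v x + u x) = 0" using add sigma_functional_add[OF \<Lambda>] by simp
    qed
  next
    case (seq U)
    show ?case
    proof
      assume u: "bounded_borel b u"
      obtain K where K: "\<And>s. s \<in> {0..b} \<Longrightarrow> \<bar>u s\<bar> \<le> K" using bounded_borel_bound[OF u] by blast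
      have le: "\<bar>U i s\<bar> \<le> K" if "s \<in> {0..b}" for i s
      proof -
        have "U i s \<le> u s"
          using seq.hyps by (intro incseq_le) (auto simp: incseq_def le_fun_def)
        then show ?thesis using K[OF that] seq.hyps(2)[of i s] by simp
      qed
      then have U: "bounded_borel b (U i)" for i by (intro bounded_borelI seq.hyps)
      have "(\<lambda>i. \<Lambda> (U i)) \<longlonglongrightarrow> \<Lambda> u"
        by (rule sigma_functional_tendsto[OF \<Lambda> U u, where K=K]) (use le seq.hyps in auto)
      moreover have "\<Lambda> (U i) = 0" for i using seq U by simp
      ultimately show "\<Lambda> u = 0" by (simp add: LIMSEQ_const_iff)
    qed
  qed
  define u where "u s = indicator {0..b} s * h s" for s
  have u[measurable]: "u \<in> borel_measurable borel"
    unfolding u_def[abs_def] by (rule bounded_borel_measurable[OF h])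
  obtain K where K: "\<And>s. s \<in> {0..b} \<Longrightarrow> \<bar>h s\<bar> \<le> K" using bounded_borel_bound[OF h] by blast
  have "\<bar>u s\<bar> \<le> K" if "s \<in> {0..b}" for s using K[OF that] that by (simp add: u_def)
  then have "\<bar>max 0 (u s)\<bar> \<le> K \<and> \<bar>max 0 (- u s)\<bar> \<le> K" if "s \<in> {0..b}" for s
    using that by (smt (verit))
  then have parts: "bounded_borel b (\<lambda>s. max 0 (u s))" "bounded_borel b (\<lambda>s. max 0 (- u s))"
    by (auto intro!: bounded_borelI[of _ _ K])
  have "\<Lambda> h = \<Lambda> (\<lambda>s. max 0 (u s) - max 0 (- u s))"
    by (rule sigma_functional_cong[OF \<Lambda> h]) (auto simp: u_def)
  also have "\<dots> = \<Lambda> (\<lambda>s. max 0 (u s)) - \<Lambda> (\<lambda>s. max 0 (- u s))"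
    by (rule sigma_functional_diff[OF \<Lambda> parts])
  also have "\<dots> = 0" using pos parts by simp
  finally show ?thesis .
qed

text \<open>Monomials determine the functional on continuous functions by the Weierstrass theorem; continuous
  functions decrease to the indicators of half lines; and the half lines form an intersection-stable
  generator of the Borel sets.\<close>

lemma sigma_functional_eq_0_if_moments:
  assumes \<Lambda>: "sigma_functional b \<Lambda>"
    and mom: "\<And>k. \<Lambda> (\<lambda>s. s ^ k) = 0"
    and h: "bounded_borel b h"
  shows "\<Lambda> h = 0"
proof (rule sigma_functional_eq_0_if_indicators[OF \<Lambda> _ h])
  have poly: "bounded_borel b (\<lambda>s. \<Sum>i\<le>n. a i * s ^ i) \<and> \<Lambda> (\<lambda>s. \<Sum>i\<le>n. a i * s ^ i) = 0"
    for a :: "nat \<Rightarrow> real" and n :: nat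
  proof (induction n)
    case 0
    then show ?case using sigma_functional_cmult[OF \<Lambda>, of "\<lambda>s. s ^ 0" "a 0"] mom[of 0] by simp
  next
    case (Suc n)
    have p: "bounded_borel b (\<lambda>s. a (Suc n) * s ^ Suc n)" by (intro bounded_borel_cmult bounded_borel_power)
    have "\<Lambda> (\<lambda>s. a (Suc n) * s ^ Suc n) = 0"
      using sigma_functional_cmult[OF \<Lambda> bounded_borel_power, of "a (Suc n)" "Suc n"] mom[of "Suc n"] by simp
    then show ?case
      using Suc sigma_functional_add[OF \<Lambda> _ p] bounded_borel_add[OF _ p] by simp
  qed
  have cont: "\<Lambda> f = 0" if f: "continuous_on {0..b} f" for f
  proof -
    have "\<exists>g. real_polynomial_function g \<and> (\<forall>s\<in>{0..b}. \<bar>f s - g s\<bar> < 1 / real (Suc n))" for n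
      by (rule Stone_Weierstrass_real_polynomial_function[OF _ f, of "1 / real (Suc n)"]) auto
    then obtain g where g: "\<And>n. real_polynomial_function (g n)"
        "\<And>n s. s \<in> {0..b} \<Longrightarrow> \<bar>f s - g n s\<bar> < 1 / real (Suc n)" by metis
    have g0: "bounded_borel b (g n)" "\<Lambda> (g n) = 0" for n
      using g(1)[of n] poly unfolding real_polynomial_function_iff_sum by auto
    have bform: "bounded_borel b f" using f by (rule bounded_borel_continuous_on)
    obtain K where K: "\<And>s. s \<in> {0..b} \<Longrightarrow> \<bar>f s\<bar> \<le> K" using bounded_borel_bound[OF bform] by blast
    have "(\<lambda>n. \<Lambda> (g n)) \<longlonglongrightarrow> \<Lambda> f"
    proof (rule sigma_functional_tendsto[OF \<Lambda> g0(1) bform, where K="K + 1"])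
      fix s assume s: "s \<in> {0..b}"
      show "\<bar>g n s\<bar> \<le> K + 1" for n
      proof -
        have "1 / real (Suc n) \<le> 1" by simp
        then show ?thesis using g(2)[OF s, of n] K[OF s] by linarith
      qed
      show "(\<lambda>n. g n s) \<longlonglongrightarrow> f s"
      proof (rule LIM_zero_cancel, rule Lim_null_comparison)
        show "\<forall>\<^sub>F n in sequentially. norm (g n s - f s) \<le> 1 / real (Suc n)"
          using g(2)[OF s] by (intro always_eventually allI) (simp add: abs_minus_commute less_imp_le)
        show "(\<lambda>n. 1 / real (Suc n)) \<longlonglongrightarrow> 0"
          by (rule LIMSEQ_inverse_real_of_nat[unfolded inverse_eq_divide])
      qed
    qed
    then show ?thesis using g0(2) by (simp add: LIMSEQ_const_iff)
  qed
  have atMost: "\<Lambda> (indicator {..a}) = 0" for a :: real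
  proof -
    define F where "F n s = max 0 (min 1 (1 - real n * (s - a)))" for n s
    have F0: "\<Lambda> (F n) = 0" "bounded_borel b (F n)" for n
      unfolding F_def[abs_def]
      by (intro cont bounded_borel_continuous_on continuous_intros)+
    have "(\<lambda>n. \<Lambda> (F n)) \<longlonglongrightarrow> \<Lambda> (indicator {..a})"
    proof (rule sigma_functional_tendsto[OF \<Lambda> F0(2), where K=1])
      show "\<bar>F n s\<bar> \<le> 1" for n s by (auto simp: F_def)
      show "(\<lambda>n. F n s) \<longlonglongrightarrow> indicator {..a} s" for s
      proof (cases "s \<le> a")
        case True
        then have "F n s = 1" for n
          by (simp add: F_def min_def max_def mult_nonneg_nonpos)
        then show ?thesis using True by simp
      next
        case False
        then obtain N where N: "1 < real N * (s - a)" using reals_Archimedean3[of "s - a"] by auto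
        have "F n s = 0" if "n \<ge> N" for n
        proof -
          have "real N * (s - a) \<le> real n * (s - a)" using False that by (intro mult_right_mono) auto
          then show ?thesis using N by (simp add: F_def)
        qed
        then have "eventually (\<lambda>n. F n s = 0) sequentially" by (intro eventually_sequentiallyI)
        then show ?thesis using False by (auto intro: tendsto_eventually)
      qed
    qed simp
    then show ?thesis using F0(1) by (simp add: LIMSEQ_const_iff)
  qed
  fix S :: "real set" assume "S \<in> sets borel"
  then have S: "S \<in> sigma_sets UNIV (range (\<lambda>a. {..a}))"
    by (subst (asm) borel_eq_atMost) simp
  have stable: "Int_stable (range (\<lambda>a::real. {..a}))"
    by (auto simp: Int_stable_def)
  have borel: "T \<in> sets borel" if "T \<in> sigma_sets UNIV (range (\<lambda>a::real. {..a}))" for T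
    using that by (subst borel_eq_atMost) simp
  show "\<Lambda> (indicator S) = 0"
  proof (rule sigma_sets_induct_disjoint[OF stable _ S])
    show "range (\<lambda>a::real. {..a}) \<subseteq> Pow UNIV" by simp
  next
    fix A :: "real set" assume "A \<in> range (\<lambda>a. {..a})"
    then show "\<Lambda> (indicator A) = 0" using atMost by auto
  next
    have "\<Lambda> (indicator {}) = \<Lambda> (\<lambda>_. 0)" by (rule arg_cong[of _ _ \<Lambda>]) auto
    then show "\<Lambda> (indicator {}) = 0" using sigma_functional_zero[OF \<Lambda>] by simp
  next
    fix A :: "real set"
    assume compl: "A \<in> sigma_sets UNIV (range (\<lambda>a. {..a}))" "\<Lambda> (indicator A) = 0"
    have "\<Lambda> (indicator (UNIV - A)) = \<Lambda> (\<lambda>s. 1 - indicator A s)"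
      by (rule arg_cong[of _ _ \<Lambda>]) (auto simp: indicator_def)
    also have "\<dots> = \<Lambda> (\<lambda>s. 1) - \<Lambda> (indicator A)"
      using compl borel by (intro sigma_functional_diff[OF \<Lambda>]) auto
    finally show "\<Lambda> (indicator (UNIV - A)) = 0" using compl mom[of 0] by simp
  next
    fix A :: "nat \<Rightarrow> real set"
    assume union: "disjoint_family A" "range A \<subseteq> sigma_sets UNIV (range (\<lambda>a. {..a}))"
      "\<And>i. \<Lambda> (indicator (A i)) = 0"
    define F where "F n = (\<lambda>s. \<Sum>i<n. indicat_real (A i) s)" for n
    have A: "A i \<in> sets borel" "\<Lambda> (indicator (A i)) = 0" for i using union borel by auto
    have F: "bounded_borel b (F n) \<and> \<Lambda> (F n) = 0" for n
    proof (induction n)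
      case 0
      then show ?case using sigma_functional_zero[OF \<Lambda>] by (simp add: F_def)
    next
      case (Suc n)
      then show ?case
        using A[of n] sigma_functional_add[OF \<Lambda>, of "F n" "indicator (A n)"]
          bounded_borel_add[of b "F n" "indicator (A n)"] by (simp add: F_def)
    qed
    have sums: "(\<lambda>i. indicat_real (A i) s) sums indicator (\<Union>i. A i) s" for s
      using union(1) by (intro indicator_sums) (auto simp: disjoint_family_on_def)
    have "(\<lambda>n. \<Lambda> (F n)) \<longlonglongrightarrow> \<Lambda> (indicator (\<Union>i. A i))"
    proof (rule sigma_functional_tendsto[OF \<Lambda>, where K=1])
      show "(\<lambda>n. F n s) \<longlonglongrightarrow> indicator (\<Union>i. A i) s" for s
        using sums[of s] by (simp add: sums_def F_def)
      show "\<bar>F n s\<bar> \<le> 1" for n s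
      proof -
        have "F n s \<le> indicator (\<Union>i. A i) s"
          using sums[of s] unfolding F_def
          by (metis indicator_pos_le sum_le_suminf sums_iff finite_lessThan)
        also have "\<dots> \<le> 1" by (simp add: indicator_def)
        finally show ?thesis by (simp add: F_def sum_nonneg)
      qed
      show "bounded_borel b (indicator (\<Union>i. A i))" using A by auto
    qed (use F in auto)
    then show "\<Lambda> (indicator (\<Union>i. A i)) = 0" using F by (simp add: LIMSEQ_const_iff)
  qed
qed

lemma sigma_functional_eq_if_moments:
  assumes "sigma_functional b \<Lambda>" "sigma_functional b \<Lambda>'"
    and "\<And>k. \<Lambda> (\<lambda>s. s ^ k) = \<Lambda>' (\<lambda>s. s ^ k)" and "bounded_borel b h"
  shows "\<Lambda> h = \<Lambda>' h"
  using sigma_functional_eq_0_if_moments[OF sigma_functional_minus[OF assms(1,2)] _ assms(4)] assms(3)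
  by simp

lemma sigma_functional_eq_if_indicators:
  assumes "sigma_functional b \<Lambda>" "sigma_functional b \<Lambda>'"
    and "\<And>S. S \<in> sets borel \<Longrightarrow> \<Lambda> (indicator S) = \<Lambda>' (indicator S)" and "bounded_borel b h"
  shows "\<Lambda> h = \<Lambda>' h"
  using sigma_functional_eq_0_if_indicators[OF sigma_functional_minus[OF assms(1,2)] _ assms(4)] assms(3)
  by simp

section \<open>Functional calculus from moments\<close>

text \<open>The measures are required to have the right moments, and nothing is assumed about their
  dependence on \<open>x\<close>. Both the solutions of the moment problem and the scalar measures of a given spectral
  measure are of this form, so one calculus serves existence and uniqueness.\<close>

locale spectral_family =
  fixes B :: "'a::{real_inner,complete_space} \<Rightarrow> 'a" and b :: real and \<mu> :: "'a \<Rightarrow> real measure"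
  assumes selfadjoint_B: "selfadjoint B"
    and finite_\<mu>: "\<And>x. finite_measure (\<mu> x)"
    and sets_\<mu>: "\<And>x. sets (\<mu> x) = sets borel"
    and concentrated: "\<And>x. emeasure (\<mu> x) (- {0..b}) = 0"
    and moments: "\<And>x k. (LINT s:{0..b}|\<mu> x. s ^ k) = (B ^^ k) x \<bullet> x"
begin

definition qform :: "(real \<Rightarrow> real) \<Rightarrow> 'a \<Rightarrow> real" where
  "qform h x = (LINT s:{0..b}|\<mu> x. h s)"

definition bform :: "(real \<Rightarrow> real) \<Rightarrow> 'a \<Rightarrow> 'a \<Rightarrow> real" where
  "bform h x y = (qform h (x + y) - qform h (x - y)) / 4"

lemma sigma_functional_qform: "sigma_functional b (\<lambda>h. qform h x)"
  unfolding qform_def by (rule sigma_functional_integral[OF finite_\<mu> sets_\<mu>])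

lemma sigma_functional_bform: "sigma_functional b (\<lambda>h. bform h x y)"
  unfolding bform_def by (intro sigma_functional_divide sigma_functional_minus sigma_functional_qform)

lemma qform_power: "qform (\<lambda>s. s ^ k) x = (B ^^ k) x \<bullet> x"
  by (simp add: qform_def moments)

lemma bform_power: "bform (\<lambda>s. s ^ k) x y = (B ^^ k) x \<bullet> y"
proof -
  have Bk: "selfadjoint (B ^^ k)" by (rule selfadjoint_funpow[OF selfadjoint_B])
  interpret Bk: bounded_linear "B ^^ k" using Bk by (rule selfadjoint_bounded_linear)
  show ?thesis
    using selfadjoint_inner[OF Bk, of x y] inner_commute[of x "(B ^^ k) y"]
    by (simp add: bform_def qform_power Bk.add Bk.diff inner_simps)
qed

lemma qform_mono:
  assumes "bounded_borel b h" "bounded_borel b g" "\<And>s. s \<in> {0..b} \<Longrightarrow> h s \<le> g s"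
  shows "qform h x \<le> qform g x"
  unfolding qform_def
  using assms by (intro set_integral_mono set_integrable_bounded_borel finite_\<mu> sets_\<mu>) auto

lemma qform_const: "qform (\<lambda>_. c) x = c * (norm x)\<^sup>2"
  using sigma_functional_cmult[OF sigma_functional_qform[of x] bounded_borel_power[of b 0], of c] qform_power[of 0 x]
  by (simp add: power2_norm_eq_inner)

lemma qform_bound:
  assumes h: "bounded_borel b h" and K: "\<And>s. s \<in> {0..b} \<Longrightarrow> \<bar>h s\<bar> \<le> K"
  shows "\<bar>qform h x\<bar> \<le> K * (norm x)\<^sup>2"
proof -
  have "h s \<le> K \<and> - K \<le> h s" if "s \<in> {0..b}" for s using K[OF that] by linarith
  then have "qform h x \<le> qform (\<lambda>_. K) x" "qform (\<lambda>_. - K) x \<le> qform h x"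
    using h by (auto intro!: qform_mono)
  then show ?thesis by (simp add: qform_const abs_le_iff)
qed

text \<open>This reduces an identity between polarized measures to one about powers of \<open>B\<close>; it is how all
  algebraic properties of the calculus are obtained.\<close>

lemma bform_eq_if_moments:
  assumes "sigma_functional b \<Lambda>" "\<And>k. \<Lambda> (\<lambda>s. s ^ k) = (B ^^ k) x \<bullet> y" "bounded_borel b h"
  shows "bform h x y = \<Lambda> h"
  by (rule sigma_functional_eq_if_moments[OF sigma_functional_bform assms(1) _ assms(3)]) (simp add: bform_power assms(2))

lemma bform_commute:
  assumes h: "bounded_borel b h"
  shows "bform h x y = bform h y x"
proof (rule bform_eq_if_moments[OF sigma_functional_bform _ h])
  show "bform (\<lambda>s. s ^ k) y x = (B ^^ k) x \<bullet> y" for k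
    using selfadjoint_inner[OF selfadjoint_funpow[OF selfadjoint_B], of k y x]
    by (simp add: bform_power inner_commute)
qed

lemma bform_add_left: "bounded_borel b h \<Longrightarrow> bform h (x + z) y = bform h x y + bform h z y"
  by (rule bform_eq_if_moments[OF sigma_functional_plus[OF sigma_functional_bform sigma_functional_bform]])
     (simp_all add: bform_power inner_add_left
       bounded_linear.axioms(1)[OF selfadjoint_bounded_linear[OF selfadjoint_funpow[OF selfadjoint_B]], THEN linear_add])

lemma bform_scale_left: "bounded_borel b h \<Longrightarrow> bform h (c *\<^sub>R x) y = c * bform h x y"
  by (rule bform_eq_if_moments[OF sigma_functional_scale[OF sigma_functional_bform]])
     (simp_all add: bform_power
       bounded_linear.axioms(1)[OF selfadjoint_bounded_linear[OF selfadjoint_funpow[OF selfadjoint_B]], THEN linear_scale])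

lemma bform_add_right: "bounded_borel b h \<Longrightarrow> bform h x (y + z) = bform h x y + bform h x z"
  by (metis bform_add_left bform_commute)

lemma bform_scale_right: "bounded_borel b h \<Longrightarrow> bform h x (c *\<^sub>R y) = c * bform h x y"
  by (metis bform_scale_left bform_commute)

lemma bform_same: "bounded_borel b h \<Longrightarrow> bform h x x = qform h x"
  by (rule bform_eq_if_moments[OF sigma_functional_qform]) (simp_all add: qform_power)

lemma bform_bound:
  assumes h: "bounded_borel b h" and K: "\<And>s. s \<in> {0..b} \<Longrightarrow> \<bar>h s\<bar> \<le> K"
  shows "\<bar>bform h x y\<bar> \<le> K * norm x * norm y"
proof -
  \<comment> \<open>The parallelogram law gives a bound that is sharp for vectors of equal norm; the
    general case follows by scaling both vectors to norm one.\<close>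
  have *: "\<bar>bform h u v\<bar> \<le> K / 2 * ((norm u)\<^sup>2 + (norm v)\<^sup>2)" for u v
  proof -
    have "\<bar>bform h u v\<bar> \<le> (\<bar>qform h (u + v)\<bar> + \<bar>qform h (u - v)\<bar>) / 4"
      unfolding bform_def by (simp add: abs_triangle_ineq4 divide_right_mono)
    also have "\<dots> \<le> (K * (norm (u + v))\<^sup>2 + K * (norm (u - v))\<^sup>2) / 4"
      by (intro divide_right_mono add_mono qform_bound[OF h K]) auto
    also have "\<dots> = K / 2 * ((norm u)\<^sup>2 + (norm v)\<^sup>2)"
      by (simp add: power2_norm_eq_inner inner_simps inner_commute algebra_simps)
    finally show ?thesis .
  qed
  show ?thesis
  proof (cases "x = 0 \<or> y = 0")
    case True
    then show ?thesis using bform_scale_left[OF h, of 0 x y] bform_scale_right[OF h, of x 0 y] by auto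
  next
    case False
    then have n: "norm x > 0" "norm y > 0" by auto
    have "x = norm x *\<^sub>R sgn x" "y = norm y *\<^sub>R sgn y" using n by (auto simp: sgn_div_norm)
    then have "bform h x y = norm x * norm y * bform h (sgn x) (sgn y)"
      using bform_scale_left[OF h, of "norm x" "sgn x" y] bform_scale_right[OF h, of "sgn x" "norm y" "sgn y"]
      by simp
    then have "\<bar>bform h x y\<bar> = norm x * norm y * \<bar>bform h (sgn x) (sgn y)\<bar>" by (simp add: abs_mult)
    also have "\<dots> \<le> norm x * norm y * (K / 2 * ((norm (sgn x))\<^sup>2 + (norm (sgn y))\<^sup>2))"
      by (intro mult_left_mono *) simp
    also have "\<dots> = K * norm x * norm y" using False by (simp add: norm_sgn)
    finally show ?thesis .
  qed
qed

text \<open>The vector that represents the functional \<open>bform h x\<close>.\<close>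

definition calc :: "(real \<Rightarrow> real) \<Rightarrow> 'a \<Rightarrow> 'a" where
  "calc h x = (SOME z. \<forall>y. bform h x y = y \<bullet> z)"

lemma calc_inner:
  assumes h: "bounded_borel b h"
  shows "calc h x \<bullet> y = bform h x y"
proof -
  obtain K where K: "\<And>s. s \<in> {0..b} \<Longrightarrow> \<bar>h s\<bar> \<le> K" using bounded_borel_bound[OF h] by blast
  have "bounded_linear (\<lambda>y. bform h x y)"
  proof (rule bounded_linear_intro[where K="K * norm x"])
    show "norm (bform h x y) \<le> norm y * (K * norm x)" for y
      using bform_bound[OF h K, of x y] by (simp add: mult_ac)
  qed (simp_all add: bform_add_right[OF h] bform_scale_right[OF h])
  then obtain z where "\<And>y. bform h x y = y \<bullet> z" by (rule riesz_representation) blast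
  then have "\<forall>y. bform h x y = y \<bullet> calc h x"
    unfolding calc_def by (intro someI[where P="\<lambda>z. \<forall>y. bform h x y = y \<bullet> z"]) blast
  then show ?thesis by (simp add: inner_commute)
qed

lemma calc_quadratic: "bounded_borel b h \<Longrightarrow> calc h x \<bullet> x = qform h x"
  by (simp add: calc_inner bform_same)

lemma selfadjoint_calc:
  assumes h: "bounded_borel b h"
  shows "selfadjoint (calc h)"
  unfolding selfadjoint_def
proof
  obtain K where "K \<ge> 0" and K: "\<And>s. s \<in> {0..b} \<Longrightarrow> \<bar>h s\<bar> \<le> K"
    using bounded_borel_bound[OF h] by blast
  show "bounded_linear (calc h)"
  proof (rule bounded_linear_intro[where K=K])
    show "calc h (x + y) = calc h x + calc h y" for x y
      by (rule inner_eqI) (simp add: calc_inner[OF h] bform_add_left[OF h] inner_simps)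
    show "calc h (r *\<^sub>R x) = r *\<^sub>R calc h x" for r x
      by (rule inner_eqI) (simp add: calc_inner[OF h] bform_scale_left[OF h] inner_simps)
    show "norm (calc h x) \<le> norm x * K" for x
    proof -
      have "norm (calc h x) * norm (calc h x) = bform h x (calc h x)"
        using calc_inner[OF h, of x "calc h x"] by (simp add: power2_norm_eq_inner[symmetric] power2_eq_square)
      also have "\<dots> \<le> K * norm x * norm (calc h x)"
        using bform_bound[OF h K, of x "calc h x"] by simp
      finally have *: "norm (calc h x) * norm (calc h x) \<le> (norm x * K) * norm (calc h x)"
        by (simp add: mult_ac)
      have "0 \<le> norm x * K" using \<open>K \<ge> 0\<close> by simp
      then show ?thesis
        using * by (cases "norm (calc h x) = 0") (auto simp: mult_le_cancel_right)
    qed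
  qed
  show "\<forall>x y. calc h x \<bullet> y = x \<bullet> calc h y"
    using bform_commute[OF h] by (simp add: calc_inner[OF h] inner_commute[of _ "calc h _"])
qed

lemma calc_add:
  assumes "bounded_borel b h" "bounded_borel b g"
  shows "calc (\<lambda>s. h s + g s) x = calc h x + calc g x"
  by (rule inner_eqI)
     (simp add: calc_inner assms bounded_borel_add inner_add_left sigma_functional_add[OF sigma_functional_bform assms])

lemma calc_cmult:
  assumes "bounded_borel b h"
  shows "calc (\<lambda>s. c * h s) x = c *\<^sub>R calc h x"
  by (rule inner_eqI)
     (simp add: calc_inner assms bounded_borel_cmult sigma_functional_cmult[OF sigma_functional_bform assms])

lemma calc_power: "calc (\<lambda>s. s ^ k) x = (B ^^ k) x"
  by (rule inner_eqI) (simp add: calc_inner bform_power)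

text \<open>A weight \<open>s\<^sup>k\<close> in the polarized measure of \<open>(x, y)\<close> amounts to replacing \<open>x\<close> by \<open>(B ^^ k) x\<close>, as
  comparison of moments shows. Reading this with an arbitrary \<open>g\<close> as integrand, a weight \<open>g\<close>
  amounts to replacing \<open>y\<close> by \<open>calc g y\<close>, again by comparison of moments.\<close>

lemma calc_mult:
  assumes g: "bounded_borel b g" and h: "bounded_borel b h"
  shows "calc (\<lambda>s. g s * h s) x = calc g (calc h x)"
proof -
  have power: "bform (\<lambda>s. s ^ k * g s) u y = bform g ((B ^^ k) u) y" if g: "bounded_borel b g" for g u k y
    by (rule bform_eq_if_moments[OF sigma_functional_weight[OF sigma_functional_bform bounded_borel_power] _ g, symmetric])
       (simp add: power_add[symmetric] bform_power add.commute[of k] funpow_add)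
  have "bform (\<lambda>s. g s * h s) x y = bform h x (calc g y)" for y
  proof (rule bform_eq_if_moments[OF sigma_functional_weight[OF sigma_functional_bform g] _ h, symmetric])
    fix k
    have "bform (\<lambda>s. g s * s ^ k) x y = bform g ((B ^^ k) x) y"
      using power[OF g, of k x y] by (simp add: mult.commute)
    also have "\<dots> = (B ^^ k) x \<bullet> calc g y"
      using bform_commute[OF g] calc_inner[OF g, of y "(B ^^ k) x"] by (simp add: inner_commute)
    finally show "bform (\<lambda>s. g s * s ^ k) x y = (B ^^ k) x \<bullet> calc g y" .
  qed
  then have "calc (\<lambda>s. g s * h s) x \<bullet> y = calc g (calc h x) \<bullet> y" for y
    using calc_inner[OF bounded_borel_mult[OF g h], of x y] calc_inner[OF h, of x "calc g y"]
      selfadjoint_inner[OF selfadjoint_calc[OF g], of "calc h x" y] by simp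
  then show ?thesis by (rule inner_eqI)
qed

lemma calc_cong:
  assumes "bounded_borel b h" "\<And>s. s \<in> {0..b} \<Longrightarrow> h s = g s"
  shows "calc h x = calc g x"
proof (rule inner_eqI)
  have "bounded_borel b g" using bounded_borel_cong[OF assms] .
  then show "calc h x \<bullet> y = calc g x \<bullet> y" for y
    by (simp add: calc_inner assms(1)) (rule sigma_functional_cong[OF sigma_functional_bform assms])
qed

end

section \<open>Existence of the spectral measure\<close>

lemma onorm_bound_inner:
  assumes "bounded_linear B"
  shows "B x \<bullet> x \<le> onorm B * (norm x)\<^sup>2"
proof -
  have "B x \<bullet> x \<le> norm (B x) * norm x" by (rule norm_cauchy_schwarz)
  also have "\<dots> \<le> onorm B * norm x * norm x" by (intro mult_right_mono onorm assms) simp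
  finally show ?thesis by (simp add: power2_eq_square mult_ac)
qed

lemma funpow_commute:
  assumes "\<And>x. f (g x) = g (f x)"
  shows "(f ^^ n) (g x) = g ((f ^^ n) x)"
  by (induction n) (simp_all add: assms)

text \<open>Two equal factors can be distributed to both sides of the inner product, which lowers the exponent
  by two. What remains are exponents at most one.\<close>

lemma bernstein_operators_nonneg:
  fixes C R :: "'a::real_inner \<Rightarrow> 'a"
  assumes C: "nonneg_selfadjoint C" and R: "nonneg_selfadjoint R" and CR: "\<And>x. C x + R x = x"
  shows "0 \<le> (C ^^ k) ((R ^^ l) x) \<bullet> x"
proof -
  have sC: "selfadjoint C" and sR: "selfadjoint R" using C R by (auto simp: nonneg_selfadjoint_def)
  interpret C: bounded_linear C using sC by (rule selfadjoint_bounded_linear)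
  interpret R: bounded_linear R using sR by (rule selfadjoint_bounded_linear)
  have R_eq: "R x = x - C x" for x using CR[of x] by (simp add: algebra_simps)
  have comm: "C (R x) = R (C x)" for x by (simp add: R_eq C.diff)
  have comm_C: "(C ^^ n) (R x) = R ((C ^^ n) x)" for n x by (rule funpow_commute) (rule comm)
  have comm_R: "(R ^^ n) (C x) = C ((R ^^ n) x)" for n x by (rule funpow_commute) (rule comm[symmetric])
  have nn: "0 \<le> C y \<bullet> y" "0 \<le> R y \<bullet> y" for y using C R by (auto simp: nonneg_selfadjoint_def)
  show ?thesis
  proof (induction "k + l" arbitrary: k l x rule: less_induct)
    case less
    consider i where "k = Suc (Suc i)" | j where "l = Suc (Suc j)"
      | "k = 0" "l = 0" | "k = 1" "l = 0" | "k = 0" "l = 1" | "k = 1" "l = 1"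
      by (metis One_nat_def not0_implies_Suc)
    then show ?case
    proof cases
      case 1
      have "(C ^^ k) ((R ^^ l) x) \<bullet> x = (C ^^ i) ((R ^^ l) (C x)) \<bullet> C x"
        by (simp add: 1 selfadjoint_inner[OF sC] comm_R flip: funpow_swap1)
      then show ?thesis using less[of i l "C x"] 1 by simp
    next
      case 2
      have "(C ^^ k) ((R ^^ l) x) \<bullet> x = (C ^^ k) ((R ^^ j) (R x)) \<bullet> R x"
        by (simp add: 2 selfadjoint_inner[OF sR] comm_C flip: funpow_swap1)
      then show ?thesis using less[of k j "R x"] 2 by simp
    next
      case 6
      \<comment> \<open>\<open>C R = C (R + C) R = R C R + C R C\<close>\<close>
      have "C (R x) \<bullet> x = C (R x) \<bullet> (R x + C x)" using CR[of x] by (simp add: add.commute)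
      also have "\<dots> = C (R x) \<bullet> R x + R (C x) \<bullet> C x" by (simp add: inner_add_right comm)
      finally show ?thesis using 6 nn(1)[of "R x"] nn(2)[of "C x"] by simp
    qed (use nn in auto)
  qed
qed

text \<open>The moment problem is solved on the unit interval for \<open>C = B / b\<close> with \<open>b = onorm B\<close>, and the
  solution is scaled back.\<close>

lemma spectral_family_exists:
  fixes B :: "'a::{real_inner,complete_space} \<Rightarrow> 'a"
  assumes B: "nonneg_selfadjoint B"
  shows "\<exists>\<mu>. spectral_family B (onorm B) \<mu>"
proof -
  define b where "b = onorm B"
  have sB: "selfadjoint B" using B by (simp add: nonneg_selfadjoint_def)
  interpret B: bounded_linear B using sB by (rule selfadjoint_bounded_linear)
  have b0: "0 \<le> b" unfolding b_def by (rule onorm_pos_le[OF B.bounded_linear_axioms])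
  \<comment> \<open>If \<open>b = 0\<close> then \<open>C = 0\<close>, since
    \<open>1 / 0 = 0\<close>, and \<open>B = b C\<close> still holds because
    \<open>B = 0\<close>.\<close>
  define C where "C x = (1 / b) *\<^sub>R B x" for x
  define R where "R x = x - C x" for x
  have BC: "B x = b *\<^sub>R C x" for x
  proof (cases "b = 0")
    case True
    then have "norm (B x) \<le> 0" using onorm[OF B.bounded_linear_axioms, of x] by (simp add: b_def)
    then show ?thesis using True by simp
  qed (simp add: C_def)
  have blC: "bounded_linear C"
    unfolding C_def[abs_def] by (intro bounded_linear_const_scaleR B.bounded_linear_axioms)
  interpret C: bounded_linear C by fact
  have C: "nonneg_selfadjoint C"
    unfolding nonneg_selfadjoint_def selfadjoint_def
    using blC B selfadjoint_inner[OF sB] b0 by (auto simp: C_def nonneg_selfadjoint_def)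
  then have sC: "selfadjoint C" by (simp add: nonneg_selfadjoint_def)
  have C_le: "C x \<bullet> x \<le> x \<bullet> x" for x
    using onorm_bound_inner[OF B.bounded_linear_axioms, of x] b0
    by (cases "b = 0") (auto simp: C_def b_def[symmetric] power2_norm_eq_inner field_simps)
  have R: "nonneg_selfadjoint R"
    unfolding nonneg_selfadjoint_def selfadjoint_def
    using bounded_linear_sub[OF bounded_linear_ident blC] C_le selfadjoint_inner[OF sC]
    by (auto simp: R_def[abs_def] inner_diff_left inner_diff_right)
  have "\<exists>M. sets M = sets borel \<and> finite_measure M \<and> emeasure M (- {0..1}) = 0 \<and>
         (\<forall>k. (LINT s:{0..1}|M. s ^ k) = (C ^^ k) x \<bullet> x)" for x
  proof -
    have pascal: "(C ^^ k) ((R ^^ l) x) \<bullet> x = (C ^^ Suc k) ((R ^^ l) x) \<bullet> x + (C ^^ k) ((R ^^ Suc l) x) \<bullet> x" for k l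
    proof -
      interpret Ck: bounded_linear "C ^^ k"
        by (rule selfadjoint_bounded_linear[OF selfadjoint_funpow[OF sC]])
      have "(C ^^ k) ((R ^^ Suc l) x) = (C ^^ k) ((R ^^ l) x) - (C ^^ k) (C ((R ^^ l) x))"
        using Ck.diff[of "(R ^^ l) x" "C ((R ^^ l) x)"] by (simp add: R_def)
      then show ?thesis by (simp add: funpow_swap1 inner_diff_left)
    qed
    have nonneg: "0 \<le> (C ^^ k) ((R ^^ l) x) \<bullet> x" for k l
      by (rule bernstein_operators_nonneg[OF C R]) (simp add: R_def)
    obtain M where "sets M = sets borel" "finite_measure M" "emeasure M (- {0..1}) = 0"
        "\<And>k. (LINT s:{0..1}|M. s ^ k) = (C ^^ k) ((R ^^ 0) x) \<bullet> x"
      by (rule hausdorff_moment_problem[of "\<lambda>k l. (C ^^ k) ((R ^^ l) x) \<bullet> x", OF nonneg pascal]) blast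
    then show ?thesis by (intro exI[of _ M]) simp
  qed
  then obtain M where M: "\<And>x. sets (M x) = sets borel" "\<And>x. finite_measure (M x)"
      "\<And>x. emeasure (M x) (- {0..1}) = 0"
      "\<And>x k. (LINT s:{0..1}|M x. s ^ k) = (C ^^ k) x \<bullet> x"
    by metis
  define \<mu> where "\<mu> x = distr (M x) borel (\<lambda>t. b * t)" for x
  have meas: "(\<lambda>t. b * t) \<in> measurable (M x) borel" for x
    using M(1) by (simp cong: measurable_cong_sets)
  have scale_in: "b * t \<in> {0..b}" if "t \<in> {0..1}" for t
    using that b0 by (auto intro: mult_left_le)
  have M_AE: "AE t in M x. t \<in> {0..1}" for x
    using M(1,3) by (intro AE_I[of _ _ "- {0..1}"]) auto
  have "spectral_family B b \<mu>"
  proof (rule spectral_family.intro)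
    fix x
    show "selfadjoint B" by fact
    show "finite_measure (\<mu> x)"
      unfolding \<mu>_def by (rule finite_measure.finite_measure_distr[OF M(2) meas])
    show "sets (\<mu> x) = sets borel" by (simp add: \<mu>_def)
    show "emeasure (\<mu> x) (- {0..b}) = 0"
    proof -
      have "emeasure (\<mu> x) (- {0..b}) = emeasure (M x) ((\<lambda>t. b * t) -` (- {0..b}) \<inter> space (M x))"
        unfolding \<mu>_def by (rule emeasure_distr[OF meas]) simp
      also have "\<dots> \<le> emeasure (M x) (- {0..1})"
        using M(1) scale_in by (intro emeasure_mono) auto
      finally show ?thesis using M(3) by simp
    qed
    fix k
    have Bk: "(B ^^ k) y = b ^ k *\<^sub>R (C ^^ k) y" for y
    proof (induction k)
      case (Suc k)
      then show ?case by (simp add: BC C.scaleR)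
    qed simp
    have "(LINT s:{0..b}|\<mu> x. s ^ k) = (\<integral>t. indicator {0..b} (b * t) * (b * t) ^ k \<partial>M x)"
      unfolding \<mu>_def set_lebesgue_integral_def by (subst integral_distr[OF meas]) auto
    also have "\<dots> = (\<integral>t. b ^ k * (indicator {0..1} t * t ^ k) \<partial>M x)"
    proof (rule integral_cong_AE)
      show "AE t in M x. indicator {0..b} (b * t) * (b * t) ^ k = b ^ k * (indicator {0..1} t * t ^ k)"
        using M_AE[of x]
      proof eventually_elim
        case (elim t)
        then show ?case using scale_in[OF elim] by (simp add: power_mult_distrib)
      qed
    qed (use M(1) in \<open>simp_all cong: measurable_cong_sets\<close>)
    also have "\<dots> = b ^ k * (LINT s:{0..1}|M x. s ^ k)"
      by (simp add: set_lebesgue_integral_def)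
    also have "\<dots> = (B ^^ k) x \<bullet> x" by (simp add: M(4) Bk)
    finally show "(LINT s:{0..b}|\<mu> x. s ^ k) = (B ^^ k) x \<bullet> x" .
  qed
  then show ?thesis unfolding b_def by blast
qed

context spectral_family
begin

lemma qform_indicator:
  assumes "S \<in> sets borel"
  shows "ennreal (qform (indicator S) x) = emeasure (\<mu> x) S"
proof -
  interpret finite_measure "\<mu> x" by (rule finite_\<mu>)
  have "emeasure (\<mu> x) S = emeasure (\<mu> x) ({0..b} \<inter> S)"
  proof (rule emeasure_eq_AE)
    have "AE s in \<mu> x. s \<in> {0..b}"
      using concentrated sets_\<mu> by (intro AE_I[of _ _ "- {0..b}"]) auto
    then show "AE s in \<mu> x. (s \<in> S) = (s \<in> {0..b} \<inter> S)" by eventually_elim auto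
  qed (use assms sets_\<mu> in auto)
  moreover have "qform (indicator S) x = (\<integral>s. indicator ({0..b} \<inter> S) s \<partial>\<mu> x)"
    unfolding qform_def set_lebesgue_integral_def by (simp add: indicator_inter_arith)
  moreover have "\<dots> = measure (\<mu> x) ({0..b} \<inter> S)"
    using assms sets_\<mu> sets_eq_imp_space_eq[OF sets_\<mu>] by simp
  ultimately show ?thesis by (simp add: emeasure_eq_measure)
qed

lemma calc_one: "calc (\<lambda>_. 1) x = x"
  using calc_power[of 0] by simp

definition proj :: "real set \<Rightarrow> 'a \<Rightarrow> 'a" where
  "proj S = calc (indicator S)"

lemma scalar_measure_proj: "scalar_measure proj x = \<mu> x"
proof -
  have "scalar_measure proj x = measure_of (space (\<mu> x)) (sets (\<mu> x)) (emeasure (\<mu> x))"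
    unfolding scalar_measure_def proj_def
    using sets_eq_imp_space_eq[OF sets_\<mu>[of x]] sets.sigma_sets_eq[of "borel :: real measure"]
    by (simp add: sets_\<mu>, intro measure_of_eq) (auto simp: calc_quadratic qform_indicator)
  then show ?thesis by (simp add: measure_of_of_measure)
qed

lemma projection_valued_measure_proj: "projection_valued_measure proj"
  unfolding projection_valued_measure_def
proof (intro conjI ballI allI impI)
  fix S :: "real set" assume S: "S \<in> sets borel"
  show "selfadjoint (proj S)" unfolding proj_def using S by (intro selfadjoint_calc) simp
  show "proj S \<circ> proj S = proj S"
  proof
    fix x
    have "calc (indicator S) (calc (indicator S) x) = calc (\<lambda>s. indicator S s * indicator S s) x"
      using S by (simp add: calc_mult)
    also have "\<dots> = calc (indicator S) x"
      by (rule arg_cong[of _ _ "\<lambda>h. calc h x"]) (auto simp: indicator_def)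
    finally show "(proj S \<circ> proj S) x = proj S x" by (simp add: proj_def)
  qed
next
  show "proj UNIV = id"
    using calc_one by (auto simp: proj_def indicator_def[abs_def])
next
  fix F :: "nat \<Rightarrow> real set" and x
  assume F: "range F \<subseteq> sets borel" "disjoint_family F"
  have Fn: "F n \<in> sets borel" for n using F(1) by auto
  then have U: "(\<Union>n. F n) \<in> sets borel" by auto
  \<comment> \<open>\<open>f n\<close> is the indicator of the tail of the union; its square tends to
    \<open>0\<close> boundedly, and \<open>qform\<close> of the square is the squared norm of the
    remainder.\<close>
  define f where "f n = (\<lambda>s. indicator (\<Union>n. F n) s - (\<Sum>i<n. indicat_real (F i) s))" for n
  have ps: "bounded_borel b (\<lambda>s. \<Sum>i<n. indicat_real (F i) s) \<and>
      calc (\<lambda>s. \<Sum>i<n. indicat_real (F i) s) x = (\<Sum>i<n. proj (F i) x)" for n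
  proof (induction n)
    case 0
    then show ?case using calc_cmult[of "\<lambda>_. 0" 0 x] by simp
  next
    case (Suc n)
    then show ?case using Fn[of n] by (simp add: calc_add proj_def bounded_borel_add)
  qed
  have f: "bounded_borel b (f n)" for n
    unfolding f_def using ps U by (intro bounded_borel_diff) auto
  have calc_f: "calc (f n) x = proj (\<Union>n. F n) x - (\<Sum>i<n. proj (F i) x)" for n
    using calc_add[OF bounded_borel_indicator[OF U] bounded_borel_cmult[OF conjunct1[OF ps[of n]], of "-1"], of x]
      calc_cmult[OF conjunct1[OF ps[of n]], of "-1" x] conjunct2[OF ps[of n]]
    by (simp add: f_def proj_def)
  have sums: "(\<lambda>i. indicat_real (F i) s) sums indicator (\<Union>i. F i) s" for s
    using F(2) by (intro indicator_sums) (auto simp: disjoint_family_on_def)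
  have f_bd: "0 \<le> f n s" "f n s \<le> 1" for n s
  proof -
    have "(\<Sum>i<n. indicat_real (F i) s) \<le> indicator (\<Union>i. F i) s"
      using sums[of s] by (metis indicator_pos_le sum_le_suminf sums_iff finite_lessThan)
    then show "0 \<le> f n s" by (simp add: f_def)
    have "0 \<le> (\<Sum>i<n. indicat_real (F i) s)" by (simp add: sum_nonneg)
    moreover have "indicat_real (\<Union>i. F i) s \<le> 1" by (simp add: indicator_def)
    ultimately show "f n s \<le> 1" unfolding f_def by linarith
  qed
  have "(\<lambda>n. qform (\<lambda>s. f n s * f n s) x) \<longlonglongrightarrow> qform (\<lambda>_. 0) x"
  proof (rule sigma_functional_tendsto[OF sigma_functional_qform, where K=1])
    show "\<bar>f n s * f n s\<bar> \<le> 1" for n s using f_bd[of n s] by (simp add: abs_mult mult_le_one)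
    have "(\<lambda>n. f n s) \<longlonglongrightarrow> 0" for s
      using tendsto_diff[OF tendsto_const sums[of s, unfolded sums_def], of "indicator (\<Union>i. F i) s"]
      by (simp add: f_def)
    then show "(\<lambda>n. f n s * f n s) \<longlonglongrightarrow> 0" for s
      using tendsto_mult[of "\<lambda>n. f n s" 0 sequentially "\<lambda>n. f n s" 0] by simp
  qed (use f in auto)
  moreover have "qform (\<lambda>s. f n s * f n s) x = (norm (calc (f n) x))\<^sup>2" for n
    using f[of n] calc_quadratic[OF bounded_borel_mult[OF f[of n] f[of n]], of x]
    by (simp add: calc_mult power2_norm_eq_inner selfadjoint_inner[OF selfadjoint_calc])
  ultimately have "(\<lambda>n. (norm (calc (f n) x))\<^sup>2) \<longlonglongrightarrow> 0"
    by (simp add: qform_const)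
  then have "(\<lambda>n. norm (calc (f n) x)) \<longlonglongrightarrow> 0"
    using tendsto_real_sqrt[of "\<lambda>n. (norm (calc (f n) x))\<^sup>2" 0] by simp
  then have "(\<lambda>n. proj (\<Union>n. F n) x - calc (f n) x) \<longlonglongrightarrow> proj (\<Union>n. F n) x - 0"
    by (intro tendsto_diff tendsto_const) (rule tendsto_norm_zero_cancel)
  then show "(\<lambda>n. proj (F n) x) sums proj (\<Union>n. F n) x"
    by (simp add: sums_def calc_f)
qed

lemma spectral_measure_proj:
  assumes "b = onorm B"
  shows "spectral_measure B proj"
  unfolding spectral_measure_def assms[symmetric]
proof (intro conjI allI)
  show "projection_valued_measure proj" by (rule projection_valued_measure_proj)
  show "proj {0..b} = id"
  proof
    fix x
    have "proj {0..b} x = calc (\<lambda>_. 1) x" unfolding proj_def by (rule calc_cong) auto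
    then show "proj {0..b} x = id x" by (simp add: calc_one)
  qed
  show "B x \<bullet> x = (LINT s:{0..b}|scalar_measure proj x. s)" for x
    using moments[of x 1] by (simp add: scalar_measure_proj)
qed

end

section \<open>Uniqueness of the spectral measure\<close>

locale projection_valued =
  fixes P :: "real set \<Rightarrow> 'a::real_inner \<Rightarrow> 'a"
  assumes pvm: "projection_valued_measure P"
begin

lemma selfadjoint_P: "S \<in> sets borel \<Longrightarrow> selfadjoint (P S)"
  using pvm by (simp add: projection_valued_measure_def)

lemma P_idem: "S \<in> sets borel \<Longrightarrow> P S (P S x) = P S x"
  using pvm unfolding projection_valued_measure_def by (metis comp_apply)

lemma P_UNIV: "P UNIV x = x"
  using pvm by (simp add: projection_valued_measure_def)

lemma P_sums:
  "range F \<subseteq> sets borel \<Longrightarrow> disjoint_family F \<Longrightarrow> (\<lambda>n. P (F n) x) sums P (\<Union>n. F n) x"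
  using pvm unfolding projection_valued_measure_def by blast

lemma P_empty: "P {} x = 0"
proof -
  have "(\<lambda>n::nat. P {} x) sums P (\<Union>n::nat. {}) x"
    by (rule P_sums) (auto simp: disjoint_family_on_def)
  then have "(\<lambda>n::nat. P {} x) \<longlonglongrightarrow> 0" by (intro summable_LIMSEQ_zero sums_summable)
  then show ?thesis by (simp add: LIMSEQ_const_iff)
qed

lemma P_Un:
  assumes "S \<in> sets borel" "T \<in> sets borel" "S \<inter> T = {}"
  shows "P (S \<union> T) x = P S x + P T x"
proof -
  have "(\<lambda>n. P (binaryset S T n) x) sums P (\<Union>n. binaryset S T n) x"
    using assms by (intro P_sums) (auto simp: disjoint_family_on_def binaryset_def)
  moreover have "(\<lambda>n. P (binaryset S T n) x) sums (P S x + P T x)"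
    by (rule binaryset_sums[of "\<lambda>S. P S x"]) (rule P_empty)
  ultimately show ?thesis by (simp add: UN_binaryset_eq sums_unique2)
qed

lemma P_quadratic: "S \<in> sets borel \<Longrightarrow> P S x \<bullet> x = (norm (P S x))\<^sup>2"
  using P_idem[of S x] selfadjoint_inner[OF selfadjoint_P, of S x "P S x"]
    selfadjoint_inner[OF selfadjoint_P, of S "P S x" x]
  by (simp add: power2_norm_eq_inner)

lemma norm_P_le: "S \<in> sets borel \<Longrightarrow> norm (P S x) \<le> norm x"
proof -
  assume S: "S \<in> sets borel"
  have "norm (P S x) * norm (P S x) \<le> norm (P S x) * norm x"
    using P_quadratic[OF S, of x] norm_cauchy_schwarz[of "P S x" x] by (simp add: power2_eq_square)
  then show ?thesis by (cases "norm (P S x) = 0") auto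
qed

text \<open>For \<open>u\<close> in the range of \<open>P S\<close> the part \<open>P S u = u\<close> already exhausts the norm of \<open>u\<close>, so nothing is
  left for a disjoint \<open>T\<close>.\<close>

lemma P_disjoint:
  assumes S: "S \<in> sets borel" and T: "T \<in> sets borel" and disj: "S \<inter> T = {}"
  shows "P T (P S y) = 0"
proof -
  define u where "u = P S y"
  have "(norm (P S u))\<^sup>2 + (norm (P T u))\<^sup>2 = P (S \<union> T) u \<bullet> u"
    by (simp add: P_Un[OF S T disj] inner_add_left P_quadratic S T)
  also have "\<dots> = (norm (P (S \<union> T) u))\<^sup>2" using S T by (intro P_quadratic) auto
  also have "\<dots> \<le> (norm u)\<^sup>2" using S T by (intro power_mono norm_P_le) auto
  also have "norm u = norm (P S u)" by (simp add: u_def P_idem S)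
  finally show ?thesis by (simp add: u_def)
qed

lemma P_Int:
  assumes S: "S \<in> sets borel" and T: "T \<in> sets borel"
  shows "P S (P T x) = P (S \<inter> T) x"
proof -
  have T': "P T x = P (S \<inter> T) x + P (T - S) x"
  proof -
    have "T = (S \<inter> T) \<union> (T - S)" by blast
    then show ?thesis using P_Un[of "S \<inter> T" "T - S" x] S T by auto
  qed
  have S': "P S u = P (S \<inter> T) u + P (S - T) u" for u
  proof -
    have "S = (S \<inter> T) \<union> (S - T)" by blast
    then show ?thesis using P_Un[of "S \<inter> T" "S - T" u] S T by auto
  qed
  interpret PS: bounded_linear "P S" by (rule selfadjoint_bounded_linear[OF selfadjoint_P[OF S]])
  have "P S (P (T - S) x) = 0" by (rule P_disjoint) (use S T in auto)
  moreover have "P (S - T) (P (S \<inter> T) x) = 0" by (rule P_disjoint) (use S T in auto)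
  ultimately show ?thesis using S T by (simp add: T' PS.add S'[of "P (S \<inter> T) x"] P_idem)
qed

lemma sets_scalar_measure: "sets (scalar_measure P x) = sets borel"
  unfolding scalar_measure_def using sets.sigma_sets_eq[of "borel :: real measure"] by simp

lemma emeasure_scalar_measure:
  assumes "S \<in> sets borel"
  shows "emeasure (scalar_measure P x) S = ennreal (P S x \<bullet> x)"
  unfolding scalar_measure_def
proof (rule emeasure_measure_of_sigma)
  show "sigma_algebra UNIV (sets (borel :: real measure))"
    using sets.sigma_algebra_axioms[of "borel :: real measure"] by simp
  show "positive (sets borel) (\<lambda>S. ennreal (P S x \<bullet> x))"
    by (simp add: positive_def P_empty)
  show "countably_additive (sets borel) (\<lambda>S. ennreal (P S x \<bullet> x))"
  proof (rule countably_additiveI)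
    fix F :: "nat \<Rightarrow> real set" assume F: "range F \<subseteq> sets borel" "disjoint_family F"
    have "(\<lambda>n. P (F n) x \<bullet> x) sums (P (\<Union>n. F n) x \<bullet> x)"
      by (rule bounded_linear.sums[OF bounded_linear_inner_left P_sums[OF F]])
    moreover have "0 \<le> P (F n) x \<bullet> x" for n using F(1) by (subst P_quadratic) auto
    ultimately show "(\<Sum>n. ennreal (P (F n) x \<bullet> x)) = ennreal (P (\<Union>n. F n) x \<bullet> x)"
      by (intro suminf_ennreal_eq)
  qed
qed fact

lemma finite_scalar_measure: "finite_measure (scalar_measure P x)"
proof (rule finite_measureI)
  have "space (scalar_measure P x) = UNIV"
    using sets_eq_imp_space_eq[OF sets_scalar_measure] by simp
  then show "emeasure (scalar_measure P x) (space (scalar_measure P x)) \<noteq> \<infinity>"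
    by (simp add: emeasure_scalar_measure)
qed

lemma measure_scalar_measure:
  "S \<in> sets borel \<Longrightarrow> measure (scalar_measure P x) S = P S x \<bullet> x"
  using P_quadratic[of S x] by (simp add: measure_def emeasure_scalar_measure)

end

text \<open>Write \<open>\<beta> h x y\<close> for the polarized integral of \<open>h\<close>. Multiplicativity of \<open>P\<close> moves an indicator from the
  integrand to the vector \<open>y\<close>. Since \<open>\<beta> (\<lambda>s. s) x y = B x \<bullet> y\<close>, replacing \<open>x\<close> by \<open>B x\<close> therefore amounts to the
  weight \<open>s\<close>, and iteration produces all moments.\<close>

lemma spectral_family_scalar_measure:
  fixes B :: "'a::{real_inner,complete_space} \<Rightarrow> 'a"
  assumes B: "selfadjoint B" and P: "spectral_measure B P"
  shows "spectral_family B (onorm B) (scalar_measure P)"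
proof -
  define b where "b = onorm B"
  interpret projection_valued P by standard (use P in \<open>simp add: spectral_measure_def\<close>)
  interpret B: bounded_linear B using B by (rule selfadjoint_bounded_linear)
  have P_b: "P {0..b} x = x" for x using P by (simp add: spectral_measure_def b_def)
  define I where "I h x = (LINT s:{0..b}|scalar_measure P x. h s)" for h :: "real \<Rightarrow> real" and x
  define \<beta> where "\<beta> h x y = (I h (x + y) - I h (x - y)) / 4" for h x y
  have sf_I: "sigma_functional b (\<lambda>h. I h x)" for x
    unfolding I_def by (rule sigma_functional_integral[OF finite_scalar_measure sets_scalar_measure])
  have sf_\<beta>: "sigma_functional b (\<lambda>h. \<beta> h x y)" for x y
    unfolding \<beta>_def by (intro sigma_functional_divide sigma_functional_minus sf_I)
  have I_ind: "I (indicator S) x = P S x \<bullet> x" if S: "S \<in> sets borel" for S x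
  proof -
    have "I (indicator S) x = (\<integral>s. indicator (S \<inter> {0..b}) s \<partial>scalar_measure P x)"
      unfolding I_def set_lebesgue_integral_def by (simp add: indicator_inter_arith mult.commute)
    also have "\<dots> = measure (scalar_measure P x) (S \<inter> {0..b})"
      using S sets_scalar_measure sets_eq_imp_space_eq[OF sets_scalar_measure] by simp
    also have "\<dots> = P (S \<inter> {0..b}) x \<bullet> x" using S by (simp add: measure_scalar_measure)
    also have "P (S \<inter> {0..b}) x = P S x" using P_Int[OF S, of "{0..b}" x] by (simp add: P_b)
    finally show ?thesis .
  qed
  have polar: "(H (x + y) \<bullet> (x + y) - H (x - y) \<bullet> (x - y)) / 4 = H x \<bullet> y" if "selfadjoint H" for H :: "'a \<Rightarrow> 'a" and x y
  proof -
    interpret H: bounded_linear H using that by (rule selfadjoint_bounded_linear)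
    show ?thesis
      using selfadjoint_inner[OF that, of x y] inner_commute[of x "H y"]
      by (simp add: H.add H.diff inner_simps)
  qed
  have \<beta>_ind: "\<beta> (indicator S) x y = P S x \<bullet> y" if S: "S \<in> sets borel" for S x y
    using polar[OF selfadjoint_P[OF S]] by (simp add: \<beta>_def I_ind S)
  have \<beta>_id: "\<beta> (\<lambda>s. s) x y = B x \<bullet> y" for x y
    using polar[OF B] P by (simp add: \<beta>_def I_def b_def spectral_measure_def)
  have ind_Int: "(\<lambda>s. indicat_real S s * indicat_real T s) = indicator (S \<inter> T)" for S T
    by (auto simp: indicator_def)
  have idb: "bounded_borel b (\<lambda>s. s)" using bounded_borel_power[of b 1] by simp
  have \<beta>_P: "\<beta> h x (P S y) = \<beta> (\<lambda>s. indicator S s * h s) x y"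
    if S: "S \<in> sets borel" and h: "bounded_borel b h" for S h x y
  proof (rule sigma_functional_eq_if_indicators[OF sf_\<beta> sigma_functional_weight[OF sf_\<beta> bounded_borel_indicator[OF S]] _ h])
    fix T :: "real set" assume T: "T \<in> sets borel"
    have "P T x \<bullet> P S y = P S (P T x) \<bullet> y" by (simp add: selfadjoint_inner[OF selfadjoint_P[OF S]])
    also have "\<dots> = P (S \<inter> T) x \<bullet> y" by (simp add: P_Int[OF S T])
    finally show "\<beta> (indicator T) x (P S y) = \<beta> (\<lambda>s. indicator S s * indicator T s) x y"
      unfolding ind_Int using S T by (simp add: \<beta>_ind)
  qed
  have \<beta>_B: "\<beta> h (B x) y = \<beta> (\<lambda>s. s * h s) x y" if h: "bounded_borel b h" for h x y
  proof (rule sigma_functional_eq_if_indicators[OF sf_\<beta> sigma_functional_weight[OF sf_\<beta> idb] _ h])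
    fix S :: "real set" assume S: "S \<in> sets borel"
    have "P S (B x) \<bullet> y = B x \<bullet> P S y" by (simp add: selfadjoint_inner[OF selfadjoint_P[OF S]])
    also have "\<dots> = \<beta> (\<lambda>s. indicator S s * s) x y"
      using \<beta>_P[OF S idb, of x y] by (simp add: \<beta>_id)
    finally show "\<beta> (indicator S) (B x) y = \<beta> (\<lambda>s. s * indicator S s) x y"
      using S by (simp add: \<beta>_ind mult.commute)
  qed
  have \<beta>_power: "\<beta> (\<lambda>s. s ^ k) x y = (B ^^ k) x \<bullet> y" for k x y
  proof (induction k arbitrary: x)
    case 0
    have "\<beta> (\<lambda>s. s ^ 0) x y = \<beta> (indicator UNIV) x y"
      by (rule arg_cong[of _ _ "\<lambda>h. \<beta> h x y"]) auto
    also have "\<dots> = x \<bullet> y" by (simp add: \<beta>_ind P_UNIV del: indicator_UNIV)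
    finally show ?case by simp
  next
    case (Suc k)
    have "\<beta> (\<lambda>s. s ^ Suc k) x y = \<beta> (\<lambda>s. s ^ k) (B x) y"
      using \<beta>_B[OF bounded_borel_power, of k x y] by simp
    then show ?case by (simp add: Suc funpow_swap1)
  qed
  have I_\<beta>: "I h x = \<beta> h x x" if h: "bounded_borel b h" for h x
    by (rule sigma_functional_eq_if_indicators[OF sf_I sf_\<beta> _ h]) (simp add: I_ind \<beta>_ind)
  show ?thesis
    unfolding b_def[symmetric]
  proof (rule spectral_family.intro)
    fix x k
    show "(LINT s:{0..b}|scalar_measure P x. s ^ k) = (B ^^ k) x \<bullet> x"
      using I_\<beta>[OF bounded_borel_power, of k x] by (simp add: I_def \<beta>_power)
    have "P (- {0..b}) x = 0"
      using P_disjoint[of "{0..b}" "- {0..b}" x] by (simp add: P_b)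
    then show "emeasure (scalar_measure P x) (- {0..b}) = 0"
      by (simp add: emeasure_scalar_measure)
  qed (use B finite_scalar_measure sets_scalar_measure in auto)
qed

lemma spectral_family_unique:
  assumes "spectral_family B b \<mu>" "spectral_family B b \<nu>" "bounded_borel b h"
  shows "(LINT s:{0..b}|\<mu> x. h s) = (LINT s:{0..b}|\<nu> x. h s)"
proof -
  interpret M: spectral_family B b \<mu> by fact
  interpret N: spectral_family B b \<nu> by fact
  show ?thesis
    using sigma_functional_eq_if_moments[OF M.sigma_functional_qform N.sigma_functional_qform _ assms(3), of x x]
    by (simp add: M.qform_power N.qform_power M.qform_def N.qform_def)
qed

text \<open>The operator constructed from the moments is the unique one that \<open>fun_calc\<close> describes, because
  every spectral measure of \<open>B\<close> leads to the same integrals.\<close>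

lemma (in spectral_family) fun_calc_eq_calc:
  assumes b: "b = onorm B" and h: "bounded_borel b h"
  shows "fun_calc h B = calc h"
  unfolding fun_calc_def
proof (rule the_equality)
  show "\<exists>P. spectral_measure B P \<and> selfadjoint (calc h) \<and>
     (\<forall>x. calc h x \<bullet> x = (LINT s:{0..onorm B}|scalar_measure P x. h s))"
    unfolding b[symmetric]
    using spectral_measure_proj[OF b] selfadjoint_calc[OF h] calc_quadratic[OF h]
    by (intro exI[of _ proj]) (simp add: scalar_measure_proj qform_def)
next
  fix H assume "\<exists>P. spectral_measure B P \<and> selfadjoint H \<and>
     (\<forall>x. H x \<bullet> x = (LINT s:{0..onorm B}|scalar_measure P x. h s))"
  then obtain P where P: "spectral_measure B P" and H: "selfadjoint H"
    and eq: "\<And>x. H x \<bullet> x = (LINT s:{0..onorm B}|scalar_measure P x. h s)" by blast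
  have fam: "spectral_family B b (scalar_measure P)"
    unfolding b by (rule spectral_family_scalar_measure[OF selfadjoint_B P])
  show "H = calc h"
  proof (rule selfadjoint_eqI[OF H selfadjoint_calc[OF h]])
    fix x
    have "H x \<bullet> x = (LINT s:{0..b}|\<mu> x. h s)"
      unfolding eq b[symmetric] by (rule spectral_family_unique[OF fam spectral_family_axioms h])
    then show "H x \<bullet> x = calc h x \<bullet> x" by (simp add: calc_quadratic[OF h] qform_def)
  qed
qed

section \<open>Nonnegative operators\<close>

locale nonneg_operator =
  fixes B :: "'a::{real_inner,complete_space} \<Rightarrow> 'a"
  assumes B: "nonneg_selfadjoint B"
begin

abbreviation "admissible \<equiv> bounded_borel (onorm B)"

lemma selfadjoint_fun_calc: "admissible h \<Longrightarrow> selfadjoint (fun_calc h B)"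
  and fun_calc_power: "fun_calc (\<lambda>s. s ^ k) B x = (B ^^ k) x"
  and fun_calc_mult: "admissible g \<Longrightarrow> admissible h \<Longrightarrow> fun_calc (\<lambda>s. g s * h s) B x = fun_calc g B (fun_calc h B x)"
  and fun_calc_add: "admissible g \<Longrightarrow> admissible h \<Longrightarrow> fun_calc (\<lambda>s. g s + h s) B x = fun_calc g B x + fun_calc h B x"
  and fun_calc_cmult: "admissible g \<Longrightarrow> fun_calc (\<lambda>s. c * g s) B x = c *\<^sub>R fun_calc g B x"
  and fun_calc_mono: "admissible g \<Longrightarrow> admissible h \<Longrightarrow> (\<And>s. s \<in> {0..onorm B} \<Longrightarrow> g s \<le> h s) \<Longrightarrow>
        fun_calc g B x \<bullet> x \<le> fun_calc h B x \<bullet> x"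
  and fun_calc_cong: "admissible g \<Longrightarrow> (\<And>s. s \<in> {0..onorm B} \<Longrightarrow> g s = h s) \<Longrightarrow> fun_calc g B x = fun_calc h B x"
proof -
  obtain \<mu> where "spectral_family B (onorm B) \<mu>" using spectral_family_exists[OF B] by blast
  then interpret spectral_family B "onorm B" \<mu> .
  note eq = fun_calc_eq_calc[OF refl]
  show "admissible h \<Longrightarrow> selfadjoint (fun_calc h B)" by (simp add: eq selfadjoint_calc)
  show "fun_calc (\<lambda>s. s ^ k) B x = (B ^^ k) x" by (simp add: eq calc_power)
  show "admissible g \<Longrightarrow> admissible h \<Longrightarrow> fun_calc (\<lambda>s. g s * h s) B x = fun_calc g B (fun_calc h B x)"
    by (simp add: eq calc_mult bounded_borel_mult)
  show "admissible g \<Longrightarrow> admissible h \<Longrightarrow> fun_calc (\<lambda>s. g s + h s) B x = fun_calc g B x + fun_calc h B x"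
    by (simp add: eq calc_add bounded_borel_add)
  show "admissible g \<Longrightarrow> fun_calc (\<lambda>s. c * g s) B x = c *\<^sub>R fun_calc g B x"
    by (simp add: eq calc_cmult bounded_borel_cmult)
  show "fun_calc g B x \<bullet> x \<le> fun_calc h B x \<bullet> x"
    if "admissible g" "admissible h" "\<And>s. s \<in> {0..onorm B} \<Longrightarrow> g s \<le> h s"
    using qform_mono[OF that] that(1,2) by (simp add: eq calc_quadratic)
  show "fun_calc g B x = fun_calc h B x"
    if "admissible g" "\<And>s. s \<in> {0..onorm B} \<Longrightarrow> g s = h s"
  proof -
    have "admissible h" by (rule bounded_borel_cong[OF that])
    then show ?thesis using calc_cong[OF that, of x] by (simp only: eq that(1))
  qed
qed

lemma sigma_functional_fun_calc: "sigma_functional (onorm B) (\<lambda>h. fun_calc h B x \<bullet> x)"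
proof -
  obtain \<mu> where "spectral_family B (onorm B) \<mu>" using spectral_family_exists[OF B] by blast
  then interpret spectral_family B "onorm B" \<mu> .
  have eq: "admissible h \<Longrightarrow> fun_calc h B x \<bullet> x = qform h x" for h
    by (simp add: fun_calc_eq_calc[OF refl] calc_quadratic)
  show ?thesis
    unfolding sigma_functional_def
  proof (intro conjI allI impI)
    fix F :: "nat \<Rightarrow> real \<Rightarrow> real" and h K
    assume F: "\<forall>n. admissible (F n)" "admissible h" "\<forall>n. \<forall>s\<in>{0..onorm B}. \<bar>F n s\<bar> \<le> K"
      "\<forall>s\<in>{0..onorm B}. (\<lambda>n. F n s) \<longlonglongrightarrow> h s"
    have "(\<lambda>n. qform (F n) x) \<longlonglongrightarrow> qform h x"
      by (rule sigma_functional_tendsto[OF sigma_functional_qform, where K=K]) (use F in auto)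
    then show "(\<lambda>n. fun_calc (F n) B x \<bullet> x) \<longlonglongrightarrow> fun_calc h B x \<bullet> x"
      using F by (simp add: eq)
  qed (simp_all add: eq bounded_borel_add bounded_borel_cmult sigma_functional_add[OF sigma_functional_qform] sigma_functional_cmult[OF sigma_functional_qform])
qed

lemma fun_calc_one: "fun_calc (\<lambda>_. 1) B x = x"
  using fun_calc_power[of 0 x] by simp

lemma fun_calc_const: "fun_calc (\<lambda>_. c) B x = c *\<^sub>R x"
  using fun_calc_cmult[of "\<lambda>_. 1" c x] by (simp add: fun_calc_one)

lemma fun_calc_id: "fun_calc (\<lambda>s. s) B x = B x"
  using fun_calc_power[of 1 x] by simp

lemma norm_fun_calc:
  assumes "admissible h"
  shows "(norm (fun_calc h B x))\<^sup>2 = fun_calc (\<lambda>s. (h s)\<^sup>2) B x \<bullet> x"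
  unfolding power2_norm_eq_inner
  using assms by (simp add: power2_eq_square fun_calc_mult selfadjoint_inner[OF selfadjoint_fun_calc])

lemma norm_fun_calc_le:
  assumes h: "admissible h" and K: "\<And>s. s \<in> {0..onorm B} \<Longrightarrow> \<bar>h s\<bar> \<le> K" and "K \<ge> 0"
  shows "norm (fun_calc h B x) \<le> K * norm x"
proof (rule power2_le_imp_le)
  have "(h s)\<^sup>2 \<le> K\<^sup>2" if "s \<in> {0..onorm B}" for s using K[OF that] abs_le_square_iff[of "h s" K] \<open>K \<ge> 0\<close> by simp
  then have "fun_calc (\<lambda>s. (h s)\<^sup>2) B x \<bullet> x \<le> fun_calc (\<lambda>_. K\<^sup>2) B x \<bullet> x"
    using h by (intro fun_calc_mono) (auto simp: power2_eq_square)
  then show "(norm (fun_calc h B x))\<^sup>2 \<le> (K * norm x)\<^sup>2"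
    unfolding norm_fun_calc[OF h] power_mult_distrib power2_norm_eq_inner[of x]
    by (simp add: fun_calc_const)
  show "0 \<le> K * norm x" using \<open>K \<ge> 0\<close> by simp
qed

end

section \<open>Quasi-concave functions\<close>

text \<open>The minimum \<open>F\<close> of the affine functions \<open>t \<mapsto> \<omega> (s j) * (1 + t / s j)\<close> is concave and lies between \<open>\<omega>\<close>
  and \<open>2 * \<omega>\<close> at the points of the dyadic grid \<open>s\<close>. Its piecewise linear interpolation on the grid
  has nonincreasing slopes \<open>\<sigma> i\<close>, so it equals the sum of \<open>c i * min t (s i)\<close> where \<open>c i \<ge> 0\<close> is the drop
  of the slope at \<open>s i\<close>. Between neighbouring grid points \<open>\<omega>\<close> changes at most by a factor \<open>2\<close>, and below
  the first one it is at most \<open>\<omega> (r / 2 ^ N)\<close>.\<close>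

lemma quasi_concave_approximation:
  fixes \<omega> :: "real \<Rightarrow> real" and r :: real
  assumes nonneg: "\<And>t. 0 \<le> t \<Longrightarrow> 0 \<le> \<omega> t"
    and mono: "\<And>s t. 0 \<le> s \<Longrightarrow> s \<le> t \<Longrightarrow> \<omega> s \<le> \<omega> t"
    and ratio: "\<And>s t. 0 < s \<Longrightarrow> s \<le> t \<Longrightarrow> \<omega> t * s \<le> \<omega> s * t"
    and r: "0 < r"
  obtains c s :: "nat \<Rightarrow> real" where "\<And>i. i \<le> N \<Longrightarrow> 0 \<le> c i" "\<And>i. i \<le> N \<Longrightarrow> 0 < s i"
    and "\<And>t. 0 \<le> t \<Longrightarrow> t \<le> r \<Longrightarrow> \<omega> t \<le> 2 * (\<Sum>i\<le>N. c i * min t (s i)) + \<omega> (r / 2 ^ N)"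
    and "\<And>t. 0 \<le> t \<Longrightarrow> t \<le> r \<Longrightarrow> (\<Sum>i\<le>N. c i * min t (s i)) \<le> 4 * \<omega> t"
proof -
  define s where "s i = r * 2 ^ i / 2 ^ N" for i :: nat
  have s_pos: "0 < s i" for i using r by (simp add: s_def)
  have s_Suc: "s (Suc i) = 2 * s i" for i by (simp add: s_def)
  have s_mono: "s i \<le> s j" if "i \<le> j" for i j
    using that r by (simp add: s_def divide_right_mono power_increasing)
  define l where "l j t = \<omega> (s j) * (1 + t / s j)" for j t
  define F where "F i = Min ((\<lambda>j. l j (s i)) ` {..N})" for i
  have F_le: "F i \<le> l j (s i)" if "j \<le> N" for i j unfolding F_def using that by (intro Min_le) auto
  have "\<exists>j\<le>N. F i = l j (s i)" for i
  proof -
    have "F i \<in> (\<lambda>j. l j (s i)) ` {..N}" unfolding F_def by (intro Min_in) auto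
    then show ?thesis by auto
  qed
  then obtain J where J: "\<And>i. J i \<le> N" "\<And>i. F i = l (J i) (s i)" by metis
  \<comment> \<open>\<open>\<beta> i\<close> is the slope of an affine function that supports
    \<open>F\<close> at \<open>s i\<close>; it separates the slopes of the interpolation on both sides
    of \<open>s i\<close>.\<close>
  define \<beta> where "\<beta> i = \<omega> (s (J i)) / s (J i)" for i
  have \<beta>_nonneg: "0 \<le> \<beta> i" for i using nonneg[of "s (J i)"] s_pos[of "J i"] by (simp add: \<beta>_def)
  have supp: "F k \<le> F i + \<beta> i * (s k - s i)" for i k
  proof -
    have "F k \<le> l (J i) (s k)" by (rule F_le) (rule J)
    also have "\<dots> = F i + \<beta> i * (s k - s i)"
      unfolding J(2)[of i] by (simp add: l_def \<beta>_def algebra_simps add_divide_distrib diff_divide_distrib)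
    finally show ?thesis .
  qed
  have F_lower: "\<omega> (s i) \<le> F i" for i
  proof (cases "i \<le> J i")
    case True
    have "\<omega> (s i) \<le> \<omega> (s (J i))" using s_mono[OF True] s_pos by (intro mono) (auto intro: less_imp_le)
    also have "\<dots> \<le> F i"
      unfolding J(2)[of i] l_def using nonneg[of "s (J i)"] s_pos[of i] s_pos[of "J i"]
      by (simp add: mult_le_cancel_left1 distrib_left)
    finally show ?thesis .
  next
    case False
    then have "\<omega> (s i) * s (J i) \<le> \<omega> (s (J i)) * s i" using s_pos s_mono by (intro ratio) auto
    then have "\<omega> (s i) \<le> \<omega> (s (J i)) * s i / s (J i)" using s_pos by (simp add: pos_le_divide_eq)
    also have "\<dots> \<le> F i"
      unfolding J(2)[of i] l_def using nonneg[of "s (J i)"] s_pos[of "J i"] by (simp add: distrib_left)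
    finally show ?thesis .
  qed
  have F_upper: "F i \<le> 2 * \<omega> (s i)" if "i \<le> N" for i
    using F_le[OF that, of i] s_pos[of i] by (simp add: l_def)
  define \<sigma> where "\<sigma> i = (case i of 0 \<Rightarrow> F 0 / s 0 | Suc k \<Rightarrow> (F (Suc k) - F k) / (s (Suc k) - s k))" for i
  have step: "0 < s (Suc k) - s k" for k using s_pos[of k] by (simp add: s_Suc)
  have \<sigma>_upper: "\<sigma> (Suc k) \<le> \<beta> k" for k
    using supp[of "Suc k" k] step[of k] by (simp add: \<sigma>_def pos_divide_le_eq)
  have \<sigma>_lower: "\<beta> k \<le> \<sigma> k" for k
  proof (cases k)
    case 0
    have "\<beta> 0 * s 0 \<le> F 0"
      unfolding J(2)[of 0] l_def \<beta>_def using nonneg[of "s (J 0)"] s_pos[of "J 0"]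
      by (simp add: distrib_left)
    then show ?thesis using s_pos[of 0] 0 by (simp add: \<sigma>_def pos_le_divide_eq)
  next
    case (Suc j)
    then show ?thesis
      using supp[of j "Suc j"] step[of j] by (simp add: \<sigma>_def pos_le_divide_eq algebra_simps)
  qed
  define c where "c i = (if i < N then \<sigma> i - \<sigma> (Suc i) else \<sigma> N)" for i
  have c_nonneg: "0 \<le> c i" if "i \<le> N" for i
  proof (cases "i < N")
    case True
    then show ?thesis using \<sigma>_upper[of i] \<sigma>_lower[of i] by (simp add: c_def)
  next
    case False
    then show ?thesis using \<sigma>_lower[of N] \<beta>_nonneg[of N] by (simp add: c_def)
  qed
  have c_sum: "(\<Sum>i=k..N. c i) = \<sigma> k" if "k \<le> N" for k
    using that
  proof (induction k rule: inc_induct)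
    case base
    then show ?case by (simp add: c_def)
  next
    case (step k)
    then have "(\<Sum>i=k..N. c i) = c k + (\<Sum>i=Suc k..N. c i)" by (intro sum.atLeast_Suc_atMost) simp
    then show ?case using step by (simp add: c_def)
  qed
  define G where "G t = (\<Sum>i\<le>N. c i * min t (s i))" for t
  have G_mono: "G t \<le> G u" if "t \<le> u" for t u
    unfolding G_def using c_nonneg that by (intro sum_mono mult_left_mono) auto
  have G_small: "G t = t * \<sigma> 0" if "t \<le> s 0" for t
  proof -
    have "G t = (\<Sum>i\<le>N. c i * t)"
      unfolding G_def using s_mono[of 0] that by (intro sum.cong) (auto simp: min_def intro: order_trans)
    then show ?thesis using c_sum[of 0] by (simp add: sum_distrib_right[symmetric] atMost_atLeast0)
  qed
  have G_s: "G (s k) = F k" if "k \<le> N" for k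
    using that
  proof (induction k)
    case 0
    then show ?case using G_small[of "s 0"] s_pos[of 0] by (simp add: \<sigma>_def)
  next
    case (Suc k)
    have "G (s (Suc k)) - G (s k) = (\<Sum>i\<le>N. c i * (min (s (Suc k)) (s i) - min (s k) (s i)))"
      by (simp add: G_def sum_subtractf right_diff_distrib)
    also have "\<dots> = (\<Sum>i\<le>N. if i \<in> {Suc k..N} then c i * (s (Suc k) - s k) else 0)"
    proof (rule sum.cong[OF refl])
      fix i assume "i \<in> {..N}"
      then show "c i * (min (s (Suc k)) (s i) - min (s k) (s i))
          = (if i \<in> {Suc k..N} then c i * (s (Suc k) - s k) else 0)"
      proof (cases "Suc k \<le> i")
        case True
        then show ?thesis using \<open>i \<in> {..N}\<close> s_mono[of "Suc k" i] s_mono[of k i] by (simp add: min_def)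
      next
        case False
        then show ?thesis using s_mono[of i k] s_mono[of i "Suc k"] by (simp add: min_def)
      qed
    qed
    also have "\<dots> = (\<Sum>i\<in>{..N} \<inter> {Suc k..N}. c i * (s (Suc k) - s k))"
      by (rule sum.inter_restrict[symmetric]) simp
    also have "{..N} \<inter> {Suc k..N} = {Suc k..N}" by auto
    also have "(\<Sum>i\<in>{Suc k..N}. c i * (s (Suc k) - s k)) = \<sigma> (Suc k) * (s (Suc k) - s k)"
      using c_sum[OF Suc.prems] by (simp add: sum_distrib_right[symmetric])
    also have "\<dots> = F (Suc k) - F k" using step[of k] by (simp add: \<sigma>_def)
    finally show ?case using Suc by simp
  qed
  have locate: "\<exists>k<K. s k \<le> t \<and> t \<le> s (Suc k)" if "s 0 < t" "t \<le> s K" for t K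
    using that
  proof (induction K)
    case (Suc K)
    then show ?case
      by (cases "t \<le> s K") (auto intro: less_SucI exI[of _ K])
  qed simp
  have sN: "s N = r" by (simp add: s_def)
  have s0: "s 0 = r / 2 ^ N" by (simp add: s_def)
  show thesis
  proof (rule that[of c s])
    fix t assume t: "0 \<le> t" "t \<le> r"
    have both: "\<omega> t \<le> 2 * G t + \<omega> (s 0) \<and> G t \<le> 4 * \<omega> t"
    proof (cases "t \<le> s 0")
      case True
      have "0 \<le> G t" using G_small[OF True] \<sigma>_lower[of 0] \<beta>_nonneg[of 0] t by simp
      moreover have "\<omega> t \<le> \<omega> (s 0)" using True t by (intro mono)
      moreover have "G t \<le> 2 * \<omega> t"
      proof (cases "t = 0")
        case True
        then show ?thesis using G_small[of 0] s_pos[of 0] nonneg[of 0] by simp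
      next
        case False
        have "G t * s 0 = t * F 0" using G_small[OF True] s_pos[of 0] by (simp add: \<sigma>_def)
        also have "\<dots> \<le> t * (2 * \<omega> (s 0))" using F_upper[of 0] t by (intro mult_left_mono) auto
        also have "\<dots> \<le> 2 * \<omega> t * s 0" using ratio[of t "s 0"] False True t by (simp add: mult_ac)
        finally show ?thesis using s_pos[of 0] by simp
      qed
      ultimately show ?thesis using nonneg[OF t(1)] by simp
    next
      case False
      then obtain k where k: "k < N" "s k \<le> t" "t \<le> s (Suc k)"
        using locate[of t N] t(2) sN by auto
      have "\<omega> (s (Suc k)) * s k \<le> \<omega> (s k) * s (Suc k)"
        using s_pos s_mono by (intro ratio) auto
      then have double: "\<omega> (s (Suc k)) \<le> 2 * \<omega> (s k)" using s_pos[of k] by (simp add: s_Suc)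
      have "\<omega> t \<le> \<omega> (s (Suc k))" using k t by (intro mono)
      also have "\<dots> \<le> 2 * F k" using double F_lower[of k] by simp
      also have "F k \<le> G t" using G_mono[OF k(2)] G_s[of k] k by simp
      finally have 1: "\<omega> t \<le> 2 * G t" by simp
      have "G t \<le> F (Suc k)" using G_mono[OF k(3)] G_s[of "Suc k"] k by simp
      also have "\<dots> \<le> 4 * \<omega> (s k)" using F_upper[of "Suc k"] double k by simp
      also have "\<omega> (s k) \<le> \<omega> t" using k s_pos[of k] by (intro mono) auto
      finally have 2: "G t \<le> 4 * \<omega> t" by simp
      show ?thesis using 1 2 nonneg[of "s 0"] s_pos[of 0] by simp
    qed
    show "\<omega> t \<le> 2 * (\<Sum>i\<le>N. c i * min t (s i)) + \<omega> (r / 2 ^ N)"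
      using both by (simp add: G_def s0)
    show "(\<Sum>i\<le>N. c i * min t (s i)) \<le> 4 * \<omega> t" using both by (simp add: G_def)
  qed (use c_nonneg s_pos in auto)
qed

section \<open>Comparison of functions of two operators\<close>

locale operator_comparison = H: nonneg_operator H + B: nonneg_operator B
  for H B :: "'a::{real_inner,complete_space} \<Rightarrow> 'a" +
  fixes d e :: "real \<Rightarrow> real" and \<kappa> :: real
  assumes adm_d: "H.admissible d" and adm_e: "B.admissible e"
    and d_nonneg: "\<And>s. s \<in> {0..onorm H} \<Longrightarrow> 0 \<le> d s"
    and e_nonneg: "\<And>s. s \<in> {0..onorm B} \<Longrightarrow> 0 \<le> e s"
    and \<kappa>: "1 \<le> \<kappa>"
    and dominated: "\<And>x. fun_calc d H x \<bullet> x \<le> \<kappa> * (fun_calc e B x \<bullet> x)"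
begin

text \<open>The spectral projection \<open>y\<close> of \<open>x\<close> to the set where \<open>e \<le> s\<close> realizes the minimum on the right: its form
  of \<open>e\<close>, plus \<open>s\<close> times the squared norm of the rest \<open>z\<close>, is exactly the form of \<open>min e s\<close>. On the left any
  decomposition \<open>x = y + z\<close> gives an upper bound up to the factor \<open>2\<close>.\<close>

lemma min_comparison:
  assumes s: "0 < s"
  shows "fun_calc (\<lambda>t. min (d t) s) H x \<bullet> x \<le> 2 * \<kappa> * (fun_calc (\<lambda>t. min (e t) s) B x \<bullet> x)"
proof -
  define p where "p t = (if e t \<le> s then 1 else 0 :: real)" for t
  have p: "B.admissible p" unfolding p_def[abs_def] by (rule bounded_borel_le[OF adm_e])
  have p': "B.admissible (\<lambda>t. 1 - p t)" using p by auto
  define y where "y = fun_calc p B x"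
  define z where "z = fun_calc (\<lambda>t. 1 - p t) B x"
  have x: "x = y + z"
    using B.fun_calc_add[OF p p', of x] by (simp add: y_def z_def B.fun_calc_one)
  have min_d: "H.admissible (\<lambda>t. min (d t) s)" using adm_d s by (intro bounded_borel_min) auto
  have k: "H.admissible (\<lambda>t. sqrt (min (d t) s))" by (rule bounded_borel_sqrt[OF min_d])
  have k2: "(norm (fun_calc (\<lambda>t. sqrt (min (d t) s)) H v))\<^sup>2 = fun_calc (\<lambda>t. min (d t) s) H v \<bullet> v" for v
  proof -
    have "fun_calc (\<lambda>t. (sqrt (min (d t) s))\<^sup>2) H v = fun_calc (\<lambda>t. min (d t) s) H v"
    proof (rule H.fun_calc_cong)
      show "H.admissible (\<lambda>t. (sqrt (min (d t) s))\<^sup>2)"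
        unfolding power2_eq_square by (rule bounded_borel_mult[OF k k])
    qed (use d_nonneg s in simp)
    then show ?thesis by (simp only: H.norm_fun_calc[OF k])
  qed
  interpret k: bounded_linear "fun_calc (\<lambda>t. sqrt (min (d t) s)) H"
    by (rule selfadjoint_bounded_linear[OF H.selfadjoint_fun_calc[OF k]])
  have "fun_calc (\<lambda>t. min (d t) s) H x \<bullet> x
      \<le> 2 * (fun_calc (\<lambda>t. min (d t) s) H y \<bullet> y) + 2 * (fun_calc (\<lambda>t. min (d t) s) H z \<bullet> z)"
  proof -
    have "(norm (u + v))\<^sup>2 \<le> 2 * (norm u)\<^sup>2 + 2 * (norm v)\<^sup>2" for u v :: 'a
      using zero_le_power2[of "norm (u - v)"]
      by (simp add: power2_norm_eq_inner inner_simps inner_commute)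
    then show ?thesis unfolding k2[symmetric] by (simp add: x k.add)
  qed
  also have "fun_calc (\<lambda>t. min (d t) s) H y \<bullet> y \<le> fun_calc d H y \<bullet> y"
    by (rule H.fun_calc_mono[OF min_d adm_d]) simp
  also have "\<dots> \<le> \<kappa> * (fun_calc e B y \<bullet> y)" by (rule dominated)
  also have "fun_calc e B y \<bullet> y = fun_calc (\<lambda>t. p t * (e t * p t)) B x \<bullet> x"
    unfolding y_def
    using p adm_e by (simp add: B.fun_calc_mult bounded_borel_mult selfadjoint_inner[OF B.selfadjoint_fun_calc[OF p]])
  also have "fun_calc (\<lambda>t. min (d t) s) H z \<bullet> z \<le> fun_calc (\<lambda>_. s) H z \<bullet> z"
    by (rule H.fun_calc_mono[OF min_d]) auto
  also have "\<dots> = s * (norm z)\<^sup>2" by (simp add: H.fun_calc_const power2_norm_eq_inner)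
  also have "(norm z)\<^sup>2 = fun_calc (\<lambda>t. (1 - p t)\<^sup>2) B x \<bullet> x"
    unfolding z_def by (rule B.norm_fun_calc[OF p'])
  also have "2 * (\<kappa> * (fun_calc (\<lambda>t. p t * (e t * p t)) B x \<bullet> x)) + 2 * (s * (fun_calc (\<lambda>t. (1 - p t)\<^sup>2) B x \<bullet> x))
     \<le> 2 * \<kappa> * (fun_calc (\<lambda>t. p t * (e t * p t)) B x \<bullet> x) + 2 * \<kappa> * (s * (fun_calc (\<lambda>t. (1 - p t)\<^sup>2) B x \<bullet> x))"
  proof -
    have "0 \<le> fun_calc (\<lambda>t. (1 - p t)\<^sup>2) B x \<bullet> x" by (simp add: B.norm_fun_calc[OF p', symmetric])
    then have "1 * (s * (fun_calc (\<lambda>t. (1 - p t)\<^sup>2) B x \<bullet> x)) \<le> \<kappa> * (s * (fun_calc (\<lambda>t. (1 - p t)\<^sup>2) B x \<bullet> x))"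
      using s \<kappa> by (intro mult_right_mono) auto
    then show ?thesis by simp
  qed
  also have "\<dots> = 2 * \<kappa> * (fun_calc (\<lambda>t. min (e t) s) B x \<bullet> x)"
  proof -
    have a1: "B.admissible (\<lambda>t. p t * (e t * p t))" using p adm_e by (intro bounded_borel_mult)
    have a2: "B.admissible (\<lambda>t. (1 - p t)\<^sup>2)" using p' by (auto simp: power2_eq_square)
    have "fun_calc (\<lambda>t. min (e t) s) B x = fun_calc (\<lambda>t. p t * (e t * p t) + s * (1 - p t)\<^sup>2) B x"
      by (rule arg_cong[of _ _ "\<lambda>h. fun_calc h B x"]) (auto simp: p_def fun_eq_iff)
    also have "\<dots> = fun_calc (\<lambda>t. p t * (e t * p t)) B x + s *\<^sub>R fun_calc (\<lambda>t. (1 - p t)\<^sup>2) B x"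
      using B.fun_calc_add[OF a1 bounded_borel_cmult[OF a2]] B.fun_calc_cmult[OF a2] by simp
    finally show ?thesis by (simp add: inner_add_left distrib_left)
  qed
  finally show ?thesis by simp
qed

text \<open>The factor is \<open>2 * (2 * \<kappa>) * 4\<close>: one \<open>2\<close> and the \<open>4\<close> come from the two sides of
  \<open>quasi_concave_approximation\<close>, and \<open>2 * \<kappa>\<close> from \<open>min_comparison\<close>.\<close>

theorem quasi_concave_comparison:
  assumes nonneg: "\<And>t. 0 \<le> t \<Longrightarrow> 0 \<le> \<omega> t"
    and mono: "\<And>s t. 0 \<le> s \<Longrightarrow> s \<le> t \<Longrightarrow> \<omega> s \<le> \<omega> t"
    and ratio: "\<And>s t. 0 < s \<Longrightarrow> s \<le> t \<Longrightarrow> \<omega> t * s \<le> \<omega> s * t"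
    and zero: "(\<omega> \<longlongrightarrow> 0) (at_right 0)"
    and admissible: "H.admissible (\<lambda>t. \<omega> (d t))" "B.admissible (\<lambda>t. \<omega> (e t))"
  shows "fun_calc (\<lambda>t. \<omega> (d t)) H x \<bullet> x \<le> 16 * \<kappa> * (fun_calc (\<lambda>t. \<omega> (e t)) B x \<bullet> x)"
proof -
  obtain K L where KL: "K \<ge> 0" "L \<ge> 0" "\<And>t. t \<in> {0..onorm H} \<Longrightarrow> \<bar>d t\<bar> \<le> K"
      "\<And>t. t \<in> {0..onorm B} \<Longrightarrow> \<bar>e t\<bar> \<le> L"
    using bounded_borel_bound[OF adm_d] bounded_borel_bound[OF adm_e] by metis
  define r where "r = K + L + 1"
  have r: "0 < r" "\<And>t. t \<in> {0..onorm H} \<Longrightarrow> d t \<le> r" "\<And>t. t \<in> {0..onorm B} \<Longrightarrow> e t \<le> r"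
    using KL by (force simp: r_def)+
  have approx: "fun_calc (\<lambda>t. \<omega> (d t)) H x \<bullet> x
      \<le> 16 * \<kappa> * (fun_calc (\<lambda>t. \<omega> (e t)) B x \<bullet> x) + \<omega> (r / 2 ^ N) * (norm x)\<^sup>2" for N
  proof -
    obtain c s where c: "\<And>i. i \<le> N \<Longrightarrow> 0 \<le> c i" and s: "\<And>i. i \<le> N \<Longrightarrow> 0 < s i"
      and upper: "\<And>t. 0 \<le> t \<Longrightarrow> t \<le> r \<Longrightarrow> \<omega> t \<le> 2 * (\<Sum>i\<le>N. c i * min t (s i)) + \<omega> (r / 2 ^ N)"
      and lower: "\<And>t. 0 \<le> t \<Longrightarrow> t \<le> r \<Longrightarrow> (\<Sum>i\<le>N. c i * min t (s i)) \<le> 4 * \<omega> t"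
      by (rule quasi_concave_approximation[of \<omega> r N, OF nonneg mono ratio r(1)]) blast+
    have G: "H.admissible (\<lambda>t. \<Sum>i\<le>n. c i * min (d t) (s i)) \<and> B.admissible (\<lambda>t. \<Sum>i\<le>n. c i * min (e t) (s i)) \<and>
       fun_calc (\<lambda>t. \<Sum>i\<le>n. c i * min (d t) (s i)) H x \<bullet> x
         \<le> 2 * \<kappa> * (fun_calc (\<lambda>t. \<Sum>i\<le>n. c i * min (e t) (s i)) B x \<bullet> x)" if "n \<le> N" for n
      using that
    proof (induction n)
      case 0
      have "H.admissible (\<lambda>t. min (d t) (s 0))" "B.admissible (\<lambda>t. min (e t) (s 0))"
        using s[of 0] adm_d adm_e by (auto intro!: bounded_borel_min)
      then show ?case
        using mult_left_mono[OF min_comparison[OF s[of 0], of x] c[of 0]]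
        by (auto simp: H.fun_calc_cmult B.fun_calc_cmult mult_ac)
    next
      case (Suc n)
      have m: "H.admissible (\<lambda>t. c (Suc n) * min (d t) (s (Suc n)))" "B.admissible (\<lambda>t. c (Suc n) * min (e t) (s (Suc n)))"
          "H.admissible (\<lambda>t. min (d t) (s (Suc n)))" "B.admissible (\<lambda>t. min (e t) (s (Suc n)))"
        using s[of "Suc n"] adm_d adm_e Suc.prems by (auto intro!: bounded_borel_min bounded_borel_cmult)
      have IH: "H.admissible (\<lambda>t. \<Sum>i\<le>n. c i * min (d t) (s i))" "B.admissible (\<lambda>t. \<Sum>i\<le>n. c i * min (e t) (s i))"
          "fun_calc (\<lambda>t. \<Sum>i\<le>n. c i * min (d t) (s i)) H x \<bullet> x
         \<le> 2 * \<kappa> * (fun_calc (\<lambda>t. \<Sum>i\<le>n. c i * min (e t) (s i)) B x \<bullet> x)"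
        using Suc by auto
      show ?case
        using mult_left_mono[OF min_comparison[OF s[of "Suc n"], of x] c[of "Suc n"]] Suc.prems IH m
        by (simp add: H.fun_calc_add B.fun_calc_add H.fun_calc_cmult B.fun_calc_cmult bounded_borel_add
              inner_add_left distrib_left mult_ac)
    qed
    define GH where "GH t = (\<Sum>i\<le>N. c i * min (d t) (s i))" for t
    define GB where "GB t = (\<Sum>i\<le>N. c i * min (e t) (s i))" for t
    have GH: "H.admissible GH" and GB: "B.admissible GB"
      and GHB: "fun_calc GH H x \<bullet> x \<le> 2 * \<kappa> * (fun_calc GB B x \<bullet> x)"
      using G[OF order_refl] by (simp_all add: GH_def[abs_def] GB_def[abs_def])
    have "fun_calc (\<lambda>t. \<omega> (d t)) H x \<bullet> x \<le> fun_calc (\<lambda>t. 2 * GH t + \<omega> (r / 2 ^ N)) H x \<bullet> x"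
    proof (rule H.fun_calc_mono[OF admissible(1)])
      show "H.admissible (\<lambda>t. 2 * GH t + \<omega> (r / 2 ^ N))"
        by (intro bounded_borel_add bounded_borel_cmult GH bounded_borel_const)
      show "\<omega> (d t) \<le> 2 * GH t + \<omega> (r / 2 ^ N)" if "t \<in> {0..onorm H}" for t
        unfolding GH_def using that by (intro upper d_nonneg r)
    qed
    also have "\<dots> = 2 * (fun_calc GH H x \<bullet> x) + \<omega> (r / 2 ^ N) * (norm x)\<^sup>2"
      using H.fun_calc_add[OF bounded_borel_cmult[OF GH, of 2] bounded_borel_const, of "\<omega> (r / 2 ^ N)" x]
      by (simp add: H.fun_calc_cmult GH H.fun_calc_const inner_add_left power2_norm_eq_inner)
    also have "fun_calc GH H x \<bullet> x \<le> 2 * \<kappa> * (fun_calc GB B x \<bullet> x)" by fact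
    also have "fun_calc GB B x \<bullet> x \<le> fun_calc (\<lambda>t. 4 * \<omega> (e t)) B x \<bullet> x"
    proof (rule B.fun_calc_mono[OF GB])
      show "B.admissible (\<lambda>t. 4 * \<omega> (e t))" by (intro bounded_borel_cmult admissible)
      show "GB t \<le> 4 * \<omega> (e t)" if "t \<in> {0..onorm B}" for t
        unfolding GB_def using that by (intro lower e_nonneg r)
    qed
    also have "\<dots> = 4 * (fun_calc (\<lambda>t. \<omega> (e t)) B x \<bullet> x)"
      by (simp add: B.fun_calc_cmult admissible)
    finally show ?thesis using \<kappa> by (simp add: mult_ac)
  qed
  have "filterlim (\<lambda>N. r / 2 ^ N) (at_right 0) sequentially"
    unfolding filterlim_at
  proof
    have "(\<lambda>N. r * (1 / 2) ^ N) \<longlonglongrightarrow> 0" by (intro tendsto_mult_right_zero LIMSEQ_realpow_zero) auto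
    then show "(\<lambda>N. r / 2 ^ N) \<longlonglongrightarrow> 0" by (simp add: power_divide)
  qed (use r in auto)
  then have "(\<lambda>N. \<omega> (r / 2 ^ N)) \<longlonglongrightarrow> 0" by (rule filterlim_compose[OF zero])
  then have "(\<lambda>N. 16 * \<kappa> * (fun_calc (\<lambda>t. \<omega> (e t)) B x \<bullet> x) + \<omega> (r / 2 ^ N) * (norm x)\<^sup>2)
     \<longlonglongrightarrow> 16 * \<kappa> * (fun_calc (\<lambda>t. \<omega> (e t)) B x \<bullet> x) + 0 * (norm x)\<^sup>2"
    by (intro tendsto_intros)
  then show ?thesis
    using approx by (intro LIMSEQ_le_const[of _ "16 * \<kappa> * (fun_calc (\<lambda>t. \<omega> (e t)) B x \<bullet> x)"]) auto
qed

end

section \<open>Index functions\<close>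

lemma index_functionD:
  assumes "index_function \<phi>"
  shows "0 \<le> s \<Longrightarrow> s \<le> t \<Longrightarrow> \<phi> s \<le> \<phi> t" "continuous_on {0..} \<phi>" "0 < t \<Longrightarrow> 0 < \<phi> t" "\<phi> 0 = 0"
    "0 \<le> t \<Longrightarrow> 0 \<le> \<phi> t"
proof -
  show "0 \<le> s \<Longrightarrow> s \<le> t \<Longrightarrow> \<phi> s \<le> \<phi> t" "continuous_on {0..} \<phi>" "0 < t \<Longrightarrow> 0 < \<phi> t" "\<phi> 0 = 0"
    using assms by (auto simp: index_function_def mono_on_def)
  then show "0 \<le> t \<Longrightarrow> 0 \<le> \<phi> t" by (cases "t = 0") (auto intro: less_imp_le)
qed

context
  fixes \<psi> :: "real \<Rightarrow> real"
  assumes \<psi>: "index_function \<psi>"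
begin

lemma Theta_nonneg: "0 \<le> s \<Longrightarrow> 0 \<le> Theta \<psi> s"
  by (simp add: Theta_def index_functionD(5)[OF \<psi>])

lemma Theta_strict_mono:
  assumes "0 \<le> s" "s < t"
  shows "Theta \<psi> s < Theta \<psi> t"
proof -
  have "sqrt s * \<psi> s \<le> sqrt s * \<psi> t"
    using assms index_functionD(1)[OF \<psi>, of s t] by (intro mult_left_mono) auto
  also have "\<dots> < sqrt t * \<psi> t"
    using assms index_functionD(3)[OF \<psi>, of t] by (intro mult_strict_right_mono) auto
  finally show ?thesis by (simp add: Theta_def)
qed

lemma Theta_0: "Theta \<psi> 0 = 0"
  by (simp add: Theta_def)

lemma Theta_mono: "0 \<le> s \<Longrightarrow> s \<le> t \<Longrightarrow> Theta \<psi> s \<le> Theta \<psi> t"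
  using Theta_strict_mono[of s t] by (cases "s = t") auto

lemma Theta_sq_strict_mono: "0 \<le> s \<Longrightarrow> s < t \<Longrightarrow> (Theta \<psi> s)\<^sup>2 < (Theta \<psi> t)\<^sup>2"
  by (intro power_strict_mono Theta_strict_mono Theta_nonneg) auto

lemma Theta_sq_inj: "inj_on (\<lambda>s. (Theta \<psi> s)\<^sup>2) {0..}"
proof (rule inj_onI)
  fix s t assume *: "s \<in> {0::real..}" "t \<in> {0..}" "(Theta \<psi> s)\<^sup>2 = (Theta \<psi> t)\<^sup>2"
  show "s = t"
    using Theta_sq_strict_mono[of s t] Theta_sq_strict_mono[of t s] * by (cases s t rule: linorder_cases) auto
qed

lemma Theta_sq_surj:
  assumes "0 \<le> t"
  obtains s where "0 \<le> s" "(Theta \<psi> s)\<^sup>2 = t"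
proof -
  define p where "p = (\<psi> 1)\<^sup>2"
  have p: "0 < p" using index_functionD(3)[OF \<psi>, of 1] by (simp add: p_def)
  define u where "u = max 1 (t / p)"
  have "p \<le> (\<psi> u)\<^sup>2" unfolding p_def
    using index_functionD(1)[OF \<psi>, of 1 u] index_functionD(5)[OF \<psi>, of 1]
    by (intro power_mono) (auto simp: u_def)
  then have "u * p \<le> (Theta \<psi> u)\<^sup>2"
    by (simp add: Theta_def power_mult_distrib u_def mult_left_mono)
  moreover have "t \<le> u * p" using p by (simp add: u_def pos_divide_le_eq[symmetric])
  ultimately have "t \<le> (Theta \<psi> u)\<^sup>2" by simp
  moreover have "continuous_on {0..u} (\<lambda>s. (Theta \<psi> s)\<^sup>2)"
    unfolding Theta_def
    by (intro continuous_intros continuous_on_subset[OF index_functionD(2)[OF \<psi>]]) auto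
  moreover have "0 \<le> u" by (simp add: u_def)
  ultimately obtain s where "0 \<le> s" "s \<le> u" "(Theta \<psi> s)\<^sup>2 = t"
    using IVT'[of "\<lambda>s. (Theta \<psi> s)\<^sup>2" 0 t u] assms by (auto simp: Theta_0)
  then show thesis using that by blast
qed

lemma f0_sq_Theta_sq:
  assumes "0 \<le> s"
  shows "(f0 \<psi> ((Theta \<psi> s)\<^sup>2))\<^sup>2 = s"
  using inv_into_f_f[OF Theta_sq_inj, of s] assms by (simp add: f0_def)

lemma Theta_sq_f0_sq:
  assumes "0 \<le> t"
  shows "(Theta \<psi> ((f0 \<psi> t)\<^sup>2))\<^sup>2 = t"
  using Theta_sq_surj[OF assms] f0_sq_Theta_sq by metis

lemma f0_sq_mono:
  assumes "0 \<le> s" "s \<le> t"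
  shows "(f0 \<psi> s)\<^sup>2 \<le> (f0 \<psi> t)\<^sup>2"
proof (rule ccontr)
  assume "\<not> ?thesis"
  then have "(Theta \<psi> ((f0 \<psi> t)\<^sup>2))\<^sup>2 < (Theta \<psi> ((f0 \<psi> s)\<^sup>2))\<^sup>2"
    by (intro Theta_sq_strict_mono) auto
  then show False using assms by (simp add: Theta_sq_f0_sq)
qed

lemma f0_0: "f0 \<psi> 0 = 0"
  using f0_sq_Theta_sq[of 0] by (simp add: Theta_0)

lemma f0_sq_pos: "0 < t \<Longrightarrow> 0 < (f0 \<psi> t)\<^sup>2"
  using Theta_sq_f0_sq[of t] by (cases "f0 \<psi> t = 0") (auto simp: Theta_0)

text \<open>The function \<open>\<omega>\<close> with \<open>\<phi>\<^sup>2 = \<omega> \<circ> \<Theta>\<^sup>2\<^sup>\<mu>\<close>; as \<open>(f0 \<psi> t)\<^sup>2\<close> inverts \<open>\<Theta>\<^sup>2\<close>, it is also the function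
  with \<open>\<omega> (s powr \<mu>) = (\<phi> ((f0 \<psi> s)\<^sup>2))\<^sup>2\<close>.\<close>

definition squared_source :: "(real \<Rightarrow> real) \<Rightarrow> real \<Rightarrow> real \<Rightarrow> real" where
  "squared_source \<phi> \<mu> t = (\<phi> ((f0 \<psi> (t powr (1 / \<mu>)))\<^sup>2))\<^sup>2"

lemma squared_source_Theta:
  assumes "0 < \<mu>" "0 \<le> s"
  shows "squared_source \<phi> \<mu> (Theta \<psi> s powr (2 * \<mu>)) = (\<phi> s)\<^sup>2"
proof -
  have "(Theta \<psi> s powr (2 * \<mu>)) powr (1 / \<mu>) = (Theta \<psi> s)\<^sup>2"
    using assms Theta_nonneg[of s] by (simp add: powr_powr)
  then show ?thesis using assms by (simp add: squared_source_def f0_sq_Theta_sq)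
qed

lemma squared_source_powr:
  assumes "0 < \<mu>" "0 \<le> s"
  shows "squared_source \<phi> \<mu> (s powr \<mu>) = (\<phi> ((f0 \<psi> s)\<^sup>2))\<^sup>2"
  using assms by (simp add: squared_source_def powr_powr)

lemma squared_source_mono:
  assumes \<phi>: "index_function \<phi>" and "0 < \<mu>" "0 \<le> s" "s \<le> t"
  shows "squared_source \<phi> \<mu> s \<le> squared_source \<phi> \<mu> t"
  unfolding squared_source_def
  using assms by (intro power_mono index_functionD(1)[OF \<phi>] index_functionD(5)[OF \<phi>] f0_sq_mono powr_mono2) auto

text \<open>With \<open>\<sigma>\<close> and \<open>\<tau>\<close> the points where \<open>\<Theta>\<^sup>2\<^sup>\<mu>\<close> takes the values \<open>s\<close> and \<open>t\<close>, this is the square of the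
  assumption at \<open>\<sigma> \<le> \<tau>\<close>.\<close>

lemma squared_source_ratio:
  assumes \<phi>: "index_function \<phi>" and \<mu>: "0 < \<mu>"
    and ratio: "\<And>s t. 0 < s \<Longrightarrow> s \<le> t \<Longrightarrow> Theta \<psi> s powr \<mu> * \<phi> t \<le> Theta \<psi> t powr \<mu> * \<phi> s"
    and "0 < s" "s \<le> t"
  shows "squared_source \<phi> \<mu> t * s \<le> squared_source \<phi> \<mu> s * t"
proof -
  have pow: "(Theta \<psi> ((f0 \<psi> (u powr (1 / \<mu>)))\<^sup>2) powr \<mu>)\<^sup>2 = u" if "0 < u" for u
  proof -
    define v where "v = (f0 \<psi> (u powr (1 / \<mu>)))\<^sup>2"
    have "(Theta \<psi> v powr \<mu>)\<^sup>2 = ((Theta \<psi> v)\<^sup>2) powr \<mu>"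
      using Theta_nonneg[of v] by (simp add: v_def power2_eq_square powr_mult)
    also have "(Theta \<psi> v)\<^sup>2 = u powr (1 / \<mu>)" unfolding v_def by (rule Theta_sq_f0_sq) simp
    finally show ?thesis using that \<mu> by (simp add: v_def powr_powr)
  qed
  define \<sigma> where "\<sigma> = (f0 \<psi> (s powr (1 / \<mu>)))\<^sup>2"
  define \<tau> where "\<tau> = (f0 \<psi> (t powr (1 / \<mu>)))\<^sup>2"
  have "0 < \<sigma>" unfolding \<sigma>_def using assms by (intro f0_sq_pos) auto
  moreover have "\<sigma> \<le> \<tau>" unfolding \<sigma>_def \<tau>_def using assms by (intro f0_sq_mono powr_mono2) auto
  ultimately have "Theta \<psi> \<sigma> powr \<mu> * \<phi> \<tau> \<le> Theta \<psi> \<tau> powr \<mu> * \<phi> \<sigma>" by (rule ratio)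
  then have "(Theta \<psi> \<sigma> powr \<mu> * \<phi> \<tau>)\<^sup>2 \<le> (Theta \<psi> \<tau> powr \<mu> * \<phi> \<sigma>)\<^sup>2"
    using index_functionD(5)[OF \<phi>, of \<tau>] by (intro power_mono) (auto simp: \<tau>_def)
  then show ?thesis
    using pow[of s] pow[of t] assms by (simp add: squared_source_def \<sigma>_def \<tau>_def power_mult_distrib mult.commute)
qed

lemma squared_source_tendsto_0:
  assumes \<phi>: "index_function \<phi>" and \<mu>: "0 < \<mu>"
  shows "(squared_source \<phi> \<mu> \<longlongrightarrow> 0) (at_right 0)"
proof (rule tendstoI)
  fix \<epsilon> :: real assume \<epsilon>: "0 < \<epsilon>"
  have lim: "((\<lambda>t. (\<phi> t)\<^sup>2) \<longlongrightarrow> (\<phi> 0)\<^sup>2) (at 0 within {0..})"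
    using index_functionD(2)[OF \<phi>] by (intro tendsto_power) (auto simp: continuous_on_def)
  have "((\<lambda>t. (\<phi> t)\<^sup>2) \<longlongrightarrow> 0) (at_right 0)"
    by (rule tendsto_within_subset[OF lim, unfolded index_functionD(4)[OF \<phi>] zero_power2]) auto
  then have "\<forall>\<^sub>F t in at_right 0. (\<phi> t)\<^sup>2 < \<epsilon>" using \<epsilon> by (rule order_tendstoD)
  then obtain u where "0 < u" "\<And>t. 0 < t \<Longrightarrow> t < u \<Longrightarrow> (\<phi> t)\<^sup>2 < \<epsilon>"
    unfolding eventually_at_right_field by auto
  then obtain t where t: "0 < t" "(\<phi> t)\<^sup>2 < \<epsilon>" using dense[of 0 u] by blast
  define t0 where "t0 = Theta \<psi> t powr (2 * \<mu>)"
  have "0 < Theta \<psi> t" using Theta_strict_mono[of 0 t] t by (simp add: Theta_0)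
  then have t0: "0 < t0" by (simp add: t0_def)
  have "dist (squared_source \<phi> \<mu> s) 0 < \<epsilon>" if "0 < s" "s < t0" for s
  proof -
    have "squared_source \<phi> \<mu> s \<le> squared_source \<phi> \<mu> t0"
      using that by (intro squared_source_mono[OF \<phi> \<mu>]) auto
    also have "\<dots> = (\<phi> t)\<^sup>2" using t unfolding t0_def by (intro squared_source_Theta[OF \<mu>]) auto
    finally show ?thesis using t by (simp add: squared_source_def)
  qed
  then show "\<forall>\<^sub>F s in at_right 0. dist (squared_source \<phi> \<mu> s) 0 < \<epsilon>"
    unfolding eventually_at_right_field using t0 by blast
qed

text \<open>The source condition in terms of \<open>H\<close> is exchanged for one in terms of \<open>B\<close>.\<close>

lemma source_comparison:
  fixes H B :: "'a::{real_inner,complete_space} \<Rightarrow> 'a"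
  assumes H: "nonneg_selfadjoint H" and B: "nonneg_selfadjoint B"
    and \<phi>: "index_function \<phi>" and \<mu>: "0 < \<mu>" and \<kappa>: "1 \<le> \<kappa>"
    and ratio: "\<And>s t. 0 < s \<Longrightarrow> s \<le> t \<Longrightarrow> Theta \<psi> s powr \<mu> * \<phi> t \<le> Theta \<psi> t powr \<mu> * \<phi> s"
    and link: "\<And>x. fun_calc (\<lambda>s. Theta \<psi> s powr (2 * \<mu>)) H x \<bullet> x
                 \<le> \<kappa> * (fun_calc (\<lambda>s. s powr \<mu>) B x \<bullet> x)"
  shows "norm (fun_calc \<phi> H x) \<le> 4 * sqrt \<kappa> * norm (fun_calc (\<lambda>s. \<phi> ((f0 \<psi> s)\<^sup>2)) B x)"
proof -
  interpret H: nonneg_operator H by standard (rule H)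
  interpret B: nonneg_operator B by standard (rule B)
  have "H.admissible (\<lambda>s. Theta \<psi> s powr (2 * \<mu>))"
    using \<mu> by (intro bounded_borel_mono_on mono_onI powr_mono2 Theta_mono Theta_nonneg) auto
  moreover have "B.admissible (\<lambda>s. s powr \<mu>)"
    using \<mu> by (intro bounded_borel_mono_on mono_onI powr_mono2) auto
  ultimately interpret operator_comparison H B "\<lambda>s. Theta \<psi> s powr (2 * \<mu>)" "\<lambda>s. s powr \<mu>" \<kappa>
    by unfold_locales (use \<kappa> link in auto)
  have \<phi>H: "H.admissible \<phi>"
    using index_functionD(1)[OF \<phi>] by (intro bounded_borel_mono_on mono_onI) auto
  have \<phi>B: "B.admissible (\<lambda>s. \<phi> ((f0 \<psi> s)\<^sup>2))"
    by (intro bounded_borel_mono_on mono_onI index_functionD(1)[OF \<phi>]) (auto intro: f0_sq_mono)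
  have eqH: "(\<phi> s)\<^sup>2 = squared_source \<phi> \<mu> (Theta \<psi> s powr (2 * \<mu>))" if "s \<in> {0..onorm H}" for s
    using that squared_source_Theta[OF \<mu>] by simp
  have eqB: "(\<phi> ((f0 \<psi> s)\<^sup>2))\<^sup>2 = squared_source \<phi> \<mu> (s powr \<mu>)" if "s \<in> {0..onorm B}" for s
    using that squared_source_powr[OF \<mu>] by simp
  have \<phi>H2: "H.admissible (\<lambda>s. (\<phi> s)\<^sup>2)" unfolding power2_eq_square by (rule bounded_borel_mult[OF \<phi>H \<phi>H])
  have \<phi>B2: "B.admissible (\<lambda>s. (\<phi> ((f0 \<psi> s)\<^sup>2))\<^sup>2)"
    unfolding power2_eq_square[of "\<phi> _"] by (rule bounded_borel_mult[OF \<phi>B \<phi>B])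
  have "(norm (fun_calc \<phi> H x))\<^sup>2 = fun_calc (\<lambda>s. (\<phi> s)\<^sup>2) H x \<bullet> x"
    by (rule H.norm_fun_calc[OF \<phi>H])
  also have "\<dots> = fun_calc (\<lambda>s. squared_source \<phi> \<mu> (Theta \<psi> s powr (2 * \<mu>))) H x \<bullet> x"
    by (simp only: H.fun_calc_cong[OF \<phi>H2 eqH])
  also have "\<dots> \<le> 16 * \<kappa> * (fun_calc (\<lambda>s. squared_source \<phi> \<mu> (s powr \<mu>)) B x \<bullet> x)"
  proof (rule quasi_concave_comparison)
    show "H.admissible (\<lambda>s. squared_source \<phi> \<mu> (Theta \<psi> s powr (2 * \<mu>)))"
      by (rule bounded_borel_cong[OF \<phi>H2 eqH])
    show "B.admissible (\<lambda>s. squared_source \<phi> \<mu> (s powr \<mu>))"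
      by (rule bounded_borel_cong[OF \<phi>B2 eqB])
    show "(squared_source \<phi> \<mu> \<longlongrightarrow> 0) (at_right 0)" by (rule squared_source_tendsto_0[OF \<phi> \<mu>])
    show "squared_source \<phi> \<mu> s \<le> squared_source \<phi> \<mu> t" if "0 \<le> s" "s \<le> t" for s t
      by (rule squared_source_mono[OF \<phi> \<mu> that])
    show "squared_source \<phi> \<mu> t * s \<le> squared_source \<phi> \<mu> s * t" if "0 < s" "s \<le> t" for s t
      by (rule squared_source_ratio[OF \<phi> \<mu> ratio that])
    show "0 \<le> squared_source \<phi> \<mu> t" for t by (simp add: squared_source_def)
  qed
  also have "fun_calc (\<lambda>s. squared_source \<phi> \<mu> (s powr \<mu>)) B x \<bullet> x = fun_calc (\<lambda>s. (\<phi> ((f0 \<psi> s)\<^sup>2))\<^sup>2) B x \<bullet> x"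
    by (simp only: B.fun_calc_cong[OF \<phi>B2 eqB])
  also have "\<dots> = (norm (fun_calc (\<lambda>s. \<phi> ((f0 \<psi> s)\<^sup>2)) B x))\<^sup>2"
    by (rule B.norm_fun_calc[OF \<phi>B, symmetric])
  also have "16 * \<kappa> * (norm (fun_calc (\<lambda>s. \<phi> ((f0 \<psi> s)\<^sup>2)) B x))\<^sup>2
      = (4 * sqrt \<kappa> * norm (fun_calc (\<lambda>s. \<phi> ((f0 \<psi> s)\<^sup>2)) B x))\<^sup>2"
    using \<kappa> by (simp add: power_mult_distrib)
  finally show ?thesis by (rule power2_le_imp_le) (use \<kappa> in simp)
qed

end

section \<open>Bias and propagated noise\<close>

lemma bounded_borel_regularization:
  assumes "regularization a q \<gamma> \<gamma>\<^sub>s" "0 < \<alpha>" "\<alpha> \<le> a"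
  shows "bounded_borel a (q \<alpha>)"
proof -
  have q: "q \<alpha> \<in> borel_measurable (restrict_space borel {0<..a})"
      "\<And>s. s \<in> {0<..a} \<Longrightarrow> \<bar>q \<alpha> s\<bar> \<le> \<gamma>\<^sub>s / \<alpha>"
    using assms unfolding regularization_def by auto
  have "(\<lambda>s. indicator {0<..a} s *\<^sub>R q \<alpha> s) \<in> borel_measurable borel"
    using q(1) by (subst borel_measurable_restrict_space_iff[symmetric]) auto
  then have "(\<lambda>s. indicator {0<..a} s *\<^sub>R q \<alpha> s + indicator {0} s * q \<alpha> 0) \<in> borel_measurable borel"
    by measurable
  also have "(\<lambda>s. indicator {0<..a} s *\<^sub>R q \<alpha> s + indicator {0} s * q \<alpha> 0) = (\<lambda>s. indicator {0..a} s * q \<alpha> s)"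
    using assms by (auto simp: indicator_def)
  finally have "(\<lambda>s. indicator {0..a} s * q \<alpha> s) \<in> borel_measurable borel" .
  moreover have "\<bar>q \<alpha> s\<bar> \<le> max (\<gamma>\<^sub>s / \<alpha>) \<bar>q \<alpha> 0\<bar>" if "s \<in> {0..a}" for s
    using q(2)[of s] that by (cases "s = 0") (auto simp: le_max_iff_disj)
  ultimately show ?thesis unfolding bounded_borel_def by blast
qed

text \<open>Below \<open>\<alpha>\<close> the residual is at most \<open>\<gamma>\<close> and \<open>h\<close> is monotone; above \<open>\<alpha>\<close> the qualification takes over,
  since \<open>h / \<rho>\<close> is nonincreasing.\<close>

lemma qualification_residual:
  assumes reg: "regularization a q \<gamma> \<gamma>\<^sub>s" and qual: "qualification a q \<gamma> \<rho>"
    and mono: "\<And>s t. 0 \<le> s \<Longrightarrow> s \<le> t \<Longrightarrow> h s \<le> h t" and h0: "h 0 = 0"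
    and anti: "antimono_on {0<..a} (\<lambda>s. h s / \<rho> s)"
    and \<alpha>: "0 < \<alpha>" "\<alpha> \<le> a" and s: "s \<in> {0..a}"
  shows "\<bar>h s * (1 - s * q \<alpha> s)\<bar> \<le> \<gamma> * h \<alpha>"
proof -
  have r: "\<bar>1 - s * q \<alpha> s\<bar> \<le> \<gamma>" "\<bar>1 - s * q \<alpha> s\<bar> * \<rho> s \<le> \<gamma> * \<rho> \<alpha>" "0 < \<rho> s" if "s \<in> {0<..a}" for s
    using reg qual \<alpha> that unfolding regularization_def qualification_def by auto
  have h_nonneg: "0 \<le> h t" if "0 \<le> t" for t using mono[of 0 t] that h0 by simp
  have \<gamma>: "0 \<le> \<gamma>" using r(1)[of \<alpha>] \<alpha> by (auto intro: order_trans[OF abs_ge_zero])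
  have \<rho>\<alpha>: "0 < \<rho> \<alpha>" using r(3)[of \<alpha>] \<alpha> by auto
  consider "s = 0" | "0 < s" "s \<le> \<alpha>" | "\<alpha> < s" using s by fastforce
  then show ?thesis
  proof cases
    case 1
    then show ?thesis using h0 h_nonneg[of \<alpha>] \<alpha> \<gamma> by simp
  next
    case 2
    have "\<bar>h s * (1 - s * q \<alpha> s)\<bar> = h s * \<bar>1 - s * q \<alpha> s\<bar>"
      using h_nonneg[of s] 2 by (simp add: abs_mult)
    also have "\<dots> \<le> h \<alpha> * \<gamma>" using 2 s r(1)[of s] mono[of s \<alpha>] h_nonneg[of \<alpha>] \<alpha> by (intro mult_mono) auto
    finally show ?thesis by (simp add: mult.commute)
  next
    case 3
    then have s': "s \<in> {0<..a}" using \<alpha> s by auto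
    have "h s / \<rho> s \<le> h \<alpha> / \<rho> \<alpha>"
      using anti s' \<alpha> 3 by (auto simp: monotone_on_def)
    then have "(h s / \<rho> s) * (\<bar>1 - s * q \<alpha> s\<bar> * \<rho> s) \<le> (h \<alpha> / \<rho> \<alpha>) * (\<gamma> * \<rho> \<alpha>)"
      by (rule mult_mono) (use r(2,3)[OF s'] h_nonneg[of \<alpha>] \<alpha> \<rho>\<alpha> in auto)
    then show ?thesis
      using h_nonneg[of s] s r(3)[OF s'] \<rho>\<alpha> by (simp add: abs_mult mult_ac)
  qed
qed

text \<open>By duality it suffices to bound \<open>T q\<^sub>\<alpha>(B)\<close>, and the squared norm of \<open>T q\<^sub>\<alpha>(B) u\<close> is the quadratic form
  of \<open>s * (q \<alpha> s)\<^sup>2\<close> at \<open>u\<close>.\<close>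

lemma noise_propagation:
  fixes T :: "'a::{real_inner,complete_space} \<Rightarrow> 'b::{real_inner,complete_space}"
  assumes T: "bounded_linear T" and a: "a = onorm (adjoint T \<circ> T)"
    and reg: "regularization a q \<gamma> \<gamma>\<^sub>s" and \<alpha>: "0 < \<alpha>" "\<alpha> \<le> a"
  shows "norm (fun_calc (q \<alpha>) (adjoint T \<circ> T) (adjoint T \<eta>)) \<le> sqrt ((1 + \<gamma>) * \<gamma>\<^sub>s) / sqrt \<alpha> * norm \<eta>"
proof -
  define B where "B = adjoint T \<circ> T"
  interpret B: nonneg_operator B unfolding B_def by standard (rule nonneg_selfadjoint_adjoint_comp[OF T])
  have q: "B.admissible (q \<alpha>)" using bounded_borel_regularization[OF reg \<alpha>] by (simp add: a B_def)
  have id: "B.admissible (\<lambda>s. s)" using bounded_borel_power[of "onorm B" 1] by simp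
  note sa = selfadjoint_inner[OF B.selfadjoint_fun_calc[OF q]]
  define u where "u = fun_calc (q \<alpha>) B (adjoint T \<eta>)"
  define v where "v = fun_calc (q \<alpha>) B u"
  define c where "c = (1 + \<gamma>) * \<gamma>\<^sub>s / \<alpha>"
  have c_nonneg: "0 \<le> c"
  proof -
    have "\<bar>q \<alpha> \<alpha>\<bar> \<le> \<gamma>\<^sub>s / \<alpha>" "\<bar>1 - \<alpha> * q \<alpha> \<alpha>\<bar> \<le> \<gamma>"
      using reg \<alpha> unfolding regularization_def by auto
    then have "0 \<le> \<gamma>\<^sub>s / \<alpha>" "0 \<le> 1 + \<gamma>" by linarith+
    then have "0 \<le> (1 + \<gamma>) * (\<gamma>\<^sub>s / \<alpha>)" by (intro mult_nonneg_nonneg)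
    then show ?thesis by (simp add: c_def)
  qed
  have "(norm (T v))\<^sup>2 = B v \<bullet> v"
    by (simp add: power2_norm_eq_inner B_def adjoint_inner'[OF T])
  also have "\<dots> = fun_calc (\<lambda>s. s) B v \<bullet> v" by (simp add: B.fun_calc_id)
  also have "\<dots> = fun_calc (\<lambda>s. q \<alpha> s * (s * q \<alpha> s)) B u \<bullet> u"
    unfolding v_def by (simp add: B.fun_calc_mult q id bounded_borel_mult sa)
  also have "\<dots> \<le> fun_calc (\<lambda>_. c) B u \<bullet> u"
  proof (rule B.fun_calc_mono)
    fix s assume s: "s \<in> {0..onorm B}"
    show "q \<alpha> s * (s * q \<alpha> s) \<le> c"
    proof (cases "s = 0")
      case True
      then show ?thesis using c_nonneg by simp
    next
      case False
      then have "s \<in> {0<..a}" using s by (auto simp: a B_def)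
      then have r: "\<bar>1 - s * q \<alpha> s\<bar> \<le> \<gamma>" "\<bar>q \<alpha> s\<bar> \<le> \<gamma>\<^sub>s / \<alpha>"
        using reg \<alpha> unfolding regularization_def by auto
      then have "\<bar>s * q \<alpha> s\<bar> \<le> 1 + \<gamma>" by linarith
      then have "\<bar>s * q \<alpha> s\<bar> * \<bar>q \<alpha> s\<bar> \<le> (1 + \<gamma>) * (\<gamma>\<^sub>s / \<alpha>)"
        by (rule mult_mono) (use r in auto)
      then show ?thesis
        unfolding c_def by (simp add: abs_mult[symmetric] mult_ac abs_le_iff)
    qed
  qed (use q id in auto)
  also have "\<dots> = c * (norm u)\<^sup>2" by (simp add: B.fun_calc_const power2_norm_eq_inner)
  finally have "norm (T v) \<le> sqrt (c * (norm u)\<^sup>2)" by (rule real_le_rsqrt)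
  then have Tv: "norm (T v) \<le> sqrt c * norm u" by (simp add: real_sqrt_mult)
  have "norm u * norm u = u \<bullet> u" by (simp add: power2_norm_eq_inner[symmetric] power2_eq_square)
  also have "\<dots> = adjoint T \<eta> \<bullet> v" by (simp add: v_def sa[symmetric] u_def[symmetric])
  also have "\<dots> = \<eta> \<bullet> T v" by (rule adjoint_inner'[OF T])
  also have "\<dots> \<le> norm \<eta> * norm (T v)" by (rule norm_cauchy_schwarz)
  also have "\<dots> \<le> norm \<eta> * (sqrt c * norm u)" by (intro mult_left_mono Tv) simp
  finally have "norm u * norm u \<le> (sqrt c * norm \<eta>) * norm u" by (simp add: mult_ac)
  then have "norm u \<le> sqrt c * norm \<eta>"
    using c_nonneg by (cases "norm u = 0") auto
  then show ?thesis by (simp add: u_def B_def c_def real_sqrt_divide)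
qed

lemma bounded_linear_adj_on_Y:
  fixes E :: "'y::{real_inner,complete_space} \<Rightarrow> 'z::real_inner"
  assumes "bounded_linear E"
  shows "bounded_linear (adj_on_Y E)"
  using nonneg_selfadjoint_adjoint_comp[OF assms]
  by (simp add: adj_on_Y_def nonneg_selfadjoint_def selfadjoint_def)

lemma bounded_linear_sym_op:
  fixes A :: "'x::real_inner \<Rightarrow> 'y::{real_inner,complete_space}"
    and E :: "'y \<Rightarrow> 'z::real_inner"
  assumes "bounded_linear A" "bounded_linear E"
  shows "bounded_linear (sym_op A E)"
  unfolding sym_op_def comp_def
  by (rule bounded_linear_compose[OF bounded_linear_adj_on_Y[OF assms(2)] assms(1)])

text \<open>Link and lifting condition enter only through the domination \<open>link\<close> of quadratic forms, with
  \<open>\<mu> = 1\<close> for the former.\<close>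

lemma error_bound:
  fixes A :: "'x::{real_inner,complete_space} \<Rightarrow> 'y::{real_inner,complete_space}"
    and E :: "'y \<Rightarrow> 'z::{real_inner,complete_space}"
  assumes A: "bounded_linear A" and E: "bounded_linear E" and \<psi>: "index_function \<psi>"
    and a: "a = onorm (adjoint (sym_op A E) \<circ> sym_op A E)"
    and reg: "regularization a q \<gamma> \<gamma>\<^sub>s" and qual: "qualification a q \<gamma> \<rho>"
    and \<mu>: "0 < \<mu>" and \<kappa>: "1 \<le> \<kappa>"
    and link: "\<And>x. fun_calc (\<lambda>s. Theta \<psi> s powr (2 * \<mu>)) (adjoint A \<circ> A) x \<bullet> x
         \<le> \<kappa> * (fun_calc (\<lambda>s. s powr \<mu>) (adjoint (sym_op A E) \<circ> sym_op A E) x \<bullet> x)"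
    and f: "source_condition A \<phi> f"
    and ratio: "\<And>s t. 0 < s \<Longrightarrow> s \<le> t \<Longrightarrow> Theta \<psi> s powr \<mu> * \<phi> t \<le> Theta \<psi> t powr \<mu> * \<phi> s"
    and noise: "norm (adjoint E \<zeta>) \<le> 1" "0 \<le> \<delta>"
    and anti: "antimono_on {0<..a} (\<lambda>s. \<phi> ((f0 \<psi> s)\<^sup>2) / \<rho> s)"
    and \<alpha>: "0 < \<alpha>" "\<alpha> \<le> a"
  shows "norm (f - reconstruction A E q \<alpha> (noisy_data A E f \<delta> \<zeta>))
    \<le> max (4 * sqrt \<kappa> * \<gamma>) (sqrt ((1 + \<gamma>) * \<gamma>\<^sub>s)) * (\<phi> ((f0 \<psi> \<alpha>)\<^sup>2) + \<delta> / sqrt \<alpha>)"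
proof -
  define T where "T = sym_op A E"
  have T: "bounded_linear T" unfolding T_def by (rule bounded_linear_sym_op[OF A E])
  define H where "H = adjoint A \<circ> A"
  define B where "B = adjoint T \<circ> T"
  have H_nn: "nonneg_selfadjoint H" unfolding H_def by (rule nonneg_selfadjoint_adjoint_comp[OF A])
  have B_nn: "nonneg_selfadjoint B" unfolding B_def by (rule nonneg_selfadjoint_adjoint_comp[OF T])
  interpret H: nonneg_operator H by standard (rule H_nn)
  interpret B: nonneg_operator B by standard (rule B_nn)
  have a_B: "a = onorm B" by (simp add: a B_def T_def)
  obtain w where \<phi>: "index_function \<phi>" and w: "norm w \<le> 1" "f = fun_calc \<phi> H w"
    using f by (auto simp: source_condition_def H_def)
  define h where "h s = \<phi> ((f0 \<psi> s)\<^sup>2)" for s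
  have h_mono: "h s \<le> h t" if "0 \<le> s" "s \<le> t" for s t
    unfolding h_def by (rule index_functionD(1)[OF \<phi>]) (auto intro: f0_sq_mono[OF \<psi>] that)
  have h0: "h 0 = 0" by (simp add: h_def f0_0[OF \<psi>] index_functionD(4)[OF \<phi>])
  have h\<alpha>: "0 \<le> h \<alpha>" using h_mono[of 0 \<alpha>] h0 \<alpha> by simp
  have \<phi>_adm: "H.admissible \<phi>"
    using index_functionD(1)[OF \<phi>] by (intro bounded_borel_mono_on mono_onI) auto
  have h_adm: "B.admissible h" using h_mono by (intro bounded_borel_mono_on mono_onI) auto
  have q: "B.admissible (q \<alpha>)" using bounded_borel_regularization[OF reg \<alpha>] by (simp add: a_B)
  have id: "B.admissible (\<lambda>s. s)" using bounded_borel_power[of "onorm B" 1] by simp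
  define r where "r s = 1 - s * q \<alpha> s" for s
  have r: "B.admissible r" unfolding r_def[abs_def] by (intro bounded_borel_diff bounded_borel_mult q id bounded_borel_const)
  have "\<bar>1 - \<alpha> * q \<alpha> \<alpha>\<bar> \<le> \<gamma>" using reg \<alpha> unfolding regularization_def by auto
  then have \<gamma>: "0 \<le> \<gamma>" by linarith
  interpret qB: bounded_linear "fun_calc (q \<alpha>) B"
    by (rule selfadjoint_bounded_linear[OF B.selfadjoint_fun_calc[OF q]])
  interpret T': bounded_linear "adjoint T" by (rule bounded_linear_adjoint[OF T])
  interpret E': bounded_linear "adjoint E" by (rule bounded_linear_adjoint[OF E])
  define \<eta> where "\<eta> = adjoint E \<zeta>"
  define z where "z = fun_calc r B f"
  have "fun_calc (q \<alpha>) B (B f) = fun_calc (\<lambda>s. q \<alpha> s * s) B f"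
    using q id by (simp add: B.fun_calc_mult B.fun_calc_id)
  moreover have "fun_calc r B f + fun_calc (\<lambda>s. q \<alpha> s * s) B f = f"
    using B.fun_calc_add[OF r bounded_borel_mult[OF q id], of f] by (simp add: r_def mult.commute B.fun_calc_one)
  ultimately have z_eq: "f - fun_calc (q \<alpha>) B (B f) = z" by (simp add: z_def algebra_simps)
  have T_apply: "T u = adjoint E (E (A u))" for u by (simp add: T_def sym_op_def adj_on_Y_def)
  have "adjoint T (adjoint E (noisy_data A E f \<delta> \<zeta>)) = B f + \<delta> *\<^sub>R adjoint T \<eta>"
    by (simp add: noisy_data_def E'.add E'.scaleR T'.add T'.scaleR B_def \<eta>_def flip: T_apply)
  then have rec: "f - reconstruction A E q \<alpha> (noisy_data A E f \<delta> \<zeta>) = z - \<delta> *\<^sub>R fun_calc (q \<alpha>) B (adjoint T \<eta>)"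
    unfolding reconstruction_def T_def[symmetric] B_def[symmetric]
    by (simp add: qB.add qB.scaleR z_eq[symmetric])
  have bias: "norm z \<le> 4 * sqrt \<kappa> * \<gamma> * h \<alpha>"
  proof -
    \<comment> \<open>The operators \<open>r(B)\<close> and \<open>\<phi>(H)\<close> need not commute;
      duality puts \<open>\<phi>(H)\<close> on the left, where it can be exchanged for
      \<open>h(B)\<close>.\<close>
    have "norm z * norm z = z \<bullet> z" by (simp add: power2_norm_eq_inner[symmetric] power2_eq_square)
    also have "\<dots> = fun_calc r B (fun_calc \<phi> H w) \<bullet> z" by (simp add: z_def w)
    also have "\<dots> = w \<bullet> fun_calc \<phi> H (fun_calc r B z)"
      by (simp add: selfadjoint_inner[OF B.selfadjoint_fun_calc[OF r]] selfadjoint_inner[OF H.selfadjoint_fun_calc[OF \<phi>_adm]])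
    also have "\<dots> \<le> norm w * norm (fun_calc \<phi> H (fun_calc r B z))" by (rule norm_cauchy_schwarz)
    also have "\<dots> \<le> 1 * (4 * sqrt \<kappa> * norm (fun_calc h B (fun_calc r B z)))"
      unfolding h_def[abs_def] using w(1)
      by (intro mult_mono source_comparison[OF \<psi> H_nn B_nn \<phi> \<mu> \<kappa> ratio link[folded H_def T_def, folded B_def]]) auto
    also have "fun_calc h B (fun_calc r B z) = fun_calc (\<lambda>s. h s * r s) B z"
      by (rule B.fun_calc_mult[OF h_adm r, symmetric])
    also have "1 * (4 * sqrt \<kappa> * norm (fun_calc (\<lambda>s. h s * r s) B z)) \<le> 1 * (4 * sqrt \<kappa> * ((\<gamma> * h \<alpha>) * norm z))"
    proof (intro mult_left_mono B.norm_fun_calc_le)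
      show "B.admissible (\<lambda>s. h s * r s)" by (rule bounded_borel_mult[OF h_adm r])
      show "\<bar>h s * r s\<bar> \<le> \<gamma> * h \<alpha>" if "s \<in> {0..onorm B}" for s
        unfolding r_def
        using that anti
        by (intro qualification_residual[of a q \<gamma> \<gamma>\<^sub>s \<rho> h, OF reg qual h_mono h0 _ \<alpha>])
           (simp_all add: a_B h_def)
      show "0 \<le> \<gamma> * h \<alpha>" using \<gamma> h\<alpha> by simp
    qed (use \<kappa> in auto)
    finally have *: "norm z * norm z \<le> (4 * sqrt \<kappa> * \<gamma> * h \<alpha>) * norm z" by (simp add: mult_ac)
    have "0 \<le> 4 * sqrt \<kappa> * \<gamma> * h \<alpha>" using \<kappa> \<gamma> h\<alpha> by simp
    then show ?thesis using * by (cases "norm z = 0") auto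
  qed
  have "norm (fun_calc (q \<alpha>) B (adjoint T \<eta>)) \<le> sqrt ((1 + \<gamma>) * \<gamma>\<^sub>s) / sqrt \<alpha> * norm \<eta>"
    unfolding B_def by (rule noise_propagation[OF T _ reg \<alpha>]) (simp add: a T_def)
  also have "\<dots> \<le> sqrt ((1 + \<gamma>) * \<gamma>\<^sub>s) / sqrt \<alpha> * 1"
  proof (rule mult_left_mono)
    have "\<bar>q \<alpha> \<alpha>\<bar> \<le> \<gamma>\<^sub>s / \<alpha>" using reg \<alpha> unfolding regularization_def by auto
    then have "0 \<le> \<gamma>\<^sub>s / \<alpha>" by linarith
    then have "0 \<le> \<gamma>\<^sub>s" using \<alpha> by (simp add: zero_le_divide_iff)
    then show "0 \<le> sqrt ((1 + \<gamma>) * \<gamma>\<^sub>s) / sqrt \<alpha>" using \<gamma> \<alpha> by simp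
  qed (use noise in \<open>simp add: \<eta>_def\<close>)
  finally have nz: "norm (fun_calc (q \<alpha>) B (adjoint T \<eta>)) \<le> sqrt ((1 + \<gamma>) * \<gamma>\<^sub>s) / sqrt \<alpha>" by simp
  define C where "C = max (4 * sqrt \<kappa> * \<gamma>) (sqrt ((1 + \<gamma>) * \<gamma>\<^sub>s))"
  have "norm (z - \<delta> *\<^sub>R fun_calc (q \<alpha>) B (adjoint T \<eta>))
      \<le> norm z + \<delta> * norm (fun_calc (q \<alpha>) B (adjoint T \<eta>))"
    using norm_triangle_ineq4[of z "\<delta> *\<^sub>R fun_calc (q \<alpha>) B (adjoint T \<eta>)"] noise(2) by simp
  also have "\<dots> \<le> 4 * sqrt \<kappa> * \<gamma> * h \<alpha> + \<delta> * (sqrt ((1 + \<gamma>) * \<gamma>\<^sub>s) / sqrt \<alpha>)"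
    by (intro add_mono bias mult_left_mono nz noise)
  also have "\<dots> = 4 * sqrt \<kappa> * \<gamma> * h \<alpha> + sqrt ((1 + \<gamma>) * \<gamma>\<^sub>s) * (\<delta> / sqrt \<alpha>)" by simp
  also have "\<dots> \<le> C * h \<alpha> + C * (\<delta> / sqrt \<alpha>)"
    using h\<alpha> noise \<alpha> by (intro add_mono mult_right_mono) (auto simp: C_def)
  finally show ?thesis unfolding rec by (simp add: C_def h_def distrib_left)
qed

section \<open>Link and lifting conditions\<close>

lemma onorm_comp_adjoint_le:
  fixes A :: "'a::{real_inner,complete_space} \<Rightarrow> 'b::real_inner"
  assumes A: "bounded_linear A"
  shows "onorm (A \<circ> adjoint A) \<le> onorm (adjoint A \<circ> A)"
proof -
  define N where "N = onorm (adjoint A \<circ> A)"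
  have blB: "bounded_linear (adjoint A \<circ> A)"
    using nonneg_selfadjoint_adjoint_comp[OF A] by (simp add: nonneg_selfadjoint_def selfadjoint_def)
  have N: "0 \<le> N" unfolding N_def by (rule onorm_pos_le[OF blB])
  have A_le: "norm (A x) \<le> sqrt N * norm x" for x
  proof -
    have "(norm (A x))\<^sup>2 = (adjoint A \<circ> A) x \<bullet> x"
      by (simp add: power2_norm_eq_inner adjoint_inner'[OF A])
    also have "\<dots> \<le> N * (norm x)\<^sup>2" unfolding N_def by (rule onorm_bound_inner[OF blB])
    finally have "norm (A x) \<le> sqrt (N * (norm x)\<^sup>2)" by (rule real_le_rsqrt)
    then show ?thesis by (simp add: real_sqrt_mult)
  qed
  have A'_le: "norm (adjoint A v) \<le> sqrt N * norm v" for v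
  proof -
    have "norm (adjoint A v) * norm (adjoint A v) = v \<bullet> A (adjoint A v)"
      by (simp add: power2_norm_eq_inner[symmetric] power2_eq_square[symmetric] adjoint_inner'[OF A, symmetric])
    also have "\<dots> \<le> norm v * norm (A (adjoint A v))" by (rule norm_cauchy_schwarz)
    also have "\<dots> \<le> norm v * (sqrt N * norm (adjoint A v))" by (intro mult_left_mono A_le) simp
    finally have "norm (adjoint A v) * norm (adjoint A v) \<le> (sqrt N * norm v) * norm (adjoint A v)"
      by (simp add: mult_ac)
    then show ?thesis using N by (cases "norm (adjoint A v) = 0") auto
  qed
  show ?thesis
    unfolding N_def[symmetric]
  proof (rule onorm_bound[OF N])
    fix v
    have "norm ((A \<circ> adjoint A) v) \<le> sqrt N * norm (adjoint A v)" using A_le by simp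
    also have "\<dots> \<le> sqrt N * (sqrt N * norm v)" using N by (intro mult_left_mono A'_le) auto
    finally show "norm ((A \<circ> adjoint A) v) \<le> N * norm v" using N by (simp add: mult.assoc[symmetric])
  qed
qed

text \<open>The quadratic-form version of \<open>h(A A\<^sup>*) A = A h(A\<^sup>* A)\<close>, which holds for monomials. Both calculi live on
  the same interval because the two operators have the same norm.\<close>

lemma fun_calc_comp_adjoint:
  fixes A :: "'a::{real_inner,complete_space} \<Rightarrow> 'b::{real_inner,complete_space}"
  assumes A: "bounded_linear A" and h: "bounded_borel (onorm (adjoint A \<circ> A)) h"
  shows "fun_calc h (A \<circ> adjoint A) (A x) \<bullet> A x = fun_calc (\<lambda>s. s * h s) (adjoint A \<circ> A) x \<bullet> x"
proof -
  have adj: "adjoint (adjoint A) = A" by (rule adjoint_unique) (simp add: adjoint_inner'[OF A])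
  have eq: "onorm (A \<circ> adjoint A) = onorm (adjoint A \<circ> A)"
    using onorm_comp_adjoint_le[OF A] onorm_comp_adjoint_le[OF bounded_linear_adjoint[OF A]]
    by (simp add: adj)
  interpret H: nonneg_operator "adjoint A \<circ> A" by standard (rule nonneg_selfadjoint_adjoint_comp[OF A])
  interpret G: nonneg_operator "A \<circ> adjoint A" by standard (rule nonneg_selfadjoint_comp_adjoint[OF A])
  have id: "H.admissible (\<lambda>s. s)" using bounded_borel_power[of "onorm (adjoint A \<circ> A)" 1] by simp
  show ?thesis
  proof (rule sigma_functional_eq_if_moments[OF G.sigma_functional_fun_calc[unfolded eq]
        sigma_functional_weight[OF H.sigma_functional_fun_calc id] _ h])
    fix k
    have "((A \<circ> adjoint A) ^^ k) (A x) = A (((adjoint A \<circ> A) ^^ k) x)"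
      by (induction k) simp_all
    then have "fun_calc (\<lambda>s. s ^ k) (A \<circ> adjoint A) (A x) \<bullet> A x = A (((adjoint A \<circ> A) ^^ k) x) \<bullet> A x"
      by (simp add: G.fun_calc_power)
    also have "\<dots> = ((adjoint A \<circ> A) ^^ Suc k) x \<bullet> x" by (simp add: adjoint_inner'[OF A])
    also have "\<dots> = fun_calc (\<lambda>s. s * s ^ k) (adjoint A \<circ> A) x \<bullet> x"
      using H.fun_calc_power[of "Suc k" x] by simp
    finally show "fun_calc (\<lambda>s. s ^ k) (A \<circ> adjoint A) (A x) \<bullet> A x
      = fun_calc (\<lambda>s. s * s ^ k) (adjoint A \<circ> A) x \<bullet> x" .
  qed
qed

text \<open>\<open>(S\<^sup>* S)\<^sup>1\<^sup>/\<^sup>2\<close> is the modulus of \<open>S\<close>.\<close>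

lemma norm_modulus:
  fixes S :: "'a::{real_inner,complete_space} \<Rightarrow> 'b::real_inner"
  assumes S: "bounded_linear S"
  shows "norm (fun_calc sqrt (adjoint S \<circ> S) v) = norm (S v)"
proof -
  interpret G: nonneg_operator "adjoint S \<circ> S" by standard (rule nonneg_selfadjoint_adjoint_comp[OF S])
  have sq: "G.admissible sqrt" by (intro bounded_borel_mono_on mono_onI) simp
  have id: "G.admissible (\<lambda>s. s)" using bounded_borel_power[of "onorm (adjoint S \<circ> S)" 1] by simp
  have "(norm (fun_calc sqrt (adjoint S \<circ> S) v))\<^sup>2 = fun_calc (\<lambda>s. (sqrt s)\<^sup>2) (adjoint S \<circ> S) v \<bullet> v"
    by (rule G.norm_fun_calc[OF sq])
  also have "fun_calc (\<lambda>s. (sqrt s)\<^sup>2) (adjoint S \<circ> S) v = fun_calc (\<lambda>s. s) (adjoint S \<circ> S) v"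
    by (rule G.fun_calc_cong[symmetric, OF id]) simp
  also have "\<dots> \<bullet> v = (norm (S v))\<^sup>2"
    by (simp add: G.fun_calc_id power2_norm_eq_inner adjoint_inner'[OF S])
  finally show ?thesis by (rule power2_eq_imp_eq) simp_all
qed

lemma le_inverse_scale: "0 < c \<Longrightarrow> c * x \<le> y \<Longrightarrow> x \<le> 1 / c * y" for c x y :: real
  by (simp add: field_simps)

lemma link_condition_dominates:
  fixes A :: "'x::{real_inner,complete_space} \<Rightarrow> 'y::{real_inner,complete_space}"
    and E :: "'y \<Rightarrow> 'z::{real_inner,complete_space}"
  assumes A: "bounded_linear A" and E: "bounded_linear E" and \<psi>: "index_function \<psi>"
    and link: "link_condition A E \<psi> m M"
  shows "fun_calc (\<lambda>s. Theta \<psi> s powr (2 * 1)) (adjoint A \<circ> A) x \<bullet> x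
     \<le> 1 / m\<^sup>2 * (fun_calc (\<lambda>s. s powr 1) (adjoint (sym_op A E) \<circ> sym_op A E) x \<bullet> x)"
proof -
  have T: "bounded_linear (sym_op A E)" by (rule bounded_linear_sym_op[OF A E])
  interpret H: nonneg_operator "adjoint A \<circ> A" by standard (rule nonneg_selfadjoint_adjoint_comp[OF A])
  interpret G: nonneg_operator "A \<circ> adjoint A" by standard (rule nonneg_selfadjoint_comp_adjoint[OF A])
  interpret B: nonneg_operator "adjoint (sym_op A E) \<circ> sym_op A E"
    by standard (rule nonneg_selfadjoint_adjoint_comp[OF T])
  have admissible: "bounded_borel b \<psi>" for b
    using index_functionD(1)[OF \<psi>] by (intro bounded_borel_mono_on mono_onI) auto
  have adm2: "bounded_borel b (\<lambda>s. (\<psi> s)\<^sup>2)" for b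
    unfolding power2_eq_square by (rule bounded_borel_mult[OF admissible admissible])
  have id: "bounded_borel b (\<lambda>s. s)" for b using bounded_borel_power[of b 1] by simp
  have m: "0 < m" using link by (simp add: link_condition_def)
  have "m * norm (fun_calc \<psi> (A \<circ> adjoint A) (A x))
      \<le> norm (fun_calc sqrt (adjoint (adj_on_Y E) \<circ> adj_on_Y E) (A x))"
    using link unfolding link_condition_def by blast
  also have "\<dots> = norm (sym_op A E x)"
    unfolding norm_modulus[OF bounded_linear_adj_on_Y[OF E]] by (simp add: sym_op_def)
  finally have "(m * norm (fun_calc \<psi> (A \<circ> adjoint A) (A x)))\<^sup>2 \<le> (norm (sym_op A E x))\<^sup>2"
    using m by (intro power_mono) auto
  then have "m\<^sup>2 * (norm (fun_calc \<psi> (A \<circ> adjoint A) (A x)))\<^sup>2 \<le> (norm (sym_op A E x))\<^sup>2"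
    by (simp add: power_mult_distrib)
  also have "(norm (fun_calc \<psi> (A \<circ> adjoint A) (A x)))\<^sup>2
      = fun_calc (\<lambda>s. (\<psi> s)\<^sup>2) (A \<circ> adjoint A) (A x) \<bullet> A x"
    by (rule G.norm_fun_calc[OF admissible])
  also have "\<dots> = fun_calc (\<lambda>s. s * (\<psi> s)\<^sup>2) (adjoint A \<circ> A) x \<bullet> x"
    by (rule fun_calc_comp_adjoint[OF A adm2])
  also have "fun_calc (\<lambda>s. s * (\<psi> s)\<^sup>2) (adjoint A \<circ> A) x
      = fun_calc (\<lambda>s. Theta \<psi> s powr (2 * 1)) (adjoint A \<circ> A) x"
  proof (rule H.fun_calc_cong)
    show "H.admissible (\<lambda>s. s * (\<psi> s)\<^sup>2)" by (intro bounded_borel_mult id adm2)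
    show "s * (\<psi> s)\<^sup>2 = Theta \<psi> s powr (2 * 1)" if "s \<in> {0..onorm (adjoint A \<circ> A)}" for s
      using that Theta_nonneg[OF \<psi>, of s] by (simp add: Theta_def power_mult_distrib)
  qed
  also have "(norm (sym_op A E x))\<^sup>2 = (adjoint (sym_op A E) \<circ> sym_op A E) x \<bullet> x"
    by (simp add: power2_norm_eq_inner adjoint_inner'[OF T])
  also have "(adjoint (sym_op A E) \<circ> sym_op A E) x = fun_calc (\<lambda>s. s) (adjoint (sym_op A E) \<circ> sym_op A E) x"
    by (rule B.fun_calc_id[symmetric])
  also have "\<dots> = fun_calc (\<lambda>s. s powr 1) (adjoint (sym_op A E) \<circ> sym_op A E) x"
    by (rule B.fun_calc_cong[OF id]) simp
  finally show ?thesis by (rule le_inverse_scale[rotated]) (use m in simp)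
qed

lemma lifting_condition_dominates:
  fixes A :: "'x::{real_inner,complete_space} \<Rightarrow> 'y::{real_inner,complete_space}"
    and E :: "'y \<Rightarrow> 'z::{real_inner,complete_space}"
  assumes A: "bounded_linear A" and E: "bounded_linear E" and \<psi>: "index_function \<psi>"
    and \<mu>: "0 < \<mu>" and lift: "lifting_condition A E \<psi> \<mu> m M"
  shows "fun_calc (\<lambda>s. Theta \<psi> s powr (2 * \<mu>)) (adjoint A \<circ> A) x \<bullet> x
     \<le> 1 / (m powr \<mu>)\<^sup>2 * (fun_calc (\<lambda>s. s powr \<mu>) (adjoint (sym_op A E) \<circ> sym_op A E) x \<bullet> x)"
proof -
  have T: "bounded_linear (sym_op A E)" by (rule bounded_linear_sym_op[OF A E])
  interpret H: nonneg_operator "adjoint A \<circ> A" by standard (rule nonneg_selfadjoint_adjoint_comp[OF A])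
  interpret B: nonneg_operator "adjoint (sym_op A E) \<circ> sym_op A E"
    by standard (rule nonneg_selfadjoint_adjoint_comp[OF T])
  have m: "0 < m" using lift by (simp add: lifting_condition_def)
  have admH: "H.admissible (\<lambda>s. Theta \<psi> s powr \<mu>)"
    using \<mu> by (intro bounded_borel_mono_on mono_onI powr_mono2 Theta_mono[OF \<psi>] Theta_nonneg[OF \<psi>]) auto
  have admB: "B.admissible (\<lambda>s. s powr (\<mu> / 2))"
    using \<mu> by (intro bounded_borel_mono_on mono_onI powr_mono2) auto
  have "m powr \<mu> * norm (fun_calc (\<lambda>s. Theta \<psi> s powr \<mu>) (adjoint A \<circ> A) x)
      \<le> norm (fun_calc (\<lambda>s. s powr (\<mu> / 2)) (adjoint (sym_op A E) \<circ> sym_op A E) x)"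
    using lift by (simp add: lifting_condition_def)
  then have "(m powr \<mu> * norm (fun_calc (\<lambda>s. Theta \<psi> s powr \<mu>) (adjoint A \<circ> A) x))\<^sup>2
      \<le> (norm (fun_calc (\<lambda>s. s powr (\<mu> / 2)) (adjoint (sym_op A E) \<circ> sym_op A E) x))\<^sup>2"
    by (intro power_mono) auto
  then have "(m powr \<mu>)\<^sup>2 * (fun_calc (\<lambda>s. (Theta \<psi> s powr \<mu>)\<^sup>2) (adjoint A \<circ> A) x \<bullet> x)
      \<le> fun_calc (\<lambda>s. (s powr (\<mu> / 2))\<^sup>2) (adjoint (sym_op A E) \<circ> sym_op A E) x \<bullet> x"
    by (simp only: power_mult_distrib H.norm_fun_calc[OF admH] B.norm_fun_calc[OF admB])
  moreover have "(\<lambda>s. (Theta \<psi> s powr \<mu>)\<^sup>2) = (\<lambda>s. Theta \<psi> s powr (2 * \<mu>))"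
    by (simp add: power2_eq_square powr_add[symmetric])
  moreover have "(\<lambda>s::real. (s powr (\<mu> / 2))\<^sup>2) = (\<lambda>s. s powr \<mu>)"
    by (simp add: power2_eq_square powr_add[symmetric])
  ultimately show ?thesis using m by (intro le_inverse_scale) simp_all
qed

lemma index_less_ratio:
  assumes less: "\<phi> \<prec>\<^sub>I \<Phi>" and \<phi>: "index_function \<phi>" and s: "0 < s" "s \<le> t"
  shows "\<Phi> s * \<phi> t \<le> \<Phi> t * \<phi> s"
proof -
  have "\<Phi> s / \<phi> s \<le> \<Phi> t / \<phi> t"
    using index_functionD(1)[OF less[unfolded index_less_def]] s by simp
  moreover have "0 < \<phi> s" "0 < \<phi> t" using index_functionD(3)[OF \<phi>] s by auto
  ultimately show ?thesis by (simp add: field_simps)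
qed

theorem theorem3p2:
  fixes A :: "'x::{real_inner,complete_space} \<Rightarrow> 'y::{real_inner,complete_space}"
    and E :: "'y \<Rightarrow> 'z::{real_inner,complete_space}"
    and \<psi> \<rho> :: "real \<Rightarrow> real"
    and q :: "real \<Rightarrow> real \<Rightarrow> real"
    and m M \<gamma> \<gamma>\<^sub>s a :: real
  assumes "bounded_linear A"
    and "bounded_linear E" and "inj E"
    and "index_function \<psi>"
    and "link_condition A E \<psi> m M"
    and "operator_concave TYPE('x) (\<lambda>t. (f0 \<psi> t)\<^sup>2)"
    and "a = onorm (adjoint (sym_op A E) \<circ> sym_op A E)"
    and "regularization a q \<gamma> \<gamma>\<^sub>s"
    and "qualification a q \<gamma> \<rho>"
  shows
    "(\<exists>C. \<forall>\<phi> f \<zeta> \<delta> \<alpha>.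
        source_condition A \<phi> f \<longrightarrow> norm (adjoint E \<zeta>) \<le> 1 \<longrightarrow> 0 \<le> \<delta> \<longrightarrow>
        (\<lambda>_. 1) \<prec>\<^sub>I \<phi> \<longrightarrow> \<phi> \<prec>\<^sub>I Theta \<psi> \<longrightarrow>
        antimono_on {0<..a} (\<lambda>s. \<phi> ((f0 \<psi> s)\<^sup>2) / \<rho> s) \<longrightarrow>
        0 < \<alpha> \<longrightarrow> \<alpha> \<le> a \<longrightarrow>
        norm (f - reconstruction A E q \<alpha> (noisy_data A E f \<delta> \<zeta>))
          \<le> C * (\<phi> ((f0 \<psi> \<alpha>)\<^sup>2) + \<delta> / sqrt \<alpha>))
     \<and>
     (\<forall>\<mu> m' M'. 1 < \<mu> \<longrightarrow> lifting_condition A E \<psi> \<mu> m' M' \<longrightarrow>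
       (\<exists>C. \<forall>\<phi> f \<zeta> \<delta> \<alpha>.
          source_condition A \<phi> f \<longrightarrow> norm (adjoint E \<zeta>) \<le> 1 \<longrightarrow> 0 \<le> \<delta> \<longrightarrow>
          Theta \<psi> \<prec>\<^sub>I \<phi> \<longrightarrow> \<phi> \<prec>\<^sub>I (\<lambda>s. Theta \<psi> s powr \<mu>) \<longrightarrow>
          operator_concave TYPE('x)
            (\<lambda>t. (\<phi> (inv_into {0..} (\<lambda>s. Theta \<psi> s powr (2 * \<mu>)) t))\<^sup>2) \<longrightarrow>
          antimono_on {0<..a} (\<lambda>s. \<phi> ((f0 \<psi> s)\<^sup>2) / \<rho> s) \<longrightarrow>
          0 < \<alpha> \<longrightarrow> \<alpha> \<le> a \<longrightarrow>
          norm (f - reconstruction A E q \<alpha> (noisy_data A E f \<delta> \<zeta>))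
            \<le> C * (\<phi> ((f0 \<psi> \<alpha>)\<^sup>2) + \<delta> / sqrt \<alpha>)))"
proof (intro conjI allI impI)
  note A = assms(1) and E = assms(2) and \<psi> = assms(4) and link = assms(5)
  note bound = error_bound[OF A E \<psi> assms(7-9)]
  have m: "0 < m" "m \<le> 1" using link by (auto simp: link_condition_def)
  have \<kappa>: "1 \<le> 1 / m\<^sup>2" using m by (simp add: power_le_one)
  show "\<exists>C. \<forall>\<phi> f \<zeta> \<delta> \<alpha>.
        source_condition A \<phi> f \<longrightarrow> norm (adjoint E \<zeta>) \<le> 1 \<longrightarrow> 0 \<le> \<delta> \<longrightarrow>
        (\<lambda>_. 1) \<prec>\<^sub>I \<phi> \<longrightarrow> \<phi> \<prec>\<^sub>I Theta \<psi> \<longrightarrow>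
        antimono_on {0<..a} (\<lambda>s. \<phi> ((f0 \<psi> s)\<^sup>2) / \<rho> s) \<longrightarrow>
        0 < \<alpha> \<longrightarrow> \<alpha> \<le> a \<longrightarrow>
        norm (f - reconstruction A E q \<alpha> (noisy_data A E f \<delta> \<zeta>))
          \<le> C * (\<phi> ((f0 \<psi> \<alpha>)\<^sup>2) + \<delta> / sqrt \<alpha>)"
  proof (intro exI allI impI)
    fix \<phi> :: "real \<Rightarrow> real" and f :: 'x and \<zeta> :: 'z and \<delta> \<alpha> :: real
    assume f: "source_condition A \<phi> f" and less: "\<phi> \<prec>\<^sub>I Theta \<psi>"
      and rest: "norm (adjoint E \<zeta>) \<le> 1" "0 \<le> \<delta>"
        "antimono_on {0<..a} (\<lambda>s. \<phi> ((f0 \<psi> s)\<^sup>2) / \<rho> s)" "0 < \<alpha>" "\<alpha> \<le> a"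
    have \<phi>: "index_function \<phi>" using f by (simp add: source_condition_def)
    have ratio: "Theta \<psi> s powr 1 * \<phi> t \<le> Theta \<psi> t powr 1 * \<phi> s" if "0 < s" "s \<le> t" for s t
      using index_less_ratio[OF less \<phi> that] Theta_nonneg[OF \<psi>, of s] Theta_nonneg[OF \<psi>, of t] that by simp
    show "norm (f - reconstruction A E q \<alpha> (noisy_data A E f \<delta> \<zeta>))
          \<le> max (4 * sqrt (1 / m\<^sup>2) * \<gamma>) (sqrt ((1 + \<gamma>) * \<gamma>\<^sub>s)) * (\<phi> ((f0 \<psi> \<alpha>)\<^sup>2) + \<delta> / sqrt \<alpha>)"
      by (rule bound[where \<mu>=1 and \<phi>=\<phi>, OF zero_less_one \<kappa> link_condition_dominates[OF A E \<psi> link] f ratio rest])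
  qed
next
  fix \<mu> m' M' :: real
  note A = assms(1) and E = assms(2) and \<psi> = assms(4)
  note bound = error_bound[OF A E \<psi> assms(7-9)]
  assume "1 < \<mu>" and lift: "lifting_condition A E \<psi> \<mu> m' M'"
  then have \<mu>: "0 < \<mu>" by simp
  have m: "0 < m'" "m' \<le> 1" using lift by (auto simp: lifting_condition_def)
  then have "m' powr \<mu> \<le> 1 powr \<mu>" using \<mu> by (intro powr_mono2) auto
  then have \<kappa>: "1 \<le> 1 / (m' powr \<mu>)\<^sup>2" using m by (simp add: power_le_one)
  show "\<exists>C. \<forall>\<phi> f \<zeta> \<delta> \<alpha>.
          source_condition A \<phi> f \<longrightarrow> norm (adjoint E \<zeta>) \<le> 1 \<longrightarrow> 0 \<le> \<delta> \<longrightarrow>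
          Theta \<psi> \<prec>\<^sub>I \<phi> \<longrightarrow> \<phi> \<prec>\<^sub>I (\<lambda>s. Theta \<psi> s powr \<mu>) \<longrightarrow>
          operator_concave TYPE('x)
            (\<lambda>t. (\<phi> (inv_into {0..} (\<lambda>s. Theta \<psi> s powr (2 * \<mu>)) t))\<^sup>2) \<longrightarrow>
          antimono_on {0<..a} (\<lambda>s. \<phi> ((f0 \<psi> s)\<^sup>2) / \<rho> s) \<longrightarrow>
          0 < \<alpha> \<longrightarrow> \<alpha> \<le> a \<longrightarrow>
          norm (f - reconstruction A E q \<alpha> (noisy_data A E f \<delta> \<zeta>))
            \<le> C * (\<phi> ((f0 \<psi> \<alpha>)\<^sup>2) + \<delta> / sqrt \<alpha>)"
  proof (intro exI allI impI)
    fix \<phi> :: "real \<Rightarrow> real" and f :: 'x and \<zeta> :: 'z and \<delta> \<alpha> :: real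
    assume f: "source_condition A \<phi> f" and less: "\<phi> \<prec>\<^sub>I (\<lambda>s. Theta \<psi> s powr \<mu>)"
      and rest: "norm (adjoint E \<zeta>) \<le> 1" "0 \<le> \<delta>"
        "antimono_on {0<..a} (\<lambda>s. \<phi> ((f0 \<psi> s)\<^sup>2) / \<rho> s)" "0 < \<alpha>" "\<alpha> \<le> a"
    have \<phi>: "index_function \<phi>" using f by (simp add: source_condition_def)
    show "norm (f - reconstruction A E q \<alpha> (noisy_data A E f \<delta> \<zeta>))
          \<le> max (4 * sqrt (1 / (m' powr \<mu>)\<^sup>2) * \<gamma>) (sqrt ((1 + \<gamma>) * \<gamma>\<^sub>s)) * (\<phi> ((f0 \<psi> \<alpha>)\<^sup>2) + \<delta> / sqrt \<alpha>)"
      by (rule bound[where \<mu>=\<mu> and \<phi>=\<phi>, OF \<mu> \<kappa> lifting_condition_dominates[OF A E \<psi> \<mu> lift] f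
            index_less_ratio[OF less \<phi>] rest])
  qed
qed

end
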